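(* A map of profinite graphs $f\colon\Gamma\to\Delta$ is a regular covering if and only if there exists a fundamental system of regular good pairs for $f$.
   Context: A graph $\Gamma$ is a set that is the disjoint union of a set $V(\Gamma)$ of vertices and a set $E(\Gamma)$ of edges, with maps $s,t\colon E(\Gamma)\to V(\Gamma)$ and an involution $e\mapsto\overline e$ of $E(\Gamma)$ such that $\overline e\ne e$, $s(\overline e)=t(e)$, $t(\overline e)=s(e)$. A map of graphs sends vertices to vertices and edges to edges and commutes with $s$, $t$ and $e\mapsto\overline e$. It is locally bijective if for every vertex $v$ it restricts to a bijection from $\{e\mid s(e)=v\}$ onto $\{e'\mid s(e')=f(v)\}$. A graph is path connected if it is nonempty and any two vertices are joined by a finite edge path. A regular covering of finite path connected graphs is a locally bijective map $q\colon X\to Y$ of such graphs with $q_*\pi_1(X,x)$ normal in $\pi_1(Y,q(x))$ for a vertex $x$ (equivalently, the group of automorphisms of $X$ over $Y$ is transitive on each vertex fiber). An equivalence relation $R$ on a graph $\Gamma$ is compatible if no vertex is equivalent to an edge, if $(e_1,e_2)\in R$ for edges implies $(s(e_1),s(e_2)),(t(e_1),t(e_2)),(\overline{e_1},\overline{e_2})\in R$, and $(e,\overline e)\notin R$ for all edges $e$; thus the set $\Gamma/R$ of classes $R[x]$ is a graph. A cofinite graph is a graph with a Hausdorff uniformity in which every entourage contains a compatible cofinite entourage, i.e. an entourage that is a compatible equivalence relation with finitely many classes. A profinite graph is a compact cofinite graph (equivalently, an inverse limit of finite discrete graphs). A map of profinite graphs means a continuous map of graphs. An inverse system of maps $(f_i\colon\Gamma_i\to\Delta_i,\phi_{ij},\psi_{ij})$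 over a directed set $I$ consists of continuous maps of graphs $f_i$, and, for $j\ge i$, continuous maps of graphs $\phi_{ij}\colon\Gamma_j\to\Gamma_i$, $\psi_{ij}\colon\Delta_j\to\Delta_i$ forming inverse systems, with $f_i\phi_{ij}=\psi_{ij}f_j$. Its inverse limit is the induced continuous map $f\colon\varprojlim\Gamma_i\to\varprojlim\Delta_i$. A map of profinite graphs is a regular covering if it is the inverse limit of an inverse system in which each $f_i$ is a regular covering of path connected finite discrete graphs. For a map $f\colon\Gamma\to\Delta$ of profinite graphs and compatible cofinite entourages $R$ of $\Gamma$ and $S$ of $\Delta$, the pair $(R,S)$ is a good pair for $f$ if $(f\times f)[R]\subseteq S$ and the induced map $f_{SR}\colon\Gamma/R\to\Delta/S$, $R[x]\mapsto S[f(x)]$, is locally bijective; it is a regular good pair if in addition $f_{SR}$ is a regular covering of finite path connected graphs. A fundamental system of regular good pairs for $f$ is a family $I$ of regular good pairs such that for all entourages $V$ of $\Gamma$ and $W$ of $\Delta$ there is $(R,S)\in I$ with $R\subseteq V$ and $S\subseteq W$. *)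

theory Defs
  imports "HOL-Analysis.Analysis" "HOL-Algebra.Coset"
begin

section \<open>Graphs\<close>

record 'a graph =
  verts :: "'a set"
  edges :: "'a set"
  src :: "'a \<Rightarrow> 'a"
  tgt :: "'a \<Rightarrow> 'a"
  opp :: "'a \<Rightarrow> 'a"

definition elts :: "('a, 'm) graph_scheme \<Rightarrow> 'a set" where
  "elts G = verts G \<union> edges G"

definition is_graph :: "('a, 'm) graph_scheme \<Rightarrow> bool" where
  "is_graph G \<longleftrightarrow> verts G \<inter> edges G = {} \<and>
     (\<forall>e\<in>edges G. src G e \<in> verts G \<and> tgt G e \<in> verts G \<and>
        opp G e \<in> edges G \<and> opp G (opp G e) = e \<and> opp G e \<noteq> e \<and>
        src G (opp G e) = tgt G e \<and> tgt G (opp G e) = src G e)"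

definition graph_map ::
  "('a, 'm) graph_scheme \<Rightarrow> ('b, 'n) graph_scheme \<Rightarrow> ('a \<Rightarrow> 'b) \<Rightarrow> bool" where
  "graph_map G H f \<longleftrightarrow> f ` verts G \<subseteq> verts H \<and> f ` edges G \<subseteq> edges H \<and>
     (\<forall>e\<in>edges G. f (src G e) = src H (f e) \<and> f (tgt G e) = tgt H (f e) \<and>
        f (opp G e) = opp H (f e))"

definition locally_bijective ::
  "('a, 'm) graph_scheme \<Rightarrow> ('b, 'n) graph_scheme \<Rightarrow> ('a \<Rightarrow> 'b) \<Rightarrow> bool" where
  "locally_bijective G H f \<longleftrightarrow>
     (\<forall>v\<in>verts G. bij_betw f {e \<in> edges G. src G e = v} {e \<in> edges H. src H e = f v})"

fun edge_path :: "('a, 'm) graph_scheme \<Rightarrow> 'a \<Rightarrow> 'a list \<Rightarrow> 'a \<Rightarrow> bool" where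
  "edge_path G v [] w \<longleftrightarrow> v \<in> verts G \<and> v = w"
| "edge_path G v (e # p) w \<longleftrightarrow> e \<in> edges G \<and> src G e = v \<and> edge_path G (tgt G e) p w"

definition path_connected_graph :: "('a, 'm) graph_scheme \<Rightarrow> bool" where
  "path_connected_graph G \<longleftrightarrow>
     elts G \<noteq> {} \<and> (\<forall>v\<in>verts G. \<forall>w\<in>verts G. \<exists>p. edge_path G v p w)"


section \<open>Fundamental groups and regular coverings of finite graphs\<close>

inductive path_homotopic ::
  "('a, 'm) graph_scheme \<Rightarrow> 'a \<Rightarrow> 'a \<Rightarrow> 'a list \<Rightarrow> 'a list \<Rightarrow> bool" for G v w where
  refl: "edge_path G v p w \<Longrightarrow> path_homotopic G v w p p"
| cancel: "edge_path G v (p @ e # opp G e # q) w \<Longrightarrow>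
    path_homotopic G v w (p @ e # opp G e # q) (p @ q)"
| sym: "path_homotopic G v w p q \<Longrightarrow> path_homotopic G v w q p"
| trans: "path_homotopic G v w p q \<Longrightarrow> path_homotopic G v w q r \<Longrightarrow> path_homotopic G v w p r"

definition fundamental_group :: "('a, 'm) graph_scheme \<Rightarrow> 'a \<Rightarrow> 'a list set monoid" where
  "fundamental_group G x =
     \<lparr>carrier = {p. edge_path G x p x} // {(p, q). path_homotopic G x x p q},
      mult = (\<lambda>A B. {r. \<exists>p\<in>A. \<exists>q\<in>B. path_homotopic G x x (p @ q) r}),
      one = {r. path_homotopic G x x [] r}\<rparr>"

definition fundamental_group_map ::
  "('b, 'n) graph_scheme \<Rightarrow> ('a \<Rightarrow> 'b) \<Rightarrow> 'a \<Rightarrow> 'a list set \<Rightarrow> 'b list set" where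
  "fundamental_group_map H f x A = {r. \<exists>p\<in>A. path_homotopic H (f x) (f x) (map f p) r}"

definition regular_covering ::
  "('a, 'm) graph_scheme \<Rightarrow> ('b, 'n) graph_scheme \<Rightarrow> ('a \<Rightarrow> 'b) \<Rightarrow> bool" where
  "regular_covering X Y q \<longleftrightarrow>
     is_graph X \<and> finite (elts X) \<and> path_connected_graph X \<and>
     is_graph Y \<and> finite (elts Y) \<and> path_connected_graph Y \<and>
     graph_map X Y q \<and> locally_bijective X Y q \<and>
     (\<exists>x\<in>verts X. fundamental_group_map Y q x ` carrier (fundamental_group X x)
                    \<lhd> fundamental_group Y (q x))"


section \<open>Uniformities on a carrier set\<close>

text \<open>Relativisation of the class \<^class>\<open>uniform_space\<close> to a carrier: the uniformity is a
  filter concentrated on \<open>A \<times> A\<close>.\<close>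

definition uniformity_on :: "'a set \<Rightarrow> ('a \<times> 'a) filter \<Rightarrow> bool" where
  "uniformity_on A U \<longleftrightarrow> U \<le> principal (A \<times> A) \<and>
     (\<forall>E. eventually E U \<longrightarrow> (\<forall>x\<in>A. E (x, x))) \<and>
     (\<forall>E. eventually E U \<longrightarrow> eventually (\<lambda>(x, y). E (y, x)) U) \<and>
     (\<forall>E. eventually E U \<longrightarrow>
        (\<exists>D. eventually D U \<and> (\<forall>x y z. D (x, y) \<longrightarrow> D (y, z) \<longrightarrow> E (x, z))))"

definition uniform_topology :: "'a set \<Rightarrow> ('a \<times> 'a) filter \<Rightarrow> 'a topology" where
  "uniform_topology A U =
     topology (\<lambda>S. S \<subseteq> A \<and> (\<forall>x\<in>S. eventually (\<lambda>(x', y). x' = x \<longrightarrow> y \<in> S) U))"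

lemma openin_uniform_topology:
  "openin (uniform_topology A U) S \<longleftrightarrow>
     S \<subseteq> A \<and> (\<forall>x\<in>S. eventually (\<lambda>(x', y). x' = x \<longrightarrow> y \<in> S) U)"
proof -
  let ?P = "\<lambda>S. S \<subseteq> A \<and> (\<forall>x\<in>S. eventually (\<lambda>(x', y). x' = x \<longrightarrow> y \<in> S) U)"
  have "?P (S \<inter> T)" if S: "?P S" and T: "?P T" for S T
  proof (intro conjI ballI)
    show "S \<inter> T \<subseteq> A" using S by blast
    fix x assume "x \<in> S \<inter> T"
    then have "eventually (\<lambda>(x', y). x' = x \<longrightarrow> y \<in> S) U"
      and "eventually (\<lambda>(x', y). x' = x \<longrightarrow> y \<in> T) U" using S T by auto
    then show "eventually (\<lambda>(x', y). x' = x \<longrightarrow> y \<in> S \<inter> T) U"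
      by eventually_elim auto
  qed
  moreover have "?P (\<Union>K)" if K: "\<forall>S\<in>K. ?P S" for K
  proof (intro conjI ballI)
    show "\<Union>K \<subseteq> A" using K by blast
    fix x assume "x \<in> \<Union>K"
    then obtain S where "S \<in> K" "x \<in> S" by blast
    then have "eventually (\<lambda>(x', y). x' = x \<longrightarrow> y \<in> S) U" using K by blast
    then show "eventually (\<lambda>(x', y). x' = x \<longrightarrow> y \<in> \<Union>K) U"
      by (rule eventually_mono) (use \<open>S \<in> K\<close> in auto)
  qed
  ultimately have "istopology ?P"
    unfolding istopology_def by blast
  then show ?thesis
    by (simp add: uniform_topology_def topology_inverse')
qed

lemma topspace_uniform_topology:
  assumes "uniformity_on A U"
  shows "topspace (uniform_topology A U) = A"
proof -
  have "eventually (\<lambda>p. p \<in> A \<times> A) U"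
    using assms by (simp add: uniformity_on_def le_principal)
  then have "openin (uniform_topology A U) A"
    unfolding openin_uniform_topology by (auto elim: eventually_mono)
  then show ?thesis
    by (auto simp: topspace_def openin_uniform_topology)
qed

lemma uniformity_on_UNIV: "uniformity_on UNIV (uniformity :: ('a::uniform_space \<times> 'a) filter)"
  unfolding uniformity_on_def
  using uniformity_refl uniformity_sym uniformity_trans by auto

lemma uniform_topology_UNIV:
  "uniform_topology UNIV (uniformity :: ('a::uniform_space \<times> 'a) filter) = euclidean"
  by (simp add: topology_eq openin_uniform_topology open_uniformity)


section \<open>Cofinite and profinite graphs\<close>

record 'a unif_graph = "'a graph" +
  unif :: "('a \<times> 'a) filter"

definition entourage :: "('a, 'm) unif_graph_scheme \<Rightarrow> ('a \<times> 'a) set \<Rightarrow> bool" where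
  "entourage G W \<longleftrightarrow> W \<subseteq> elts G \<times> elts G \<and> eventually (\<lambda>p. p \<in> W) (unif G)"

definition compatible_equiv :: "('a, 'm) graph_scheme \<Rightarrow> ('a \<times> 'a) set \<Rightarrow> bool" where
  "compatible_equiv G R \<longleftrightarrow> equiv (elts G) R \<and>
     (\<forall>v\<in>verts G. \<forall>e\<in>edges G. (v, e) \<notin> R) \<and>
     (\<forall>e1\<in>edges G. \<forall>e2\<in>edges G. (e1, e2) \<in> R \<longrightarrow>
        (src G e1, src G e2) \<in> R \<and> (tgt G e1, tgt G e2) \<in> R \<and> (opp G e1, opp G e2) \<in> R) \<and>
     (\<forall>e\<in>edges G. (e, opp G e) \<notin> R)"

text \<open>For a compatible \<open>R\<close> and an edge class \<open>A\<close>, the set \<open>R `` (src G ` A)\<close> is the single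
  class of the sources of the members of \<open>A\<close>; similarly for \<open>tgt\<close>, \<open>opp\<close>, and for the
  induced map below.\<close>

definition quotient_graph :: "('a, 'm) graph_scheme \<Rightarrow> ('a \<times> 'a) set \<Rightarrow> 'a set graph" where
  "quotient_graph G R =
     \<lparr>verts = verts G // R, edges = edges G // R,
      src = (\<lambda>A. R `` (src G ` A)), tgt = (\<lambda>A. R `` (tgt G ` A)), opp = (\<lambda>A. R `` (opp G ` A))\<rparr>"

definition quotient_map_of :: "('b \<times> 'b) set \<Rightarrow> ('a \<Rightarrow> 'b) \<Rightarrow> 'a set \<Rightarrow> 'b set" where
  "quotient_map_of S f = (\<lambda>A. S `` (f ` A))"

definition compatible_cofinite_entourage ::
  "('a, 'm) unif_graph_scheme \<Rightarrow> ('a \<times> 'a) set \<Rightarrow> bool" where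
  "compatible_cofinite_entourage G R \<longleftrightarrow>
     entourage G R \<and> compatible_equiv G R \<and> finite (elts G // R)"

definition cofinite_graph :: "('a, 'm) unif_graph_scheme \<Rightarrow> bool" where
  "cofinite_graph G \<longleftrightarrow> is_graph G \<and> uniformity_on (elts G) (unif G) \<and>
     Hausdorff_space (uniform_topology (elts G) (unif G)) \<and>
     (\<forall>W. entourage G W \<longrightarrow> (\<exists>R. compatible_cofinite_entourage G R \<and> R \<subseteq> W))"

definition profinite_graph :: "('a, 'm) unif_graph_scheme \<Rightarrow> bool" where
  "profinite_graph G \<longleftrightarrow>
     cofinite_graph G \<and> compact_space (uniform_topology (elts G) (unif G))"


section \<open>Inverse systems of topological graphs\<close>

record 'a top_graph = "'a graph" +
  topo :: "'a topology"

definition top_graph_of :: "('a, 'm) unif_graph_scheme \<Rightarrow> 'a top_graph" where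
  "top_graph_of G =
     \<lparr>verts = verts G, edges = edges G, src = src G, tgt = tgt G, opp = opp G,
      topo = uniform_topology (elts G) (unif G)\<rparr>"

definition finite_discrete_graph :: "('a, 'm) top_graph_scheme \<Rightarrow> bool" where
  "finite_discrete_graph G \<longleftrightarrow>
     is_graph G \<and> finite (elts G) \<and> topo G = discrete_topology (elts G)"

definition continuous_graph_map ::
  "('a, 'm) top_graph_scheme \<Rightarrow> ('b, 'n) top_graph_scheme \<Rightarrow> ('a \<Rightarrow> 'b) \<Rightarrow> bool" where
  "continuous_graph_map G H f \<longleftrightarrow> graph_map G H f \<and> continuous_map (topo G) (topo H) f"

definition top_graph_isomorphism ::
  "('a, 'm) top_graph_scheme \<Rightarrow> ('b, 'n) top_graph_scheme \<Rightarrow> ('a \<Rightarrow> 'b) \<Rightarrow> bool" where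
  "top_graph_isomorphism G H h \<longleftrightarrow>
     graph_map G H h \<and> bij_betw h (elts G) (elts H) \<and> homeomorphic_map (topo G) (topo H) h"

definition directed_order :: "'i set \<Rightarrow> ('i \<times> 'i) set \<Rightarrow> bool" where
  "directed_order I r \<longleftrightarrow>
     I \<noteq> {} \<and> preorder_on I r \<and> (\<forall>i\<in>I. \<forall>j\<in>I. \<exists>k\<in>I. (i, k) \<in> r \<and> (j, k) \<in> r)"

text \<open>Here \<open>(i, j) \<in> r\<close> means \<open>i \<le> j\<close>, and then \<open>\<phi> i j\<close> goes from \<open>G j\<close> to \<open>G i\<close>.\<close>

definition inverse_system ::
  "'i set \<Rightarrow> ('i \<times> 'i) set \<Rightarrow> ('i \<Rightarrow> 'a top_graph) \<Rightarrow> ('i \<Rightarrow> 'i \<Rightarrow> 'a \<Rightarrow> 'a) \<Rightarrow> bool" where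
  "inverse_system I r G \<phi> \<longleftrightarrow> directed_order I r \<and>
     (\<forall>(i, j)\<in>r. continuous_graph_map (G j) (G i) (\<phi> i j)) \<and>
     (\<forall>i\<in>I. \<forall>x\<in>elts (G i). \<phi> i i x = x) \<and>
     (\<forall>(i, j)\<in>r. \<forall>(j', k)\<in>r. j' = j \<longrightarrow> (\<forall>x\<in>elts (G k). \<phi> i k x = \<phi> i j (\<phi> j k x)))"

definition inverse_limit ::
  "'i set \<Rightarrow> ('i \<times> 'i) set \<Rightarrow> ('i \<Rightarrow> 'a top_graph) \<Rightarrow> ('i \<Rightarrow> 'i \<Rightarrow> 'a \<Rightarrow> 'a) \<Rightarrow>
     ('i \<Rightarrow> 'a) top_graph" where
  "inverse_limit I r G \<phi> =
     (let threads = {x. \<forall>(i, j)\<in>r. x i = \<phi> i j (x j)};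
          V = (\<Pi>\<^sub>E i\<in>I. verts (G i)) \<inter> threads;
          E = (\<Pi>\<^sub>E i\<in>I. edges (G i)) \<inter> threads
      in \<lparr>verts = V, edges = E,
          src = (\<lambda>x. \<lambda>i\<in>I. src (G i) (x i)),
          tgt = (\<lambda>x. \<lambda>i\<in>I. tgt (G i) (x i)),
          opp = (\<lambda>x. \<lambda>i\<in>I. opp (G i) (x i)),
          topo = subtopology (product_topology (\<lambda>i. topo (G i)) I) (V \<union> E)\<rparr>)"

definition inverse_system_of_maps ::
  "'i set \<Rightarrow> ('i \<times> 'i) set \<Rightarrow> ('i \<Rightarrow> 'a top_graph) \<Rightarrow> ('i \<Rightarrow> 'b top_graph) \<Rightarrow>
     ('i \<Rightarrow> 'a \<Rightarrow> 'b) \<Rightarrow> ('i \<Rightarrow> 'i \<Rightarrow> 'a \<Rightarrow> 'a) \<Rightarrow> ('i \<Rightarrow> 'i \<Rightarrow> 'b \<Rightarrow> 'b) \<Rightarrow> bool" where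
  "inverse_system_of_maps I r G D f \<phi> \<psi> \<longleftrightarrow>
     inverse_system I r G \<phi> \<and> inverse_system I r D \<psi> \<and>
     (\<forall>i\<in>I. continuous_graph_map (G i) (D i) (f i)) \<and>
     (\<forall>(i, j)\<in>r. \<forall>x\<in>elts (G j). f i (\<phi> i j x) = \<psi> i j (f j x))"

definition limit_map :: "'i set \<Rightarrow> ('i \<Rightarrow> 'a \<Rightarrow> 'b) \<Rightarrow> ('i \<Rightarrow> 'a) \<Rightarrow> ('i \<Rightarrow> 'b)" where
  "limit_map I f = (\<lambda>x. \<lambda>i\<in>I. f i (x i))"

text \<open>Being the inverse limit is understood up to isomorphism of maps of topological graphs.\<close>

definition is_inverse_limit_of_maps ::
  "'a top_graph \<Rightarrow> 'b top_graph \<Rightarrow> ('a \<Rightarrow> 'b) \<Rightarrow>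
     'i set \<Rightarrow> ('i \<times> 'i) set \<Rightarrow> ('i \<Rightarrow> 'c top_graph) \<Rightarrow> ('i \<Rightarrow> 'd top_graph) \<Rightarrow>
     ('i \<Rightarrow> 'c \<Rightarrow> 'd) \<Rightarrow> ('i \<Rightarrow> 'i \<Rightarrow> 'c \<Rightarrow> 'c) \<Rightarrow> ('i \<Rightarrow> 'i \<Rightarrow> 'd \<Rightarrow> 'd) \<Rightarrow> bool" where
  "is_inverse_limit_of_maps \<Gamma> \<Delta> f I r G D g \<phi> \<psi> \<longleftrightarrow>
     inverse_system_of_maps I r G D g \<phi> \<psi> \<and>
     (\<exists>h k. top_graph_isomorphism \<Gamma> (inverse_limit I r G \<phi>) h \<and>
            top_graph_isomorphism \<Delta> (inverse_limit I r D \<psi>) k \<and>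
            (\<forall>x\<in>elts \<Gamma>. k (f x) = limit_map I g (h x)))"


section \<open>Regular coverings of profinite graphs\<close>

text \<open>HOL cannot quantify existentially over types, so the index type and the types carrying the
  finite graphs are parameters.\<close>

definition regular_covering_over ::
  "'i itself \<Rightarrow> 'c itself \<Rightarrow> 'd itself \<Rightarrow> 'a unif_graph \<Rightarrow> 'b unif_graph \<Rightarrow> ('a \<Rightarrow> 'b) \<Rightarrow> bool" where
  "regular_covering_over _ _ _ \<Gamma> \<Delta> f \<longleftrightarrow>
     profinite_graph \<Gamma> \<and> profinite_graph \<Delta> \<and>
     continuous_graph_map (top_graph_of \<Gamma>) (top_graph_of \<Delta>) f \<and>
     (\<exists>(I :: 'i set) r (G :: 'i \<Rightarrow> 'c top_graph) (D :: 'i \<Rightarrow> 'd top_graph) g \<phi> \<psi>.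
        (\<forall>i\<in>I. finite_discrete_graph (G i) \<and> finite_discrete_graph (D i) \<and>
               regular_covering (G i) (D i) (g i)) \<and>
        is_inverse_limit_of_maps (top_graph_of \<Gamma>) (top_graph_of \<Delta>) f I r G D g \<phi> \<psi>)"

text \<open>The types chosen here have room for the system of all \<open>\<Gamma>/R \<rightarrow> \<Delta>/S\<close>, indexed by pairs
  \<open>(R, S)\<close>. That systems over other types yield no further coverings is stated as part of the
  main theorem.\<close>

definition profinite_regular_covering ::
  "'a unif_graph \<Rightarrow> 'b unif_graph \<Rightarrow> ('a \<Rightarrow> 'b) \<Rightarrow> bool" where
  "profinite_regular_covering \<Gamma> \<Delta> f \<longleftrightarrow>
     regular_covering_over TYPE(('a \<times> 'a) set \<times> ('b \<times> 'b) set) TYPE('a set) TYPE('b set) \<Gamma> \<Delta> f"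


section \<open>Good pairs\<close>

definition good_pair ::
  "'a unif_graph \<Rightarrow> 'b unif_graph \<Rightarrow> ('a \<Rightarrow> 'b) \<Rightarrow> ('a \<times> 'a) set \<Rightarrow> ('b \<times> 'b) set \<Rightarrow> bool" where
  "good_pair \<Gamma> \<Delta> f R S \<longleftrightarrow>
     compatible_cofinite_entourage \<Gamma> R \<and> compatible_cofinite_entourage \<Delta> S \<and>
     map_prod f f ` R \<subseteq> S \<and>
     locally_bijective (quotient_graph \<Gamma> R) (quotient_graph \<Delta> S) (quotient_map_of S f)"

definition regular_good_pair ::
  "'a unif_graph \<Rightarrow> 'b unif_graph \<Rightarrow> ('a \<Rightarrow> 'b) \<Rightarrow> ('a \<times> 'a) set \<Rightarrow> ('b \<times> 'b) set \<Rightarrow> bool" where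
  "regular_good_pair \<Gamma> \<Delta> f R S \<longleftrightarrow> good_pair \<Gamma> \<Delta> f R S \<and>
     regular_covering (quotient_graph \<Gamma> R) (quotient_graph \<Delta> S) (quotient_map_of S f)"

definition fundamental_system_of_regular_good_pairs ::
  "'a unif_graph \<Rightarrow> 'b unif_graph \<Rightarrow> ('a \<Rightarrow> 'b) \<Rightarrow> (('a \<times> 'a) set \<times> ('b \<times> 'b) set) set \<Rightarrow> bool"
  where
  "fundamental_system_of_regular_good_pairs \<Gamma> \<Delta> f I \<longleftrightarrow>
     (\<forall>(R, S)\<in>I. regular_good_pair \<Gamma> \<Delta> f R S) \<and>
     (\<forall>V W. entourage \<Gamma> V \<longrightarrow> entourage \<Delta> W \<longrightarrow> (\<exists>(R, S)\<in>I. R \<subseteq> V \<and> S \<subseteq> W))"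

end

theory Submission
  imports Defs
begin

text \<open>
  Given a fundamental system of regular good pairs \<open>(R, S)\<close>, ordered by reverse inclusion, compactness
  and the Hausdorff property identify \<open>f\<close> with the limit of the maps \<open>\<Gamma>/R \<rightarrow> \<Delta>/S\<close>.

  Conversely let \<open>f\<close> be the limit of regular coverings \<open>g\<^sub>i : G\<^sub>i \<rightarrow> D\<^sub>i\<close>. The deck transformations of the
  \<open>g\<^sub>i\<close> are compatible with the bonding maps by unique lifting, so they pass to a family of automorphisms
  of \<open>\<Gamma>\<close> over \<open>\<Delta>\<close> that is transitive on the fibers of \<open>f\<close> and preserves the kernel \<open>R\<^sub>i\<close> of each projection
  \<open>\<Gamma> \<rightarrow> G\<^sub>i\<close>; moreover an automorphism that moves some vertex only within its \<open>R\<^sub>i\<close>-class is trivial modulo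
  \<open>R\<^sub>i\<close>. Hence \<open>R\<^sub>i\<close> and its image \<open>(f \<times> f)[R\<^sub>i]\<close> form a regular good pair: \<open>\<Delta>\<close> modulo the latter is the orbit
  graph of a free action on \<open>\<Gamma>/R\<^sub>i\<close>. The graph \<open>\<Gamma>/R\<^sub>i\<close> is path connected because it is isomorphic to the image of
  a single \<open>G\<^sub>j\<close> in \<open>G\<^sub>i\<close>.
\<close>

section \<open>Paths and lifting\<close>

text \<open>The bonding maps are arbitrary, so the projections of the limits to the finite levels
  need not be onto, and the given finite coverings are in general not the ones that occur between
  the quotients. The two ways of passing from finite levels to the limit are used for different
  purposes. Where a finite-level object is unique, such as the edge lift at a vertex or the deck map
  with a prescribed value at one vertex, the objects of all levels automatically form a thread.
  Where it is not unique, compactness supplies a thread through nonempty finite sets; this gives the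
  surjectivity of \<open>f\<close> and the fact that a point hit from all higher levels is hit by
  the limit. Normality in the fundamental group enters only to produce deck maps at the finite
  levels, and deck maps serve to prove normality for the quotients. A fundamental system consists of
  relations on \<Gamma> and \<Delta> themselves, hence forgets the types of the inverse system it
  came from; this is how systems over different types are compared.\<close>

lemma edge_path_ends:
  assumes "is_graph G" "edge_path G v p w"
  shows "v \<in> verts G" "w \<in> verts G"
  using assms(2) assms(1) by (induction p arbitrary: v) (auto simp: is_graph_def)

lemma edge_path_append:
  assumes "is_graph G"
  shows "edge_path G v (p @ q) w \<longleftrightarrow> (\<exists>u. edge_path G v p u \<and> edge_path G u q w)"
  by (induction p arbitrary: v) (auto dest: edge_path_ends[OF assms])

lemma edge_path_edges: "edge_path G v p w \<Longrightarrow> set p \<subseteq> edges G"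
  by (induction p arbitrary: v) auto

lemma edge_path_map:
  assumes "graph_map G H f" "edge_path G v p w"
  shows "edge_path H (f v) (map f p) (f w)"
  using assms(2) assms(1)
proof (induction p arbitrary: v)
  case Nil
  then show ?case by (auto simp: graph_map_def)
next
  case (Cons e p)
  from Cons.prems have e: "e \<in> edges G" "src G e = v" "edge_path G (tgt G e) p w" by auto
  from Cons.IH[OF e(3) Cons.prems(2)] e Cons.prems(2) show ?case
    by (force simp: graph_map_def)
qed

definition rev_path :: "('a, 'm) graph_scheme \<Rightarrow> 'a list \<Rightarrow> 'a list" where
  "rev_path G p = rev (map (opp G) p)"

lemma rev_path_simps [simp]:
  "rev_path G [] = []"
  "rev_path G (e # p) = rev_path G p @ [opp G e]"
  by (simp_all add: rev_path_def)

lemma rev_path_append [simp]: "rev_path G (p @ q) = rev_path G q @ rev_path G p"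
  by (simp add: rev_path_def)

lemma edge_path_rev:
  assumes "is_graph G" "edge_path G v p w"
  shows "edge_path G w (rev_path G p) v"
  using assms(2)
proof (induction p arbitrary: v)
  case Nil
  then show ?case by auto
next
  case (Cons e p)
  then have "edge_path G w (rev_path G p) (tgt G e)" by auto
  moreover have "edge_path G (tgt G e) [opp G e] v"
    using Cons.prems assms(1) by (auto simp: is_graph_def)
  ultimately show ?case using assms(1) by (auto simp: edge_path_append simp del: edge_path.simps)
qed

lemma rev_path_rev_path:
  assumes "is_graph G" "set p \<subseteq> edges G"
  shows "rev_path G (rev_path G p) = p"
  using assms by (induction p) (auto simp: is_graph_def)

lemma map_rev_path:
  assumes "graph_map G H f" "set p \<subseteq> edges G"
  shows "map f (rev_path G p) = rev_path H (map f p)"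
  using assms by (induction p) (auto simp: graph_map_def)

text \<open>The half of local bijectivity that forces lifts to be unique. The target graph does not
  occur in it, so it applies alike to the finite coverings, to the limit map \<open>f\<close> and to
  an identity map.\<close>

definition locally_injective ::
  "('a, 'm) graph_scheme \<Rightarrow> ('a \<Rightarrow> 'b) \<Rightarrow> bool" where
  "locally_injective G f \<longleftrightarrow>
     (\<forall>e\<in>edges G. \<forall>e'\<in>edges G. src G e = src G e' \<longrightarrow> f e = f e' \<longrightarrow> e = e')"

lemma locally_injectiveD:
  "locally_injective G f \<Longrightarrow> e \<in> edges G \<Longrightarrow> e' \<in> edges G \<Longrightarrow> src G e = src G e' \<Longrightarrow>
    f e = f e' \<Longrightarrow> e = e'"
  unfolding locally_injective_def by blast

lemma locally_bijective_imp_locally_injective: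
  assumes "is_graph G" "locally_bijective G H f"
  shows "locally_injective G f"
  using assms unfolding locally_injective_def locally_bijective_def is_graph_def bij_betw_def inj_on_def
  by simp metis

lemma locally_bijective_lift_edge:
  assumes "locally_bijective G H f" "v \<in> verts G" "d \<in> edges H" "src H d = f v"
  obtains e where "e \<in> edges G" "src G e = v" "f e = d"
proof -
  have "d \<in> f ` {e \<in> edges G. src G e = v}"
    using assms unfolding locally_bijective_def bij_betw_def by simp
  then show ?thesis using that by blast
qed

text \<open>Two edges with a common source and a common image coincide, so the paths agree edge by
  edge. The end points are not assumed equal; they come out equal, and most uses are for this second
  conclusion.\<close>

lemma path_lift_unique:
  assumes "locally_injective G f"
    and "edge_path G v p w" "edge_path G v p' w'" "map f p = map f p'"
  shows "p = p'" "w = w'"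
proof -
  have "p = p' \<and> w = w'"
    using assms(2-)
  proof (induction p arbitrary: v p')
    case Nil
    then show ?case by auto
  next
    case (Cons e p)
    then obtain e' q where [simp]: "p' = e' # q" by (cases p') auto
    have "e = e'" using Cons.prems locally_injectiveD[OF assms(1), of e e'] by auto
    then show ?case using Cons by auto
  qed
  then show "p = p'" "w = w'" by auto
qed

lemma path_lift_exists:
  assumes "is_graph G" "graph_map G H f" "locally_bijective G H f"
    and "v \<in> verts G" "edge_path H (f v) p w"
  obtains p' u where "edge_path G v p' u" "map f p' = p" "f u = w"
proof -
  have "\<exists>p' u. edge_path G v p' u \<and> map f p' = p \<and> f u = w"
    using assms(4,5)
  proof (induction p arbitrary: v)
    case Nil
    then show ?case by (intro exI[of _ "[]"] exI[of _ v]) auto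
  next
    case (Cons d p)
    then obtain e where e: "e \<in> edges G" "src G e = v" "f e = d"
      using locally_bijective_lift_edge[OF assms(3)] by (metis edge_path.simps(2))
    have "tgt G e \<in> verts G" "f (tgt G e) = tgt H d"
      using e assms(1,2) by (auto simp: is_graph_def graph_map_def)
    then obtain p' u where "edge_path G (tgt G e) p' u" "map f p' = p" "f u = w"
      using Cons by (metis edge_path.simps(2))
    then show ?case using e by (intro exI[of _ "e # p'"] exI[of _ u]) auto
  qed
  then show ?thesis using that by blast
qed

text \<open>Rigidity: a path from \<open>z\<close> to a vertex has two images under \<open>a\<close>
  and \<open>b\<close> that start together and lie over the same path, so they end together; an edge
  is then settled at its source. This makes deck maps commute with bonding maps and makes a deck map
  with a fixed vertex trivial.\<close>

lemma unique_lift: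
  assumes "is_graph Z" "path_connected_graph Z" "graph_map Z X a" "graph_map Z X b"
    and "locally_injective X q" "\<And>y. y \<in> elts Z \<Longrightarrow> q (a y) = q (b y)"
    and "z \<in> verts Z" "a z = b z" "y \<in> elts Z"
  shows "a y = b y"
proof -
  have v: "a y = b y" if y: "y \<in> verts Z" for y
  proof -
    obtain p where p: "edge_path Z z p y"
      using assms(2,7) y by (auto simp: path_connected_graph_def)
    have "edge_path X (a z) (map a p) (a y)" "edge_path X (a z) (map b p) (b y)"
      using edge_path_map[OF assms(3) p] edge_path_map[OF assms(4) p] assms(8) by auto
    moreover have "map q (map a p) = map q (map b p)"
      using edge_path_edges[OF p] assms(6) by (auto simp: elts_def)
    ultimately show ?thesis by (rule path_lift_unique(2)[OF assms(5)])
  qed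
  show ?thesis
  proof (cases "y \<in> verts Z")
    case False
    then have y: "y \<in> edges Z" using assms(9) by (auto simp: elts_def)
    then have "src Z y \<in> verts Z" using assms(1) by (auto simp: is_graph_def)
    then have "a (src Z y) = b (src Z y)" by (rule v)
    moreover have "a y \<in> edges X" "b y \<in> edges X" "src X (a y) = a (src Z y)" "src X (b y) = b (src Z y)"
      using y assms(3,4) by (auto simp: graph_map_def)
    ultimately show ?thesis
      using locally_injectiveD[OF assms(5), of "a y" "b y"] assms(6)[OF assms(9)] by simp
  qed (rule v)
qed

section \<open>Graph maps and graphs elementwise\<close>

lemma graph_mapD:
  assumes "graph_map G H f"
  shows "v \<in> verts G \<Longrightarrow> f v \<in> verts H" "e \<in> edges G \<Longrightarrow> f e \<in> edges H" "x \<in> elts G \<Longrightarrow> f x \<in> elts H"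
    "e \<in> edges G \<Longrightarrow> f (src G e) = src H (f e)" "e \<in> edges G \<Longrightarrow> f (tgt G e) = tgt H (f e)"
    "e \<in> edges G \<Longrightarrow> f (opp G e) = opp H (f e)"
  using assms by (auto simp: graph_map_def elts_def)

lemma is_graphD:
  assumes "is_graph G"
  shows "e \<in> edges G \<Longrightarrow> src G e \<in> verts G" "e \<in> edges G \<Longrightarrow> tgt G e \<in> verts G"
    "e \<in> edges G \<Longrightarrow> opp G e \<in> edges G" "v \<in> verts G \<Longrightarrow> v \<notin> edges G"
    "e \<in> edges G \<Longrightarrow> opp G e \<noteq> e"
  using assms by (auto simp: is_graph_def)

lemma verts_elts: "v \<in> verts G \<Longrightarrow> v \<in> elts G"
  and edges_elts: "e \<in> edges G \<Longrightarrow> e \<in> elts G"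
  by (auto simp: elts_def)

text \<open>Vertices and edges of the target are disjoint, so the kind of an element can be read off
  from its image.\<close>

lemma graph_map_reflects:
  assumes "graph_map G H f" "is_graph H" "x \<in> elts G"
  shows "f x \<in> verts H \<Longrightarrow> x \<in> verts G" "f x \<in> edges H \<Longrightarrow> x \<in> edges G"
  using assms by (auto simp: graph_map_def elts_def is_graph_def)

lemma path_connected_graph_image:
  assumes "path_connected_graph X" "graph_map X Y q" "q ` elts X = elts Y" "is_graph Y"
  shows "path_connected_graph Y"
  unfolding path_connected_graph_def
proof (intro conjI ballI)
  show "elts Y \<noteq> {}" using assms(1,3) by (auto simp: path_connected_graph_def)
  fix v w assume vw: "v \<in> verts Y" "w \<in> verts Y"
  then have "v \<in> q ` elts X" "w \<in> q ` elts X" using assms(3) by (simp_all add: verts_elts)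
  then obtain v' w' where "v' \<in> verts X" "v = q v'" "w' \<in> verts X" "w = q w'"
    using vw graph_map_reflects(1)[OF assms(2,4)] by blast
  then show "\<exists>p. edge_path Y v p w"
    using assms(1) edge_path_map[OF assms(2)] unfolding path_connected_graph_def by blast
qed

section \<open>The fundamental group\<close>

lemma path_homotopic_edge_path:
  assumes "is_graph G" "path_homotopic G v w p q"
  shows "edge_path G v p w" "edge_path G v q w"
proof -
  have "edge_path G v p w \<and> edge_path G v q w"
    using assms(2)
  proof induction
    case (cancel p e q)
    then have "edge_path G v (p @ q) w"
      using assms(1) by (auto simp: edge_path_append is_graph_def)
    then show ?case using cancel by blast
  qed auto
  then show "edge_path G v p w" "edge_path G v q w" by auto
qed

lemma path_homotopic_append_left:
  assumes "is_graph G" "edge_path G u r v" "path_homotopic G v w p q"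
  shows "path_homotopic G u w (r @ p) (r @ q)"
  using assms(3)
proof induction
  case (refl p)
  then show ?case using assms by (intro path_homotopic.refl) (auto simp: edge_path_append)
next
  case (cancel p e q)
  then have "edge_path G u ((r @ p) @ e # opp G e # q) w"
    using assms by (auto simp: edge_path_append)
  from path_homotopic.cancel[OF this] show ?case by simp
qed (auto intro: path_homotopic.sym path_homotopic.trans)

lemma path_homotopic_append_right:
  assumes "is_graph G" "path_homotopic G u v p q" "edge_path G v r w"
  shows "path_homotopic G u w (p @ r) (q @ r)"
  using assms(2)
proof induction
  case (refl p)
  then show ?case using assms by (intro path_homotopic.refl) (auto simp: edge_path_append)
next
  case (cancel p e q)
  have "edge_path G u ((p @ e # opp G e # q) @ r) w"
    using edge_path_append[OF assms(1), of u "p @ e # opp G e # q" r w] cancel assms(3) by blast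
  then have "edge_path G u (p @ e # opp G e # (q @ r)) w" by simp
  from path_homotopic.cancel[OF this] show ?case by simp
qed (auto intro: path_homotopic.sym path_homotopic.trans)

lemma path_homotopic_append:
  assumes "is_graph G" "path_homotopic G u v p p'" "path_homotopic G v w q q'"
  shows "path_homotopic G u w (p @ q) (p' @ q')"
  using path_homotopic.trans[OF
      path_homotopic_append_right[OF assms(1,2) path_homotopic_edge_path(1)[OF assms(1,3)]]
      path_homotopic_append_left[OF assms(1) path_homotopic_edge_path(2)[OF assms(1,2)] assms(3)]] .

text \<open>Cancellation runs from the inside out: the induction hypothesis removes the tail with
  its reverse, and then the first edge meets its opposite.\<close>

lemma path_homotopic_append_rev:
  assumes "is_graph G" "edge_path G v p w"
  shows "path_homotopic G v v (p @ rev_path G p) []"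
  using assms(2)
proof (induction p arbitrary: v)
  case Nil
  then show ?case by (auto intro: path_homotopic.refl)
next
  case (Cons e p)
  have o: "edge_path G (tgt G e) [opp G e] v" and e: "edge_path G v [e] (tgt G e)"
    using Cons.prems assms(1) by (auto simp: is_graph_def)
  have "path_homotopic G (tgt G e) (tgt G e) (p @ rev_path G p) []" using Cons by auto
  from path_homotopic_append_right[OF assms(1) this o]
  have "path_homotopic G v v ([e] @ (p @ rev_path G p) @ [opp G e]) ([e] @ [] @ [opp G e])"
    using path_homotopic_append_left[OF assms(1) e] by simp
  moreover have "path_homotopic G v v ([] @ e # opp G e # []) ([] @ [])"
    using e o by (intro path_homotopic.cancel) auto
  ultimately show ?case by (auto intro: path_homotopic.trans)
qed

lemma path_homotopic_rev_append:
  assumes "is_graph G" "edge_path G v p w"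
  shows "path_homotopic G w w (rev_path G p @ p) []"
  using path_homotopic_append_rev[OF assms(1) edge_path_rev[OF assms]]
  by (simp add: rev_path_rev_path[OF assms(1) edge_path_edges[OF assms(2)]])

lemma path_homotopic_map:
  assumes "is_graph G" "graph_map G H f" "path_homotopic G v w p q"
  shows "path_homotopic H (f v) (f w) (map f p) (map f q)"
  using assms(3)
proof induction
  case (refl p)
  then show ?case using edge_path_map[OF assms(2)] by (auto intro: path_homotopic.refl)
next
  case (cancel p e q)
  have "e \<in> edges G" using edge_path_edges[OF cancel] by auto
  then have o: "f (opp G e) = opp H (f e)" using assms(2) by (auto simp: graph_map_def)
  show ?case using edge_path_map[OF assms(2) cancel] by (auto intro: path_homotopic.cancel simp: o)
qed (auto intro: path_homotopic.sym path_homotopic.trans)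

text \<open>A cancelling pair lifts to a cancelling pair: the lift of the second edge and the
  opposite of the lift of the first start at the same vertex over the same edge, so they are equal.
  In the transitive case the middle path is lifted twice, and uniqueness of the lift identifies the
  two end points.\<close>

lemma path_homotopic_lift:
  assumes "is_graph G" "is_graph H" "graph_map G H f" "locally_bijective G H f" "v \<in> verts G"
    and "path_homotopic H (f v) w p q"
  obtains p' q' u where "edge_path G v p' u" "edge_path G v q' u" "map f p' = p" "map f q' = q"
proof -
  note inj = locally_bijective_imp_locally_injective[OF assms(1,4)]
  have "\<exists>p' q' u. edge_path G v p' u \<and> edge_path G v q' u \<and> map f p' = p \<and> map f q' = q"
    using assms(6)
  proof induction
    case (refl p)
    then show ?case using path_lift_exists[OF assms(1,3,4,5)] by metis
  next
    case (cancel p e q)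
    obtain c u where c: "edge_path G v c u" "map f c = p @ e # opp H e # q"
      using path_lift_exists[OF assms(1,3,4,5) cancel] by metis
    then obtain p' e1 e2 q' where c': "c = p' @ e1 # e2 # q'" "map f p' = p" "f e1 = e"
        "f e2 = opp H e" "map f q' = q"
      by (auto simp: map_eq_append_conv map_eq_Cons_conv)
    obtain a where a: "edge_path G v p' a" "e1 \<in> edges G" "src G e1 = a" "e2 \<in> edges G"
        "src G e2 = tgt G e1" "edge_path G (tgt G e2) q' u"
      using c(1) unfolding c' edge_path_append[OF assms(1)] by auto
    have "opp G e1 \<in> edges G" "src G (opp G e1) = tgt G e1"
      using a(2) assms(1) by (auto simp: is_graph_def)
    moreover have "f (opp G e1) = opp H e"
      using a(2) assms(3) c'(3) by (auto simp: graph_map_def)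
    ultimately have "e2 = opp G e1"
      using locally_injectiveD[OF inj, of e2 "opp G e1"] a(4,5) c'(4) by simp
    then have "edge_path G v (p' @ q') u"
      using a assms(1) by (auto simp: edge_path_append is_graph_def)
    then show ?case using c c' by (metis map_append)
  next
    case (sym p q)
    then show ?case by blast
  next
    case (trans p q r)
    then obtain p1 q1 u q2 r2 u2 where
      *: "edge_path G v p1 u" "edge_path G v q1 u" "map f p1 = p" "map f q1 = q"
      "edge_path G v q2 u2" "edge_path G v r2 u2" "map f q2 = q" "map f r2 = r" by blast
    then have "u = u2" using path_lift_unique[OF inj *(2,5)] by simp
    then show ?case using * by blast
  qed
  then show ?thesis using that by blast
qed

section \<open>The group of homotopy classes of loops\<close>

abbreviation homotopy_class :: "('a, 'm) graph_scheme \<Rightarrow> 'a \<Rightarrow> 'a list \<Rightarrow> 'a list set" where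
  "homotopy_class G x p \<equiv> {r. path_homotopic G x x p r}"

lemma homotopy_class_eq_iff:
  assumes "edge_path G x q x"
  shows "homotopy_class G x p = homotopy_class G x q \<longleftrightarrow> path_homotopic G x x p q"
proof
  assume "homotopy_class G x p = homotopy_class G x q"
  then show "path_homotopic G x x p q" using path_homotopic.refl[OF assms] by blast
qed (auto intro: path_homotopic.sym path_homotopic.trans)

lemma carrier_fundamental_group:
  "carrier (fundamental_group G x) = homotopy_class G x ` {p. edge_path G x p x}"
  by (auto simp: fundamental_group_def quotient_def Image_def)

lemma mult_fundamental_group:
  assumes "is_graph G" "edge_path G x p x" "edge_path G x q x"
  shows "homotopy_class G x p \<otimes>\<^bsub>fundamental_group G x\<^esub> homotopy_class G x q = homotopy_class G x (p @ q)"
  using assms path_homotopic.refl[of G x _ x]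
  by (auto simp: fundamental_group_def intro: path_homotopic.trans path_homotopic_append)

lemma one_fundamental_group: "\<one>\<^bsub>fundamental_group G x\<^esub> = homotopy_class G x []"
  by (simp add: fundamental_group_def)

lemma group_fundamental_group:
  assumes "is_graph G" "x \<in> verts G"
  shows "group (fundamental_group G x)"
proof (rule groupI)
  fix a b assume "a \<in> carrier (fundamental_group G x)" "b \<in> carrier (fundamental_group G x)"
  then show "a \<otimes>\<^bsub>fundamental_group G x\<^esub> b \<in> carrier (fundamental_group G x)"
    using assms(1)
    by (auto simp: carrier_fundamental_group mult_fundamental_group edge_path_append intro!: imageI) blast
next
  show "\<one>\<^bsub>fundamental_group G x\<^esub> \<in> carrier (fundamental_group G x)"
    using assms(2) by (auto simp: carrier_fundamental_group one_fundamental_group)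
next
  fix a b c assume "a \<in> carrier (fundamental_group G x)" "b \<in> carrier (fundamental_group G x)"
    "c \<in> carrier (fundamental_group G x)"
  then obtain p q r where "a = homotopy_class G x p" "b = homotopy_class G x q"
      "c = homotopy_class G x r" and e: "edge_path G x p x" "edge_path G x q x" "edge_path G x r x"
    by (auto simp: carrier_fundamental_group)
  moreover have "edge_path G x (p @ q) x" "edge_path G x (q @ r) x"
    using e assms(1) by (auto simp: edge_path_append)
  ultimately show "a \<otimes>\<^bsub>fundamental_group G x\<^esub> b \<otimes>\<^bsub>fundamental_group G x\<^esub> c =
      a \<otimes>\<^bsub>fundamental_group G x\<^esub> (b \<otimes>\<^bsub>fundamental_group G x\<^esub> c)"
    using assms(1) by (simp add: mult_fundamental_group)
next
  fix a assume "a \<in> carrier (fundamental_group G x)"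
  then obtain p where a: "a = homotopy_class G x p" and p: "edge_path G x p x"
    by (auto simp: carrier_fundamental_group)
  have n: "edge_path G x [] x" using assms(2) by simp
  show "\<one>\<^bsub>fundamental_group G x\<^esub> \<otimes>\<^bsub>fundamental_group G x\<^esub> a = a"
    using mult_fundamental_group[OF assms(1) n p] by (simp add: a one_fundamental_group)
  have r: "edge_path G x (rev_path G p) x" by (rule edge_path_rev[OF assms(1) p])
  have "homotopy_class G x (rev_path G p @ p) = homotopy_class G x []"
    by (subst homotopy_class_eq_iff[OF n]) (rule path_homotopic_rev_append[OF assms(1) p])
  then show "\<exists>b\<in>carrier (fundamental_group G x). b \<otimes>\<^bsub>fundamental_group G x\<^esub> a = \<one>\<^bsub>fundamental_group G x\<^esub>"
    using mult_fundamental_group[OF assms(1) r p] r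
    by (auto simp: a one_fundamental_group carrier_fundamental_group)
qed

lemma inv_fundamental_group:
  assumes "is_graph G" "edge_path G x p x"
  shows "inv\<^bsub>fundamental_group G x\<^esub> (homotopy_class G x p) = homotopy_class G x (rev_path G p)"
proof -
  have x: "x \<in> verts G" using edge_path_ends[OF assms] by simp
  interpret group "fundamental_group G x" by (rule group_fundamental_group[OF assms(1) x])
  have r: "edge_path G x (rev_path G p) x" by (rule edge_path_rev[OF assms])
  show ?thesis
  proof (rule inv_equality)
    have "homotopy_class G x (rev_path G p @ p) = homotopy_class G x []"
      using x by (subst homotopy_class_eq_iff) (auto intro: path_homotopic_rev_append[OF assms])
    then show "homotopy_class G x (rev_path G p) \<otimes>\<^bsub>fundamental_group G x\<^esub> homotopy_class G x p =
        \<one>\<^bsub>fundamental_group G x\<^esub>"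
      by (simp only: mult_fundamental_group[OF assms(1) r assms(2)] one_fundamental_group)
  qed (use assms r in \<open>auto simp: carrier_fundamental_group\<close>)
qed

lemma fundamental_group_map_class:
  assumes "is_graph G" "graph_map G H f" "edge_path G x p x"
  shows "fundamental_group_map H f x (homotopy_class G x p) = homotopy_class H (f x) (map f p)"
  using path_homotopic_map[OF assms(1,2)] path_homotopic.refl[OF assms(3)]
  unfolding fundamental_group_map_def by (blast intro: path_homotopic.trans)

text \<open>Turns the subgroup in the definition of a regular covering into a set of classes of
  projected loops, the form in which normality is both proved and used.\<close>

lemma fundamental_group_map_image:
  assumes "is_graph G" "graph_map G H f"
  shows "fundamental_group_map H f x ` carrier (fundamental_group G x) =
    {homotopy_class H (f x) (map f p) | p. edge_path G x p x}"
  unfolding carrier_fundamental_group image_image setcompr_eq_image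
  by (rule image_cong) (auto simp: fundamental_group_map_class[OF assms])

section \<open>Deck transformations\<close>

text \<open>To conjugate the class of the projection of \<open>p\<close> by the class of
  \<open>s\<close>, lift \<open>s\<close> from \<open>x\<close> to a path \<open>s'\<close>, let a
  deck map carry \<open>p\<close> to the end of \<open>s'\<close>, and return along
  \<open>s'\<close>. The resulting loop at \<open>x\<close> projects to the conjugate. All that is
  asked of a deck map is to be a graph map over \<open>q\<close> with one prescribed value.\<close>

lemma regular_coveringI:
  assumes X: "is_graph X" "finite (elts X)" "path_connected_graph X"
    and Y: "is_graph Y" "finite (elts Y)" "path_connected_graph Y"
    and q: "graph_map X Y q" "locally_bijective X Y q"
    and deck: "\<And>x x'. x \<in> verts X \<Longrightarrow> x' \<in> verts X \<Longrightarrow> q x = q x' \<Longrightarrow>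
      \<exists>d. graph_map X X d \<and> (\<forall>y\<in>elts X. q (d y) = q y) \<and> d x = x'"
  shows "regular_covering X Y q"
proof -
  obtain x where x: "x \<in> verts X"
    using X by (force simp: path_connected_graph_def elts_def is_graph_def)
  then have qx: "q x \<in> verts Y" using q by (auto simp: graph_map_def)
  let ?G = "fundamental_group Y (q x)"
  let ?N = "{homotopy_class Y (q x) (map q p) | p. edge_path X x p x}"
  interpret group ?G by (rule group_fundamental_group[OF Y(1) qx])
  have path: "edge_path Y (q x) (map q p) (q x)" if "edge_path X x p x" for p
    using edge_path_map[OF q(1) that] .
  have "subgroup ?N ?G"
  proof (rule subgroupI)
    show "?N \<subseteq> carrier ?G" using path by (auto simp: carrier_fundamental_group)
    show "?N \<noteq> {}" using x by (auto intro!: exI[of _ "[]"])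
    fix a assume "a \<in> ?N"
    then obtain p where a: "a = homotopy_class Y (q x) (map q p)" and p: "edge_path X x p x" by blast
    show "inv\<^bsub>?G\<^esub> a \<in> ?N"
      unfolding a inv_fundamental_group[OF Y(1) path[OF p]] map_rev_path[OF q(1) edge_path_edges[OF p], symmetric]
      using edge_path_rev[OF X(1) p] by blast
    fix b assume "b \<in> ?N"
    then obtain r where b: "b = homotopy_class Y (q x) (map q r)" and r: "edge_path X x r x" by blast
    show "a \<otimes>\<^bsub>?G\<^esub> b \<in> ?N"
      unfolding a b mult_fundamental_group[OF Y(1) path[OF p] path[OF r]]
      using p r X(1) by (auto simp: edge_path_append intro!: exI[of _ "p @ r"])
  qed
  moreover have "a \<otimes>\<^bsub>?G\<^esub> b \<otimes>\<^bsub>?G\<^esub> inv\<^bsub>?G\<^esub> a \<in> ?N" if a: "a \<in> carrier ?G" and b: "b \<in> ?N" for a b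
  proof -
    obtain s where s: "a = homotopy_class Y (q x) s" "edge_path Y (q x) s (q x)"
      using a by (auto simp: carrier_fundamental_group)
    obtain p where p: "b = homotopy_class Y (q x) (map q p)" "edge_path X x p x" using b by blast
    obtain s' x' where s': "edge_path X x s' x'" "map q s' = s" "q x' = q x"
      using path_lift_exists[OF X(1) q x s(2)] .
    have "x' \<in> verts X" using edge_path_ends[OF X(1) s'(1)] by simp
    then obtain d where d: "graph_map X X d" "\<And>y. y \<in> elts X \<Longrightarrow> q (d y) = q y" "d x = x'"
      using deck[OF x, of x'] s'(3) by auto
    have m: "map q (map d p) = map q p"
      using edge_path_edges[OF p(2)] d(2) by (auto simp: elts_def)
    let ?c = "s' @ map d p @ rev_path X s'"
    have "edge_path X x ?c x"
      unfolding edge_path_append[OF X(1)]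
      using s'(1) edge_path_map[OF d(1) p(2)] edge_path_rev[OF X(1) s'(1)] d(3) by auto
    moreover have "map q ?c = s @ map q p @ rev_path Y s"
      using s'(2) m map_rev_path[OF q(1) edge_path_edges[OF s'(1)]] by simp
    moreover have "a \<otimes>\<^bsub>?G\<^esub> b \<otimes>\<^bsub>?G\<^esub> inv\<^bsub>?G\<^esub> a = homotopy_class Y (q x) (s @ map q p @ rev_path Y s)"
    proof -
      have "edge_path Y (q x) (s @ map q p) (q x)"
        using s(2) path[OF p(2)] Y(1) by (auto simp: edge_path_append)
      then show ?thesis
        unfolding s(1) p(1) inv_fundamental_group[OF Y(1) s(2)]
        by (simp add: mult_fundamental_group[OF Y(1)] s(2) path[OF p(2)] edge_path_rev[OF Y(1)])
    qed
    ultimately show ?thesis unfolding mem_Collect_eq by metis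
  qed
  ultimately have "?N \<lhd> ?G" by (simp add: normal_inv_iff)
  then show ?thesis
    unfolding regular_covering_def using assms(1-8) x fundamental_group_map_image[OF X(1) q(1)] by auto
qed

lemma regular_coveringD:
  assumes "regular_covering X Y q"
  shows "is_graph X" "finite (elts X)" "path_connected_graph X"
    "is_graph Y" "finite (elts Y)" "path_connected_graph Y"
    "graph_map X Y q" "locally_bijective X Y q" "locally_injective X q"
  using assms locally_bijective_imp_locally_injective by (auto simp: regular_covering_def)

text \<open>For paths \<open>s\<close>, \<open>t\<close> from the base point to \<open>x\<close>, \<open>x'\<close>, conjugation by the loop \<open>q(t) q(s)\<inverse>\<close>
  turns the class of \<open>q(s) q(c) q(s)\<inverse>\<close> into that of \<open>q(t) q(c) q(t)\<inverse>\<close>.\<close>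

lemma regular_covering_closed_lift:
  assumes "regular_covering X Y q" and q: "q x = q x'"
    and c: "edge_path X x c x" and c': "edge_path X x' c' x''" and m: "map q c = map q c'"
  shows "x'' = x'"
proof -
  note X = regular_coveringD[OF assms(1)]
  obtain x0 where x0: "x0 \<in> verts X" and
    normal: "fundamental_group_map Y q x0 ` carrier (fundamental_group X x0) \<lhd> fundamental_group Y (q x0)"
    using assms(1) by (auto simp: regular_covering_def)
  let ?G = "fundamental_group Y (q x0)"
  let ?N = "{homotopy_class Y (q x0) (map q p) | p. edge_path X x0 p x0}"
  interpret normal ?N ?G
    using normal unfolding fundamental_group_map_image[OF X(1,7)] .
  have "x \<in> verts X" "x' \<in> verts X" using edge_path_ends[OF X(1)] c c' by blast+
  then obtain s t where s: "edge_path X x0 s x" and t: "edge_path X x0 t x'"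
    using X(3) x0 unfolding path_connected_graph_def by blast
  have qs: "edge_path Y (q x0) (map q s) (q x)" and qt: "edge_path Y (q x0) (map q t) (q x)"
    and qc: "edge_path Y (q x) (map q c) (q x)"
    using edge_path_map[OF X(7)] s t c q by metis+
  let ?u = "map q t @ rev_path Y (map q s)" and ?n = "map q s @ map q c @ rev_path Y (map q s)"
  have u: "edge_path Y (q x0) ?u (q x0)" and n: "edge_path Y (q x0) ?n (q x0)"
    using qs qt qc edge_path_rev[OF X(4) qs] by (auto simp: edge_path_append[OF X(4)])
  have ru: "rev_path Y ?u = map q s @ rev_path Y (map q t)"
    by (simp add: rev_path_rev_path[OF X(4) edge_path_edges[OF qs]])
  have un: "edge_path Y (q x0) (?u @ ?n) (q x0)" using u n by (auto simp: edge_path_append[OF X(4)])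
  have "edge_path X x0 (s @ c @ rev_path X s) x0"
    using s c edge_path_rev[OF X(1) s] by (auto simp: edge_path_append[OF X(1)])
  moreover have "map q (s @ c @ rev_path X s) = ?n"
    using map_rev_path[OF X(7) edge_path_edges[OF s]] by simp
  ultimately have "homotopy_class Y (q x0) ?n \<in> ?N" by (metis (mono_tags, lifting) mem_Collect_eq)
  then have "homotopy_class Y (q x0) ?u \<otimes>\<^bsub>?G\<^esub> homotopy_class Y (q x0) ?n \<otimes>\<^bsub>?G\<^esub>
      inv\<^bsub>?G\<^esub> (homotopy_class Y (q x0) ?u) \<in> ?N"
    using u by (intro inv_op_closed2) (auto simp: carrier_fundamental_group)
  then have "homotopy_class Y (q x0) ((?u @ ?n) @ rev_path Y ?u) \<in> ?N"
    by (simp only: inv_fundamental_group[OF X(4) u] mult_fundamental_group[OF X(4) u n]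
        mult_fundamental_group[OF X(4) un edge_path_rev[OF X(4) u]])
  then obtain d where d: "edge_path X x0 d x0"
    and "homotopy_class Y (q x0) ((?u @ ?n) @ rev_path Y ?u) = homotopy_class Y (q x0) (map q d)" by blast
  then have "path_homotopic Y (q x0) (q x0) ((?u @ ?n) @ rev_path Y ?u) (map q d)"
    using edge_path_map[OF X(7) d] by (simp add: homotopy_class_eq_iff)
  \<comment> \<open>The two copies of \<open>[]\<close> mark the places where
    \<open>rev_path Y (map q s) @ map q s\<close> cancels, so that the homotopy can be assembled
    segment by segment.\<close>
  moreover have "path_homotopic Y (q x0) (q x0) ((?u @ ?n) @ rev_path Y ?u)
      (map q t @ [] @ map q c @ [] @ rev_path Y (map q t))"
  proof -
    have k: "path_homotopic Y (q x) (q x) (rev_path Y (map q s) @ map q s) []"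
      by (rule path_homotopic_rev_append[OF X(4) qs])
    note R = path_homotopic.refl and A = path_homotopic_append[OF X(4)]
    have "path_homotopic Y (q x0) (q x0)
      (map q t @ (rev_path Y (map q s) @ map q s) @ map q c @ (rev_path Y (map q s) @ map q s) @ rev_path Y (map q t))
      (map q t @ [] @ map q c @ [] @ rev_path Y (map q t))"
      by (rule A[OF R[OF qt] A[OF k A[OF R[OF qc] A[OF k R[OF edge_path_rev[OF X(4) qt]]]]]])
    then show ?thesis unfolding ru by simp
  qed
  ultimately have "path_homotopic Y (q x0) (q x0) (map q d) (map q t @ map q c @ rev_path Y (map q t))"
    by (auto intro: path_homotopic.sym path_homotopic.trans)
  \<comment> \<open>Lifts of homotopic paths from \<open>x0\<close> end at the same vertex. One of
    them is a lift of the projection of the closed path \<open>d\<close> and so closes up; hence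
    \<open>l\<close>, the lift of the conjugate, closes up too.\<close>
  from path_homotopic_lift[OF X(1,4,7,8) x0 this]
  obtain d' l z where l: "edge_path X x0 d' z" "edge_path X x0 l z" "map q d' = map q d"
      "map q l = map q t @ map q c @ rev_path Y (map q t)" .
  have "z = x0" using path_lift_unique(2)[OF X(9) l(1) d l(3)] .
  from l(4) obtain t1 l2 where "l = t1 @ l2" "map q t1 = map q t" "map q l2 = map q c @ rev_path Y (map q t)"
    by (metis map_eq_append_conv)
  moreover from this(3) obtain c1 r1 where "l2 = c1 @ r1" "map q c1 = map q c"
      "map q r1 = rev_path Y (map q t)"
    by (metis map_eq_append_conv)
  ultimately have l1: "l = t1 @ c1 @ r1" "map q t1 = map q t" "map q c1 = map q c"
      "map q r1 = rev_path Y (map q t)" by simp_all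
  then obtain a b where a: "edge_path X x0 t1 a" "edge_path X a c1 b" "edge_path X b r1 x0"
    using l(2) \<open>z = x0\<close> by (auto simp: edge_path_append[OF X(1)])
  have "a = x'" using path_lift_unique(2)[OF X(9) a(1) t l1(2)] .
  then have "b = x''" using path_lift_unique(2)[OF X(9) _ c', of c1 b] a(2) l1(3) m by simp
  \<comment> \<open>Reversed, the last segment of \<open>l\<close> lifts \<open>map q t\<close> from
    \<open>x0\<close>, as \<open>t\<close> does, so its other end \<open>b\<close> is
    \<open>x'\<close>.\<close>
  have "map q (rev_path X r1) = map q t"
    using map_rev_path[OF X(7) edge_path_edges[OF a(3)]] l1(4)
      rev_path_rev_path[OF X(4) edge_path_edges[OF qt]] by simp
  from path_lift_unique(2)[OF X(9) edge_path_rev[OF X(1) a(3)] t this] show ?thesis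
    using \<open>b = x''\<close> by simp
qed

text \<open>The image of a vertex \<open>y\<close> is found by taking a path from \<open>x\<close>
  to \<open>y\<close> and lifting its projection from \<open>x'\<close>. Two such paths differ by a
  loop at \<open>x\<close>; by \<open>regular_covering_closed_lift\<close> the projection of this
  loop also lifts to a loop at \<open>x'\<close>, so the end point does not depend on the
  path.\<close>

lemma regular_covering_deck:
  assumes "regular_covering X Y q" and x: "x \<in> verts X" "x' \<in> verts X" "q x = q x'"
  shows "\<exists>d. graph_map X X d \<and> (\<forall>y\<in>elts X. q (d y) = q y) \<and> d x = x'"
proof -
  note X = regular_coveringD[OF assms(1)]
  define P where "P y z \<longleftrightarrow> (\<exists>p p'. edge_path X x p y \<and> edge_path X x' p' z \<and> map q p = map q p')" for y z
  have P_ex: "\<exists>z. P y z" if y: "y \<in> verts X" for y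
  proof -
    obtain p where p: "edge_path X x p y" using X(3) x(1) y unfolding path_connected_graph_def by blast
    have "edge_path Y (q x') (map q p) (q y)" using edge_path_map[OF X(7) p] x(3) by simp
    from path_lift_exists[OF X(1,7,8) x(2) this] obtain p' u
      where "edge_path X x' p' u" "map q p' = map q p" .
    then have "P y u" unfolding P_def by (intro exI[of _ p] exI[of _ p'] conjI p) simp_all
    then show ?thesis by blast
  qed
  have P_q: "q z = q y" if yz: "P y z" for y z
  proof -
    obtain p p' where p: "edge_path X x p y" "edge_path X x' p' z" "map q p = map q p'"
      using yz unfolding P_def by blast
    show ?thesis
      \<comment> \<open>Both projections are the same path in \<open>Y\<close> from the same vertex;
        unique lifting along the identity of \<open>Y\<close> says that they have the same
        end.\<close>
      using path_lift_unique(2)[of Y "\<lambda>e. e", OF _ edge_path_map[OF X(7) p(2)]]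
        edge_path_map[OF X(7) p(1)] p(3) x(3) by (auto simp: locally_injective_def)
  qed
  have P_unique: "z = z'" if yz: "P y z" "P y z'" for y z z'
  proof -
    obtain p p' r r' where p: "edge_path X x p y" "edge_path X x' p' z" "map q p = map q p'"
      and r: "edge_path X x r y" "edge_path X x' r' z'" "map q r = map q r'"
      using yz unfolding P_def by blast
    have z: "q z = q y" by (rule P_q[OF yz(1)])
    have zY: "z \<in> verts X" using edge_path_ends[OF X(1) p(2)] by simp
    have "edge_path Y (q z) (rev_path Y (map q r)) (q x)"
      using edge_path_rev[OF X(4) edge_path_map[OF X(7) r(1)]] z by simp
    from path_lift_exists[OF X(1,7,8) zY this]
    obtain s u where s: "edge_path X z s u" "map q s = rev_path Y (map q r)" .
    have qr: "map q (rev_path X r) = rev_path Y (map q r)"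
      using map_rev_path[OF X(7) edge_path_edges[OF r(1)]] .
    \<comment> \<open>\<open>p' @ s\<close> is the lift from \<open>x'\<close> of the projection of
      the loop \<open>p @ rev_path X r\<close> at \<open>x\<close>.\<close>
    have "u = x'"
    proof (rule regular_covering_closed_lift[OF assms(1) x(3)])
      show "edge_path X x (p @ rev_path X r) x"
        using p(1) edge_path_rev[OF X(1) r(1)] by (auto simp: edge_path_append[OF X(1)])
      show "edge_path X x' (p' @ s) u" using p(2) s(1) by (auto simp: edge_path_append[OF X(1)])
    qed (use p(3) s(2) qr in simp)
    then have "edge_path X x' (rev_path X s) z" using edge_path_rev[OF X(1) s(1)] by simp
    moreover have "map q (rev_path X s) = map q r'"
      using map_rev_path[OF X(7) edge_path_edges[OF s(1)]] s(2) r(3)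
        rev_path_rev_path[OF X(4) edge_path_edges[OF edge_path_map[OF X(7) r(1)]]] by simp
    ultimately show ?thesis using path_lift_unique(2)[OF X(9) _ r(2)] by blast
  qed
  have P_verts: "z \<in> verts X" if "P y z" for y z
    using that edge_path_ends[OF X(1)] unfolding P_def by blast
  define dv where "dv y = (THE z. P y z)" for y
  have dv: "P y (dv y)" if y: "y \<in> verts X" for y
  proof -
    obtain z where z: "P y z" using P_ex[OF y] by blast
    show ?thesis unfolding dv_def by (rule theI[of "P y", OF z]) (rule P_unique[OF _ z])
  qed
  have dv_eq: "dv y = z" if "P y z" for y z
    unfolding dv_def by (rule the_equality[of "P y", OF that]) (rule P_unique[OF _ that])
  \<comment> \<open>An edge goes to the edge over the same image at the moved source. Local
    injectivity makes it unique, so the choice below is no real choice, and compatibility with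
    \<open>opp\<close> follows by comparing two such edges.\<close>
  define Q where "Q e e' \<longleftrightarrow> e' \<in> edges X \<and> src X e' = dv (src X e) \<and> q e' = q e" for e e'
  define de where "de e = (SOME e'. Q e e')" for e
  have de: "de e \<in> edges X \<and> src X (de e) = dv (src X e) \<and> q (de e) = q e" if "e \<in> edges X" for e
  proof -
    have "src X e \<in> verts X" using that X(1) by (auto simp: is_graph_def)
    note s = dv[OF this]
    have "q e \<in> edges Y" "src Y (q e) = q (dv (src X e))"
      using X(7) that P_q[OF s] by (auto simp: graph_map_def)
    from locally_bijective_lift_edge[OF X(8) P_verts[OF s] this] obtain e'
      where "e' \<in> edges X" "src X e' = dv (src X e)" "q e' = q e" .
    then have "Q e e'" by (simp add: Q_def)
    then have "Q e (de e)" unfolding de_def by (rule someI[of "Q e"])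
    then show ?thesis by (simp add: Q_def)
  qed
  have dv_tgt: "dv (tgt X e) = tgt X (de e)" if e: "e \<in> edges X" for e
  proof (rule dv_eq)
    have "src X e \<in> verts X" using e X(1) by (auto simp: is_graph_def)
    from dv[OF this] obtain p p' where
      p: "edge_path X x p (src X e)" "edge_path X x' p' (dv (src X e))" "map q p = map q p'"
      unfolding P_def by blast
    have "edge_path X x (p @ [e]) (tgt X e)" "edge_path X x' (p' @ [de e]) (tgt X (de e))"
      "map q (p @ [e]) = map q (p' @ [de e])"
      using p e de[OF e] X(1) by (auto simp: edge_path_append[OF X(1)] is_graph_def)
    then show "P (tgt X e) (tgt X (de e))" unfolding P_def by blast
  qed
  have de_opp: "de (opp X e) = opp X (de e)" if e: "e \<in> edges X" for e
  proof (rule locally_injectiveD[OF X(9)])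
    have o: "opp X e \<in> edges X" "src X (opp X e) = tgt X e" using e X(1) by (auto simp: is_graph_def)
    show "de (opp X e) \<in> edges X" using de[OF o(1)] by simp
    show "opp X (de e) \<in> edges X" using de[OF e] X(1) by (auto simp: is_graph_def)
    show "src X (de (opp X e)) = src X (opp X (de e))"
      using de[OF o(1)] o(2) de[OF e] X(1) dv_tgt[OF e] by (auto simp: is_graph_def)
    show "q (de (opp X e)) = q (opp X (de e))"
      using de[OF o(1)] de[OF e] X(7) e by (auto simp: graph_map_def)
  qed
  define d where "d y = (if y \<in> verts X then dv y else de y)" for y
  have d_edge: "d e = de e" if "e \<in> edges X" for e
    using that X(1) by (auto simp: d_def is_graph_def)
  have d_vert: "d y = dv y" if "y \<in> verts X" for y
    using that by (simp add: d_def)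
  have "graph_map X X d"
    unfolding graph_map_def
  proof (intro conjI ballI)
    show "d ` verts X \<subseteq> verts X" using P_verts[OF dv] d_vert by (simp add: image_subset_iff)
    show "d ` edges X \<subseteq> edges X" using de d_edge by (simp add: image_subset_iff)
    fix e assume e: "e \<in> edges X"
    then have "src X e \<in> verts X" "tgt X e \<in> verts X" "opp X e \<in> edges X"
      using X(1) by (auto simp: is_graph_def)
    then show "d (src X e) = src X (d e)" "d (tgt X e) = tgt X (d e)" "d (opp X e) = opp X (d e)"
      using e de[OF e] dv_tgt[OF e] de_opp[OF e] by (simp_all add: d_edge d_vert)
  qed
  moreover have "q (d y) = q y" if "y \<in> elts X" for y
    using that P_q[OF dv] de d_edge d_vert by (auto simp: elts_def)
  moreover have "P x x'" unfolding P_def using x by (intro exI[of _ "[]"]) auto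
  then have "d x = x'" using x(1) dv_eq by (simp add: d_vert)
  ultimately show ?thesis by blast
qed

text \<open>Vertices are reached by lifting paths that start at the image of one vertex, edges by
  lifting them at a vertex over their source.\<close>

lemma locally_bijective_surj:
  assumes "is_graph X" "path_connected_graph X" "is_graph Y" "path_connected_graph Y"
    and "graph_map X Y q" "locally_bijective X Y q"
  shows "q ` elts X = elts Y"
proof -
  obtain x where x: "x \<in> verts X"
    using assms(1,2) by (force simp: path_connected_graph_def elts_def is_graph_def)
  have v: "y \<in> q ` verts X" if y: "y \<in> verts Y" for y
  proof -
    have "q x \<in> verts Y" using x assms(5) by (auto simp: graph_map_def)
    then obtain p where "edge_path Y (q x) p y" 
      using assms(4) y unfolding path_connected_graph_def by blast
    from path_lift_exists[OF assms(1,5,6) x this] obtain p' u where "edge_path X x p' u" "q u = y" .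
    then show ?thesis using edge_path_ends(2)[OF assms(1)] by blast
  qed
  have e: "d \<in> q ` edges X" if d: "d \<in> edges Y" for d
  proof -
    have "src Y d \<in> verts Y" using assms(3) d by (auto simp: is_graph_def)
    then obtain z where "z \<in> verts X" "src Y d = q z" using v by blast
    then show ?thesis using locally_bijective_lift_edge[OF assms(6) _ d] by blast
  qed
  show ?thesis using v e assms(5) by (auto simp: elts_def graph_map_def)
qed

text \<open>Quotient graphs are plain graphs, while members of an inverse system carry a topology.
  The notion depends on the graph part alone, but through the recursive \<open>edge_path\<close> and
  the inductive \<open>path_homotopic\<close>, each of which is transported along the record
  extension by its own induction.\<close>

lemma regular_covering_extend:
  assumes "regular_covering X Y q"
  shows "regular_covering (graph.extend X m) (graph.extend Y n) q"
proof -
  have p: "edge_path (graph.extend G k) v p w = edge_path G v p w" for G :: "'x graph" and k :: 'z and v p w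
    by (induction p arbitrary: v) (auto simp: graph.defs)
  have h: "path_homotopic (graph.extend G k) v w p r \<longleftrightarrow> path_homotopic G v w p r"
    (is "?A \<longleftrightarrow> ?B") for G :: "'x graph" and k :: 'z and v w p r
  proof
    show ?B if ?A using that
    proof induction
      case (cancel p e q)
      then show ?case using path_homotopic.cancel[of G v p e q w]
        unfolding p by (simp add: graph.defs)
    qed (auto simp: p intro: path_homotopic.intros)
    show ?A if ?B using that
    proof induction
      case (cancel p e q)
      then show ?case using path_homotopic.cancel[of "graph.extend G k" v p e q w]
        unfolding p by (simp add: graph.defs)
    qed (auto simp: p intro: path_homotopic.intros)
  qed
  show ?thesis
    using assms
    unfolding regular_covering_def fundamental_group_def fundamental_group_map_def h p
      path_connected_graph_def locally_bijective_def graph_map_def is_graph_def elts_def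
    by (simp add: graph.defs)
qed

section \<open>Quotient graphs\<close>

locale compatible_equivalence =
  fixes G :: "('a, 'm) graph_scheme" and R :: "('a \<times> 'a) set"
  assumes graph: "is_graph G" and compatible: "compatible_equiv G R"
begin

lemma equiv: "equiv (elts G) R"
  using compatible by (simp add: compatible_equiv_def)

lemma rel_refl: "x \<in> elts G \<Longrightarrow> (x, x) \<in> R"
  using equiv by (auto simp: equiv_def refl_on_def)

lemma rel_sym: "(x, y) \<in> R \<Longrightarrow> (y, x) \<in> R"
  using equiv by (auto simp: equiv_def dest: symD)

lemma rel_trans: "(x, y) \<in> R \<Longrightarrow> (y, z) \<in> R \<Longrightarrow> (x, z) \<in> R"
  using equiv by (auto simp: equiv_def dest: transD)

lemma in_elts: "(x, y) \<in> R \<Longrightarrow> x \<in> elts G \<and> y \<in> elts G"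
  using equiv by (auto simp: equiv_def)

lemma class_eq_iff: "x \<in> elts G \<Longrightarrow> y \<in> elts G \<Longrightarrow> R `` {x} = R `` {y} \<longleftrightarrow> (x, y) \<in> R"
  using eq_equiv_class_iff[OF equiv] by simp

lemma class_eq: "(x, y) \<in> R \<Longrightarrow> R `` {x} = R `` {y}"
  using equiv_class_eq[OF equiv] .

lemma edge_iff: "(x, y) \<in> R \<Longrightarrow> x \<in> edges G \<longleftrightarrow> y \<in> edges G"
  using compatible rel_sym[of x y] in_elts[of x y] unfolding compatible_equiv_def elts_def by blast

lemma vert_iff: "(x, y) \<in> R \<Longrightarrow> x \<in> verts G \<longleftrightarrow> y \<in> verts G"
  using edge_iff[of x y] in_elts[of x y] graph unfolding is_graph_def elts_def by blast

lemma edge_rel: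
  assumes "(e, e') \<in> R" "e \<in> edges G"
  shows "(src G e, src G e') \<in> R" "(tgt G e, tgt G e') \<in> R" "(opp G e, opp G e') \<in> R"
  using assms compatible edge_iff[OF assms(1)] unfolding compatible_equiv_def by blast+

lemma opp_not_rel: "e \<in> edges G \<Longrightarrow> (e, opp G e) \<notin> R"
  using compatible by (auto simp: compatible_equiv_def)

text \<open>The operations of a quotient graph and the induced map are defined by saturating the
  image of a whole class. This evaluates all of them at a representative.\<close>

lemma class_image_eq:
  assumes "x \<in> elts G" "equiv A S" "\<And>y. (x, y) \<in> R \<Longrightarrow> (g x, g y) \<in> S"
  shows "S `` (g ` (R `` {x})) = S `` {g x}"
proof -
  have "S `` {g y} = S `` {g x}" if "(x, y) \<in> R" for y
    using equiv_class_eq[OF assms(2) assms(3)[OF that], symmetric] .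
  then show ?thesis using rel_refl[OF assms(1)] by blast
qed

lemma quotient_graph_simps:
  assumes "e \<in> edges G"
  shows "src (quotient_graph G R) (R `` {e}) = R `` {src G e}"
    "tgt (quotient_graph G R) (R `` {e}) = R `` {tgt G e}"
    "opp (quotient_graph G R) (R `` {e}) = R `` {opp G e}"
  using assms edge_rel[OF _ assms] 
  by (auto simp: quotient_graph_def elts_def intro!: class_image_eq[OF _ equiv])

lemma verts_quotient_graph: "verts (quotient_graph G R) = (\<lambda>x. R `` {x}) ` verts G"
  by (auto simp: quotient_graph_def quotient_def)

lemma edges_quotient_graph: "edges (quotient_graph G R) = (\<lambda>x. R `` {x}) ` edges G"
  by (auto simp: quotient_graph_def quotient_def)

lemma elts_quotient_graph: "elts (quotient_graph G R) = elts G // R"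
  by (auto simp: elts_def quotient_graph_def quotient_def)

lemma is_graph_quotient: "is_graph (quotient_graph G R)"
  unfolding is_graph_def
proof (intro conjI ballI)
  show "verts (quotient_graph G R) \<inter> edges (quotient_graph G R) = {}"
  proof -
    have "R `` {v} \<noteq> R `` {e}" if "v \<in> verts G" "e \<in> edges G" for v e
      using class_eq_iff[of v e] vert_iff[of v e] that graph by (auto simp: elts_def is_graph_def)
    then show ?thesis by (auto simp: verts_quotient_graph edges_quotient_graph)
  qed
  fix A assume "A \<in> edges (quotient_graph G R)"
  then obtain e where e: "e \<in> edges G" and A: "A = R `` {e}" by (auto simp: edges_quotient_graph)
  have *: "src G e \<in> verts G" "tgt G e \<in> verts G" "opp G e \<in> edges G" "opp G (opp G e) = e"
      "src G (opp G e) = tgt G e" "tgt G (opp G e) = src G e"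
    using e graph by (auto simp: is_graph_def)
  have "R `` {opp G e} \<noteq> R `` {e}"
    using opp_not_rel[OF e] e *(3) rel_sym by (simp add: class_eq_iff elts_def) blast
  then show "src (quotient_graph G R) A \<in> verts (quotient_graph G R)"
    "tgt (quotient_graph G R) A \<in> verts (quotient_graph G R)"
    "opp (quotient_graph G R) A \<in> edges (quotient_graph G R)"
    "opp (quotient_graph G R) (opp (quotient_graph G R) A) = A"
    "opp (quotient_graph G R) A \<noteq> A"
    "src (quotient_graph G R) (opp (quotient_graph G R) A) = tgt (quotient_graph G R) A"
    "tgt (quotient_graph G R) (opp (quotient_graph G R) A) = src (quotient_graph G R) A"
    using e * by (auto simp: A quotient_graph_simps verts_quotient_graph edges_quotient_graph)
qed

lemma quotient_map_of_class:
  assumes "x \<in> elts G" "equiv A S" "map_prod f f ` R \<subseteq> S"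
  shows "quotient_map_of S f (R `` {x}) = S `` {f x}"
  unfolding quotient_map_of_def using assms by (intro class_image_eq) auto

end

lemma graph_map_quotient_map:
  assumes "compatible_equivalence G R" "compatible_equivalence H S"
    and f: "graph_map G H f" "map_prod f f ` R \<subseteq> S"
  shows "graph_map (quotient_graph G R) (quotient_graph H S) (quotient_map_of S f)"
proof -
  interpret R: compatible_equivalence G R by fact
  interpret S: compatible_equivalence H S by fact
  have *: "quotient_map_of S f (R `` {x}) = S `` {f x}" if "x \<in> elts G" for x
    using R.quotient_map_of_class[OF that S.equiv f(2)] .
  have "f e \<in> edges H \<and> src G e \<in> verts G \<and> tgt G e \<in> verts G \<and> opp G e \<in> edges G" if "e \<in> edges G" for e
    using that f(1) R.graph by (auto simp: graph_map_def is_graph_def)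
  then show ?thesis
    unfolding graph_map_def
    using f(1) by (auto simp: R.verts_quotient_graph R.edges_quotient_graph S.verts_quotient_graph
        S.edges_quotient_graph R.quotient_graph_simps S.quotient_graph_simps * elts_def graph_map_def)
qed

section \<open>Directed sets and compactness\<close>

lemma directed_order_refl: "directed_order I r \<Longrightarrow> i \<in> I \<Longrightarrow> (i, i) \<in> r"
  by (auto simp: directed_order_def preorder_on_def refl_on_def)

lemma directed_order_trans: "directed_order I r \<Longrightarrow> (i, j) \<in> r \<Longrightarrow> (j, k) \<in> r \<Longrightarrow> (i, k) \<in> r"
  by (auto simp: directed_order_def preorder_on_def dest: transD)

lemma directed_order_carrier: "directed_order I r \<Longrightarrow> (i, j) \<in> r \<Longrightarrow> i \<in> I \<and> j \<in> I"
  by (auto simp: directed_order_def preorder_on_def)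

lemma directed_order_upper_bound:
  assumes "directed_order I r" "finite F" "F \<subseteq> I"
  obtains k where "k \<in> I" "\<And>i. i \<in> F \<Longrightarrow> (i, k) \<in> r"
proof -
  have "\<exists>k\<in>I. \<forall>i\<in>F. (i, k) \<in> r"
    using assms(2,3)
  proof induction
    case empty
    then show ?case using assms(1) by (auto simp: directed_order_def)
  next
    case (insert i F)
    then obtain k where k: "k \<in> I" "\<forall>i\<in>F. (i, k) \<in> r" by auto
    obtain l where l: "l \<in> I" "(i, l) \<in> r" "(k, l) \<in> r"
      using assms(1) k(1) insert.prems unfolding directed_order_def by blast
    then have "\<forall>j\<in>insert i F. (j, l) \<in> r" using k(2) directed_order_trans[OF assms(1)] by blast
    then show ?case using l(1) by blast
  qed
  then show ?thesis using that by blast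
qed

lemma compactin_indexed_cover:
  assumes "compactin X S" "\<And>i. i \<in> I \<Longrightarrow> openin X (U i)" "S \<subseteq> (\<Union>i\<in>I. U i)"
  obtains F where "finite F" "F \<subseteq> I" "S \<subseteq> (\<Union>i\<in>F. U i)"
proof -
  have "\<And>V. V \<in> U ` I \<Longrightarrow> openin X V" "S \<subseteq> \<Union>(U ` I)" using assms(2,3) by auto
  from compactinD[OF assms(1) this] obtain K where K: "finite K" "K \<subseteq> U ` I" "S \<subseteq> \<Union>K" by auto
  from finite_subset_image[OF K(1,2)] obtain F where "F \<subseteq> I" "finite F" "K = U ` F" by blast
  then show ?thesis using that K(3) by simp
qed

text \<open>A finite subcover of a growing family lies in the member at an upper bound of its
  indices.\<close>

lemma compactin_directed_cover:
  assumes "compactin X S" "directed_order I r" "\<And>i. i \<in> I \<Longrightarrow> openin X (U i)" "S \<subseteq> (\<Union>i\<in>I. U i)"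
    and mono: "\<And>i j. (i, j) \<in> r \<Longrightarrow> U i \<subseteq> U j"
  obtains k where "k \<in> I" "S \<subseteq> U k"
proof -
  obtain F where F: "finite F" "F \<subseteq> I" "S \<subseteq> (\<Union>i\<in>F. U i)"
    using compactin_indexed_cover[OF assms(1,3,4)] .
  obtain k where k: "k \<in> I" "\<And>i. i \<in> F \<Longrightarrow> (i, k) \<in> r"
    by (rule directed_order_upper_bound[OF assms(2) F(1,2)]) (rule that)
  have "S \<subseteq> U k" using F(3) mono[OF k(2)] by blast
  then show ?thesis using that k(1) by blast
qed

text \<open>If no point were common to all \<open>C i\<close>, their growing complements would cover
  the space, so one complement would be everything.\<close>

lemma compact_space_directed_Inter_nonempty:
  assumes "compact_space X" "directed_order I r" "\<And>i. i \<in> I \<Longrightarrow> closedin X (C i)"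
    and ne: "\<And>i. i \<in> I \<Longrightarrow> C i \<noteq> {}" and mono: "\<And>i j. (i, j) \<in> r \<Longrightarrow> C j \<subseteq> C i"
  obtains x where "x \<in> topspace X" "\<And>i. i \<in> I \<Longrightarrow> x \<in> C i"
proof -
  have "\<not> topspace X \<subseteq> (\<Union>i\<in>I. topspace X - C i)"
  proof
    assume cover: "topspace X \<subseteq> (\<Union>i\<in>I. topspace X - C i)"
    obtain k where "k \<in> I" "topspace X \<subseteq> topspace X - C k"
    proof (rule compactin_directed_cover[OF _ assms(2) _ cover])
      show "compactin X (topspace X)" using assms(1) by (simp add: compact_space_def)
      show "openin X (topspace X - C i)" if "i \<in> I" for i using assms(3)[OF that] by auto
      show "topspace X - C i \<subseteq> topspace X - C j" if "(i, j) \<in> r" for i j using mono[OF that] by auto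
    qed
    moreover have "C k \<subseteq> topspace X" using closedin_subset[OF assms(3)[OF \<open>k \<in> I\<close>]] .
    ultimately show False using ne by blast
  qed
  then show ?thesis using that by blast
qed

lemma continuous_map_into_discrete:
  assumes "\<And>x. x \<in> topspace X \<Longrightarrow> f x \<in> A"
    and "\<And>x. x \<in> topspace X \<Longrightarrow> openin X {y \<in> topspace X. f y = f x}"
  shows "continuous_map X (discrete_topology A) f"
  unfolding continuous_map_def
proof (intro conjI allI impI)
  show "f \<in> topspace X \<rightarrow> topspace (discrete_topology A)" using assms(1) by auto
  fix U
  have "{x \<in> topspace X. f x \<in> U} = (\<Union>x\<in>{x \<in> topspace X. f x \<in> U}. {y \<in> topspace X. f y = f x})" by auto
  moreover have "openin X \<dots>" using assms(2) by auto
  ultimately show "openin X {x \<in> topspace X. f x \<in> U}" by simp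
qed

section \<open>Profinite graphs\<close>

locale profinite =
  fixes \<Gamma> :: "'a unif_graph"
  assumes profinite: "profinite_graph \<Gamma>"
begin

abbreviation "\<T> \<equiv> uniform_topology (elts \<Gamma>) (unif \<Gamma>)"

lemma graph: "is_graph \<Gamma>"
  and uniformity: "uniformity_on (elts \<Gamma>) (unif \<Gamma>)"
  and Hausdorff: "Hausdorff_space \<T>"
  and compact: "compact_space \<T>"
  and cofinite: "entourage \<Gamma> W \<Longrightarrow> \<exists>R. compatible_cofinite_entourage \<Gamma> R \<and> R \<subseteq> W"
  using profinite by (auto simp: profinite_graph_def cofinite_graph_def)

lemma topspace: "topspace \<T> = elts \<Gamma>"
  by (rule topspace_uniform_topology[OF uniformity])

section \<open>Entourages and open equivalence relations on a compact graph\<close>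

lemma entourage_full: "entourage \<Gamma> (elts \<Gamma> \<times> elts \<Gamma>)"
  using uniformity by (simp add: entourage_def uniformity_on_def le_principal)

lemma entourage_Int: "entourage \<Gamma> V \<Longrightarrow> entourage \<Gamma> W \<Longrightarrow> entourage \<Gamma> (V \<inter> W)"
  by (auto simp: entourage_def eventually_conj_iff)

lemma entourage_mono: "entourage \<Gamma> V \<Longrightarrow> V \<subseteq> W \<Longrightarrow> W \<subseteq> elts \<Gamma> \<times> elts \<Gamma> \<Longrightarrow> entourage \<Gamma> W"
  by (auto simp: entourage_def elim: eventually_mono)

text \<open>The factor \<open>elts \<Gamma> \<times> elts \<Gamma>\<close> gives the intersection
  its right value when \<open>F\<close> is empty.\<close>

lemma entourage_Inter:
  assumes "finite F" "\<And>i. i \<in> F \<Longrightarrow> entourage \<Gamma> (V i)"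
  shows "entourage \<Gamma> ((elts \<Gamma> \<times> elts \<Gamma>) \<inter> (\<Inter>i\<in>F. V i))"
  using assms
proof induction
  case empty
  then show ?case using entourage_full by simp
next
  case (insert i F)
  then have "entourage \<Gamma> (V i \<inter> (elts \<Gamma> \<times> elts \<Gamma> \<inter> (\<Inter>i\<in>F. V i)))"
    using entourage_Int[of "V i"] by blast
  then show ?case by (simp add: Int_left_commute)
qed

lemma entourage_class_subset:
  assumes "openin \<T> S" "x \<in> S"
  obtains R where "compatible_cofinite_entourage \<Gamma> R" "R `` {x} \<subseteq> S"
proof -
  have "eventually (\<lambda>(x', y). x' = x \<longrightarrow> y \<in> S) (unif \<Gamma>)"
    using assms by (auto simp: openin_uniform_topology)
  moreover have "eventually (\<lambda>p. p \<in> elts \<Gamma> \<times> elts \<Gamma>) (unif \<Gamma>)"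
    using entourage_full by (simp add: entourage_def)
  ultimately have "eventually (\<lambda>p. p \<in> {(a, b) \<in> elts \<Gamma> \<times> elts \<Gamma>. a = x \<longrightarrow> b \<in> S}) (unif \<Gamma>)"
    by eventually_elim auto
  then have "entourage \<Gamma> {(a, b) \<in> elts \<Gamma> \<times> elts \<Gamma>. a = x \<longrightarrow> b \<in> S}" by (auto simp: entourage_def)
  from cofinite[OF this] obtain R where "compatible_cofinite_entourage \<Gamma> R"
    "R \<subseteq> {(a, b) \<in> elts \<Gamma> \<times> elts \<Gamma>. a = x \<longrightarrow> b \<in> S}" by blast
  then show ?thesis using that by auto
qed

text \<open>The topological side of an entourage. By \<open>open_equiv_entourage\<close> the two
  sides match on a compact graph, so for kernels of projections and their images under
  \<open>f\<close> it is enough to check that classes are open.\<close>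

definition open_equiv :: "('a \<times> 'a) set \<Rightarrow> bool" where
  "open_equiv E \<longleftrightarrow> equiv (elts \<Gamma>) E \<and> (\<forall>x\<in>elts \<Gamma>. openin \<T> (E `` {x}))"

lemma compatible_cofinite_entourage_open_equiv:
  assumes "compatible_cofinite_entourage \<Gamma> R"
  shows "open_equiv R"
  unfolding open_equiv_def openin_uniform_topology
proof (intro conjI ballI)
  show eq: "equiv (elts \<Gamma>) R"
    using assms by (auto simp: compatible_cofinite_entourage_def compatible_equiv_def)
  fix x
  show "R `` {x} \<subseteq> elts \<Gamma>" using eq by (auto simp: equiv_def)
  fix y assume y: "y \<in> R `` {x}"
  have "eventually (\<lambda>p. p \<in> R) (unif \<Gamma>)"
    using assms by (auto simp: compatible_cofinite_entourage_def entourage_def)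
  then show "eventually (\<lambda>(x', z). x' = y \<longrightarrow> z \<in> R `` {x}) (unif \<Gamma>)"
    by (rule eventually_mono) (use y eq in \<open>auto simp: equiv_def dest: transD\<close>)
qed

lemma open_equiv_closed_class:
  assumes "open_equiv E" "x \<in> elts \<Gamma>"
  shows "closedin \<T> (E `` {x})"
proof -
  have eq: "equiv (elts \<Gamma>) E" using assms by (simp add: open_equiv_def)
  have "elts \<Gamma> - E `` {x} = (\<Union>y\<in>elts \<Gamma> - E `` {x}. E `` {y})"
  proof (intro equalityI subsetI)
    fix y assume "y \<in> elts \<Gamma> - E `` {x}"
    then show "y \<in> (\<Union>y\<in>elts \<Gamma> - E `` {x}. E `` {y})" using eq by (auto simp: equiv_def refl_on_def)
  next
    fix z assume "z \<in> (\<Union>y\<in>elts \<Gamma> - E `` {x}. E `` {y})"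
    then obtain y where "y \<in> elts \<Gamma>" "(x, y) \<notin> E" "(y, z) \<in> E" by auto
    then show "z \<in> elts \<Gamma> - E `` {x}" using eq by (auto simp: equiv_def dest: transD symD)
  qed
  moreover have "openin \<T> \<dots>" using assms(1) by (auto simp: open_equiv_def)
  moreover have "E `` {x} \<subseteq> elts \<Gamma>" using eq by (auto simp: equiv_def)
  ultimately show ?thesis by (simp add: closedin_def topspace)
qed

text \<open>By compactness, finitely many entourages suffice to refine all classes.\<close>

lemma open_equiv_entourage:
  assumes "open_equiv E"
  shows "entourage \<Gamma> E"
proof -
  have eq: "equiv (elts \<Gamma>) E" using assms by (simp add: open_equiv_def)
  have "\<exists>R. compatible_cofinite_entourage \<Gamma> R \<and> R `` {x} \<subseteq> E `` {x}" if "x \<in> elts \<Gamma>" for x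
  proof -
    have "openin \<T> (E `` {x})" "x \<in> E `` {x}"
      using assms that eq by (auto simp: open_equiv_def equiv_def refl_on_def)
    from entourage_class_subset[OF this] show ?thesis by metis
  qed
  then obtain R where R: "\<And>x. x \<in> elts \<Gamma> \<Longrightarrow> compatible_cofinite_entourage \<Gamma> (R x)"
    "\<And>x. x \<in> elts \<Gamma> \<Longrightarrow> R x `` {x} \<subseteq> E `` {x}" by metis
  have oe: "open_equiv (R x)" if "x \<in> elts \<Gamma>" for x
    using compatible_cofinite_entourage_open_equiv[OF R(1)[OF that]] .
  obtain F where F: "finite F" "F \<subseteq> elts \<Gamma>" "elts \<Gamma> \<subseteq> (\<Union>x\<in>F. R x `` {x})"
  proof (rule compactin_indexed_cover[of \<T> "elts \<Gamma>" "elts \<Gamma>" "\<lambda>x. R x `` {x}"])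
    show "compactin \<T> (elts \<Gamma>)" using compact by (simp add: compact_space_def topspace)
    show "openin \<T> (R x `` {x})" if "x \<in> elts \<Gamma>" for x
      using oe[OF that] that by (simp add: open_equiv_def)
    show "elts \<Gamma> \<subseteq> (\<Union>x\<in>elts \<Gamma>. R x `` {x})"
      using oe by (fastforce simp: open_equiv_def equiv_def refl_on_def)
  qed
  have "entourage \<Gamma> ((elts \<Gamma> \<times> elts \<Gamma>) \<inter> (\<Inter>x\<in>F. R x))"
    using F R(1) by (intro entourage_Inter) (auto simp: compatible_cofinite_entourage_def)
  moreover have "(elts \<Gamma> \<times> elts \<Gamma>) \<inter> (\<Inter>x\<in>F. R x) \<subseteq> E"
  proof clarify
    fix a b assume ab: "a \<in> elts \<Gamma>" "(a, b) \<in> (\<Inter>x\<in>F. R x)"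
    then obtain x where x: "x \<in> F" "(x, a) \<in> R x" using F(3) by auto
    have "equiv (elts \<Gamma>) (R x)" using oe x(1) F(2) by (auto simp: open_equiv_def)
    then have "(x, b) \<in> R x" using ab(2) x by (auto simp: equiv_def dest: transD)
    then have "(x, a) \<in> E" "(x, b) \<in> E" using x R(2)[of x] F(2) by auto
    then show "(a, b) \<in> E" using eq by (auto simp: equiv_def dest: transD symD)
  qed
  moreover have "E \<subseteq> elts \<Gamma> \<times> elts \<Gamma>" using eq by (auto simp: equiv_def)
  ultimately show ?thesis by (rule entourage_mono)
qed

text \<open>Compactness is used twice. Take a compatible \<open>R\<close> inside \<open>V\<close>.
  For a fixed \<open>x\<close> the complement of its \<open>R\<close>-class is compact and covered
  by the growing complements of the \<open>E i\<close>-classes of \<open>x\<close>, so one of these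
  classes lies in the \<open>R\<close>-class. Finitely many classes obtained in this way cover
  \<Gamma>, and an index above all of theirs works for every point.\<close>

lemma separating_family_refines:
  assumes I: "directed_order I r" and E: "\<And>i. i \<in> I \<Longrightarrow> open_equiv (E i)"
    and mono: "\<And>i j. (i, j) \<in> r \<Longrightarrow> E j \<subseteq> E i"
    and sep: "\<And>x y. x \<in> elts \<Gamma> \<Longrightarrow> y \<in> elts \<Gamma> \<Longrightarrow> (\<And>i. i \<in> I \<Longrightarrow> (x, y) \<in> E i) \<Longrightarrow> x = y"
    and V: "entourage \<Gamma> V"
  obtains i where "i \<in> I" "E i \<subseteq> V"
proof -
  obtain R where R: "compatible_cofinite_entourage \<Gamma> R" "R \<subseteq> V" using cofinite[OF V] by blast
  have oR: "open_equiv R" using compatible_cofinite_entourage_open_equiv[OF R(1)] .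
  then have eqR: "equiv (elts \<Gamma>) R" by (simp add: open_equiv_def)
  have "\<exists>i\<in>I. E i `` {x} \<subseteq> R `` {x}" if x: "x \<in> elts \<Gamma>" for x
  proof -
    obtain i where "i \<in> I" "elts \<Gamma> - R `` {x} \<subseteq> elts \<Gamma> - E i `` {x}"
    proof (rule compactin_directed_cover[OF _ I, of \<T> "elts \<Gamma> - R `` {x}" "\<lambda>i. elts \<Gamma> - E i `` {x}"])
      have "openin \<T> (R `` {x})" using oR x by (simp add: open_equiv_def)
      then have "closedin \<T> (elts \<Gamma> - R `` {x})" by (metis closedin_diff closedin_topspace topspace)
      then show "compactin \<T> (elts \<Gamma> - R `` {x})" by (rule closedin_compact_space[OF compact])
      show "openin \<T> (elts \<Gamma> - E i `` {x})" if "i \<in> I" for i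
        using open_equiv_closed_class[OF E[OF that] x] by (simp add: closedin_def topspace)
      show "elts \<Gamma> - R `` {x} \<subseteq> (\<Union>i\<in>I. elts \<Gamma> - E i `` {x})"
      proof
        fix y assume y: "y \<in> elts \<Gamma> - R `` {x}"
        then have "y \<noteq> x" using x eqR by (auto simp: equiv_def refl_on_def)
        then obtain i where "i \<in> I" "(x, y) \<notin> E i" using sep[OF x, of y] y by blast
        then show "y \<in> (\<Union>i\<in>I. elts \<Gamma> - E i `` {x})" using y by blast
      qed
      show "elts \<Gamma> - E i `` {x} \<subseteq> elts \<Gamma> - E j `` {x}" if "(i, j) \<in> r" for i j
        using mono[OF that] by blast
    qed
    moreover have "E i `` {x} \<subseteq> elts \<Gamma>"
      using E[OF \<open>i \<in> I\<close>] by (auto simp: open_equiv_def equiv_def)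
    ultimately show ?thesis by blast
  qed
  then obtain c where c: "\<And>x. x \<in> elts \<Gamma> \<Longrightarrow> c x \<in> I" "\<And>x. x \<in> elts \<Gamma> \<Longrightarrow> E (c x) `` {x} \<subseteq> R `` {x}" by metis
  obtain F where F: "finite F" "F \<subseteq> elts \<Gamma>" "elts \<Gamma> \<subseteq> (\<Union>x\<in>F. E (c x) `` {x})"
  proof (rule compactin_indexed_cover[of \<T> "elts \<Gamma>" "elts \<Gamma>" "\<lambda>x. E (c x) `` {x}"])
    show "compactin \<T> (elts \<Gamma>)" using compact by (simp add: compact_space_def topspace)
    show "openin \<T> (E (c x) `` {x})" if "x \<in> elts \<Gamma>" for x
      using E[OF c(1)[OF that]] that by (simp add: open_equiv_def)
    show "elts \<Gamma> \<subseteq> (\<Union>x\<in>elts \<Gamma>. E (c x) `` {x})"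
      using E[OF c(1)] by (fastforce simp: open_equiv_def equiv_def refl_on_def)
  qed
  have "finite (c ` F)" "c ` F \<subseteq> I" using F(1,2) c(1) by auto
  then obtain k where k: "k \<in> I" "\<And>x. x \<in> F \<Longrightarrow> (c x, k) \<in> r"
    by (rule directed_order_upper_bound[OF I]) (rule that, auto)
  have "E k \<subseteq> R"
  proof clarify
    fix a b assume ab: "(a, b) \<in> E k"
    have "a \<in> elts \<Gamma>" using ab E[OF k(1)] by (auto simp: open_equiv_def equiv_def)
    then obtain x where x: "x \<in> F" "(x, a) \<in> E (c x)" using F(3) by auto
    have "(a, b) \<in> E (c x)" using ab mono[OF k(2)[OF x(1)]] by auto
    moreover have "equiv (elts \<Gamma>) (E (c x))" using E[OF c(1)] x(1) F(2) by (auto simp: open_equiv_def)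
    ultimately have "(x, b) \<in> E (c x)" using x(2) by (auto simp: equiv_def dest: transD)
    then have "(x, a) \<in> R" "(x, b) \<in> R" using c(2)[of x] x F(2) by auto
    then show "(a, b) \<in> R" using eqR by (auto simp: equiv_def dest: transD symD)
  qed
  then show ?thesis using that k(1) R(2) by blast
qed

lemma entourages_separate:
  assumes "x \<in> elts \<Gamma>" "y \<in> elts \<Gamma>" "x \<noteq> y"
  obtains R where "compatible_cofinite_entourage \<Gamma> R" "(x, y) \<notin> R"
proof -
  obtain U V where UV: "openin \<T> U" "openin \<T> V" "x \<in> U" "y \<in> V" "disjnt U V"
    using Hausdorff assms unfolding Hausdorff_space_def topspace by blast
  obtain R where "compatible_cofinite_entourage \<Gamma> R" "R `` {x} \<subseteq> U"
    using entourage_class_subset[OF UV(1,3)] .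
  then show ?thesis using that UV(4,5) by (auto simp: disjnt_iff)
qed

lemma compatible_equivalence:
  "compatible_cofinite_entourage \<Gamma> R \<Longrightarrow> compatible_equivalence \<Gamma> R"
  by unfold_locales (auto simp: graph compatible_cofinite_entourage_def)

end

section \<open>The inverse system of finite quotients\<close>

text \<open>Formed by record extension so that \<open>regular_covering_extend\<close> carries
  regular coverings over to it.\<close>

definition quotient_top_graph :: "('a, 'm) graph_scheme \<Rightarrow> ('a \<times> 'a) set \<Rightarrow> 'a set top_graph" where
  "quotient_top_graph G R =
     graph.extend (quotient_graph G R) (top_graph.fields (discrete_topology (elts G // R)))"

lemma quotient_top_graph_simps [simp]:
  "verts (quotient_top_graph G R) = verts (quotient_graph G R)"
  "edges (quotient_top_graph G R) = edges (quotient_graph G R)"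
  "src (quotient_top_graph G R) = src (quotient_graph G R)"
  "tgt (quotient_top_graph G R) = tgt (quotient_graph G R)"
  "opp (quotient_top_graph G R) = opp (quotient_graph G R)"
  "topo (quotient_top_graph G R) = discrete_topology (elts G // R)"
  "elts (quotient_top_graph G R) = elts (quotient_graph G R)"
  by (simp_all add: quotient_top_graph_def graph.defs top_graph.defs elts_def)

lemma graph_map_quotient_top_graph:
  "graph_map (quotient_top_graph G R) (quotient_top_graph H S) f \<longleftrightarrow>
     graph_map (quotient_graph G R) (quotient_graph H S) f"
  by (simp add: graph_map_def)

lemma top_graph_of_simps [simp]:
  "verts (top_graph_of G) = verts G" "edges (top_graph_of G) = edges G"
  "src (top_graph_of G) = src G" "tgt (top_graph_of G) = tgt G" "opp (top_graph_of G) = opp G"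
  "topo (top_graph_of G) = uniform_topology (elts G) (unif G)" "elts (top_graph_of G) = elts G"
  by (simp_all add: top_graph_of_def elts_def)

lemma finite_discrete_quotient:
  assumes "compatible_equivalence G R" "finite (elts G // R)"
  shows "finite_discrete_graph (quotient_top_graph G R)"
proof -
  interpret compatible_equivalence G R by fact
  show ?thesis
    using is_graph_quotient assms(2)
    by (simp add: finite_discrete_graph_def elts_quotient_graph is_graph_def)
qed

lemma continuous_quotient_map:
  assumes "compatible_equivalence G R" "compatible_equivalence H S"
    and f: "graph_map G H f" "map_prod f f ` R \<subseteq> S"
  shows "continuous_graph_map (quotient_top_graph G R) (quotient_top_graph H S) (quotient_map_of S f)"
proof -
  interpret R: compatible_equivalence G R by fact
  interpret S: compatible_equivalence H S by fact
  have m: "graph_map (quotient_graph G R) (quotient_graph H S) (quotient_map_of S f)"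
    by (rule graph_map_quotient_map[OF assms])
  then have "quotient_map_of S f \<in> elts (quotient_graph G R) \<rightarrow> elts (quotient_graph H S)"
    by (auto simp: graph_map_def elts_def)
  with m show ?thesis
    by (simp add: continuous_graph_map_def graph_map_quotient_top_graph R.elts_quotient_graph S.elts_quotient_graph)
qed

text \<open>Index set and relations are kept apart so that the locale can be instantiated twice over
  one directed set of pairs \<open>(R, S)\<close>: by \<open>fst\<close> for \<Gamma> and by
  \<open>snd\<close> for \<Delta>.\<close>

locale quotient_system = profinite \<Gamma> for \<Gamma> :: "'a unif_graph" +
  fixes I :: "'i set" and r :: "('i \<times> 'i) set" and E :: "'i \<Rightarrow> ('a \<times> 'a) set"
  assumes directed: "directed_order I r"
    and E: "i \<in> I \<Longrightarrow> compatible_cofinite_entourage \<Gamma> (E i)"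
    and antimono: "(i, j) \<in> r \<Longrightarrow> E j \<subseteq> E i"
    and fundamental: "entourage \<Gamma> V \<Longrightarrow> \<exists>i\<in>I. E i \<subseteq> V"
begin

definition Q :: "'i \<Rightarrow> 'a set top_graph" where "Q i = quotient_top_graph \<Gamma> (E i)"

definition \<phi> :: "'i \<Rightarrow> 'i \<Rightarrow> 'a set \<Rightarrow> 'a set" where "\<phi> i j = quotient_map_of (E i) id"

definition proj :: "'a \<Rightarrow> 'i \<Rightarrow> 'a set" where "proj x = (\<lambda>i\<in>I. E i `` {x})"

lemma compatible: "i \<in> I \<Longrightarrow> compatible_equivalence \<Gamma> (E i)"
  by (intro compatible_equivalence E)

lemma \<phi>_class: "(i, j) \<in> r \<Longrightarrow> x \<in> elts \<Gamma> \<Longrightarrow> \<phi> i j (E j `` {x}) = E i `` {x}"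
  unfolding \<phi>_def
  using compatible_equivalence.quotient_map_of_class[OF compatible, of j x "elts \<Gamma>" "E i" id]
    compatible_equivalence.equiv[OF compatible, of i] antimono[of i j] directed_order_carrier[OF directed, of i j]
  by (simp add: prod.map_id0)

lemma elts_Q: "i \<in> I \<Longrightarrow> elts (Q i) = (\<lambda>x. E i `` {x}) ` elts \<Gamma>"
  using compatible_equivalence.elts_quotient_graph[OF compatible]
  by (auto simp: Q_def quotient_def)

lemma inverse_system_Q: "inverse_system I r Q \<phi>"
  unfolding inverse_system_def
proof (intro conjI ballI; clarify?)
  show "directed_order I r" by (rule directed)
  fix i j assume ij: "(i, j) \<in> r"
  then have I: "i \<in> I" "j \<in> I" using directed_order_carrier[OF directed] by auto
  show "continuous_graph_map (Q j) (Q i) (\<phi> i j)"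
    unfolding Q_def \<phi>_def using antimono[OF ij]
    by (intro continuous_quotient_map compatible I) (auto simp: graph_map_def map_prod_def)
  fix k x assume jk: "(j, k) \<in> r" and x: "x \<in> elts (Q k)"
  then have "k \<in> I" "(i, k) \<in> r" using directed_order_carrier[OF directed] directed_order_trans[OF directed ij] by auto
  then show "\<phi> i k x = \<phi> i j (\<phi> j k x)" using x ij jk by (auto simp: elts_Q \<phi>_class)
next
  fix i x assume "i \<in> I" "x \<in> elts (Q i)"
  then show "\<phi> i i x = x" using directed_order_refl[OF directed] by (auto simp: elts_Q \<phi>_class)
qed

lemma inj_proj: "inj_on proj (elts \<Gamma>)"
proof (rule inj_onI, rule ccontr)
  fix x y assume xy: "x \<in> elts \<Gamma>" "y \<in> elts \<Gamma>" "proj x = proj y" "x \<noteq> y"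
  obtain R where R: "compatible_cofinite_entourage \<Gamma> R" "(x, y) \<notin> R"
    using entourages_separate[OF xy(1,2,4)] .
  then obtain i where i: "i \<in> I" "E i \<subseteq> R"
    using fundamental by (auto simp: compatible_cofinite_entourage_def)
  have "E i `` {x} = E i `` {y}" using fun_cong[OF xy(3), of i] i(1) by (simp add: proj_def)
  then have "(x, y) \<in> E i" using compatible_equivalence.class_eq_iff[OF compatible[OF i(1)] xy(1,2)] by simp
  then show False using i(2) R(2) by blast
qed

text \<open>A thread of classes is a family of nonempty closed subsets of \<Gamma> that shrinks
  along the order. Compactness gives a point in all of them, and this point represents every class
  of the thread.\<close>

lemma thread_proj:
  assumes t: "t \<in> (\<Pi>\<^sub>E i\<in>I. elts (Q i))" "\<And>i j. (i, j) \<in> r \<Longrightarrow> t i = \<phi> i j (t j)"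
  obtains x where "x \<in> elts \<Gamma>" "t = proj x"
proof -
  have t_class: "\<exists>x\<in>elts \<Gamma>. t i = E i `` {x}" if "i \<in> I" for i
    using PiE_mem[OF t(1) that] elts_Q[OF that] by auto
  have "\<exists>x. x \<in> topspace \<T> \<and> (\<forall>i\<in>I. x \<in> t i)"
  proof (rule compact_space_directed_Inter_nonempty[OF compact directed, of t])
    fix i assume i: "i \<in> I"
    obtain x where x: "x \<in> elts \<Gamma>" "t i = E i `` {x}" using t_class[OF i] by blast
    have "open_equiv (E i)" using compatible_cofinite_entourage_open_equiv[OF E[OF i]] .
    then show "closedin \<T> (t i)" unfolding x(2) using x(1) by (rule open_equiv_closed_class)
    show "t i \<noteq> {}" using x compatible_equivalence.rel_refl[OF compatible[OF i]] by auto
  next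
    fix i j assume ij: "(i, j) \<in> r"
    then have I: "i \<in> I" "j \<in> I" using directed_order_carrier[OF directed] by auto
    obtain x where x: "x \<in> elts \<Gamma>" "t j = E j `` {x}" using t_class[OF I(2)] by blast
    then show "t j \<subseteq> t i" using t(2)[OF ij] \<phi>_class[OF ij] antimono[OF ij] by auto
  qed blast
  then obtain x where x: "x \<in> topspace \<T>" "\<And>i. i \<in> I \<Longrightarrow> x \<in> t i" by blast
  have "t i = E i `` {x}" if i: "i \<in> I" for i
    using t_class[OF i] x(2)[OF i] compatible_equivalence.class_eq[OF compatible[OF i]] by force
  then have "t = proj x" using PiE_arb[OF t(1)] by (auto simp: proj_def fun_eq_iff)
  then show ?thesis using that x(1) topspace by blast
qed

abbreviation "L \<equiv> inverse_limit I r Q \<phi>"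

lemma L_simps:
  "verts L = (\<Pi>\<^sub>E i\<in>I. verts (Q i)) \<inter> {t. \<forall>(i, j)\<in>r. t i = \<phi> i j (t j)}"
  "edges L = (\<Pi>\<^sub>E i\<in>I. edges (Q i)) \<inter> {t. \<forall>(i, j)\<in>r. t i = \<phi> i j (t j)}"
  "src L t = (\<lambda>i\<in>I. src (Q i) (t i))" "tgt L t = (\<lambda>i\<in>I. tgt (Q i) (t i))"
  "opp L t = (\<lambda>i\<in>I. opp (Q i) (t i))"
  "topo L = subtopology (product_topology (\<lambda>i. topo (Q i)) I) (elts L)"
  by (simp_all add: inverse_limit_def Let_def elts_def)

lemma proj_thread: "x \<in> elts \<Gamma> \<Longrightarrow> (i, j) \<in> r \<Longrightarrow> proj x i = \<phi> i j (proj x j)"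
  using directed_order_carrier[OF directed, of i j] \<phi>_class[of i j x] by (simp add: proj_def)

lemma graph_map_proj: "graph_map \<Gamma> L proj"
  unfolding graph_map_def
proof (intro conjI ballI)
  have v: "E i `` {x} \<in> verts (Q i)" if "i \<in> I" "x \<in> verts \<Gamma>" for i x
    using that compatible_equivalence.verts_quotient_graph[OF compatible] by (simp add: Q_def)
  have e: "E i `` {x} \<in> edges (Q i)" if "i \<in> I" "x \<in> edges \<Gamma>" for i x
    using that compatible_equivalence.edges_quotient_graph[OF compatible] by (simp add: Q_def)
  show "proj ` verts \<Gamma> \<subseteq> verts L"
  proof clarify
    fix x assume x: "x \<in> verts \<Gamma>"
    then have "proj x \<in> (\<Pi>\<^sub>E i\<in>I. verts (Q i))" using v by (auto simp: proj_def)
    then show "proj x \<in> verts L" using proj_thread[of x] x by (auto simp: L_simps elts_def)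
  qed
  show "proj ` edges \<Gamma> \<subseteq> edges L"
  proof clarify
    fix x assume x: "x \<in> edges \<Gamma>"
    then have "proj x \<in> (\<Pi>\<^sub>E i\<in>I. edges (Q i))" using e by (auto simp: proj_def)
    then show "proj x \<in> edges L" using proj_thread[of x] x by (auto simp: L_simps elts_def)
  qed
  fix x assume "x \<in> edges \<Gamma>"
  then show "proj (src \<Gamma> x) = src L (proj x)" "proj (tgt \<Gamma> x) = tgt L (proj x)"
    "proj (opp \<Gamma> x) = opp L (proj x)"
    using compatible_equivalence.quotient_graph_simps[OF compatible]
    by (auto simp: L_simps Q_def proj_def fun_eq_iff restrict_def)
qed

text \<open>A continuous bijection from a compact space to a Hausdorff space is a homeomorphism.
  Continuity holds coordinatewise because classes are open.\<close>

lemma isomorphism_proj: "top_graph_isomorphism (top_graph_of \<Gamma>) L proj"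
proof -
  have "proj ` elts \<Gamma> = elts L"
  proof
    show "proj ` elts \<Gamma> \<subseteq> elts L" using graph_map_proj by (auto simp: graph_map_def elts_def)
    show "elts L \<subseteq> proj ` elts \<Gamma>"
    proof
      fix t assume "t \<in> elts L"
      then have "t \<in> (\<Pi>\<^sub>E i\<in>I. elts (Q i))" "\<And>i j. (i, j) \<in> r \<Longrightarrow> t i = \<phi> i j (t j)"
        by (auto simp: elts_def L_simps)
      then obtain x where "x \<in> elts \<Gamma>" "t = proj x" by (rule thread_proj)
      then show "t \<in> proj ` elts \<Gamma>" by blast
    qed
  qed
  moreover have "topspace (topo L) = elts L"
  proof -
    have "topspace (topo (Q i)) = elts (Q i)" if "i \<in> I" for i
      using compatible_equivalence.elts_quotient_graph[OF compatible[OF that]] by (simp add: Q_def)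
    then have "elts L \<subseteq> topspace (product_topology (\<lambda>i. topo (Q i)) I)"
      by (auto simp: elts_def L_simps PiE_iff)
    then show ?thesis by (auto simp: L_simps(6))
  qed
  moreover have "continuous_map \<T> (topo L) proj"
    unfolding L_simps(6) continuous_map_in_subtopology
  proof
    show "proj \<in> topspace \<T> \<rightarrow> elts L" using \<open>proj ` elts \<Gamma> = elts L\<close> by (auto simp: topspace)
    have "continuous_map \<T> (topo (Q i)) (\<lambda>x. proj x i)" if i: "i \<in> I" for i
      unfolding Q_def quotient_top_graph_simps
    proof (rule continuous_map_into_discrete)
      fix x assume "x \<in> topspace \<T>"
      then have x: "x \<in> elts \<Gamma>" by (simp add: topspace)
      then show "proj x i \<in> elts \<Gamma> // E i" using i by (auto simp: proj_def quotient_def)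
      interpret Ei: compatible_equivalence \<Gamma> "E i" by (rule compatible[OF i])
      have "{y \<in> topspace \<T>. proj y i = proj x i} = E i `` {x}"
      proof -
        have "proj y i = proj x i \<longleftrightarrow> (x, y) \<in> E i" if "y \<in> elts \<Gamma>" for y
          using Ei.class_eq_iff[OF x that] i by (simp add: proj_def eq_commute)
        then show ?thesis using Ei.in_elts by (auto simp: topspace)
      qed
      then show "openin \<T> {y \<in> topspace \<T>. proj y i = proj x i}"
        using compatible_cofinite_entourage_open_equiv[OF E[OF i]] x by (simp add: open_equiv_def)
    qed
    moreover have "proj ` topspace \<T> \<subseteq> extensional I" by (auto simp: proj_def)
    ultimately show "continuous_map \<T> (product_topology (\<lambda>i. topo (Q i)) I) proj"
      by (simp add: continuous_map_componentwise)
  qed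
  moreover have "Hausdorff_space (topo L)"
    unfolding L_simps(6) by (intro Hausdorff_space_subtopology)
      (auto simp: Hausdorff_space_product_topology Q_def)
  ultimately have "homeomorphic_map \<T> (topo L) proj"
    using compact inj_proj by (intro continuous_imp_homeomorphic_map) (auto simp: topspace)
  then show ?thesis
    using graph_map_proj inj_proj \<open>proj ` elts \<Gamma> = elts L\<close>
    by (auto simp: top_graph_isomorphism_def bij_betw_def graph_map_def)
qed

end

lemma profinite_regular_coveringI:
  fixes \<Gamma> :: "'a unif_graph" and \<Delta> :: "'b unif_graph"
  assumes "profinite_graph \<Gamma>" "profinite_graph \<Delta>"
    and f: "continuous_graph_map (top_graph_of \<Gamma>) (top_graph_of \<Delta>) f"
    and I: "fundamental_system_of_regular_good_pairs \<Gamma> \<Delta> f I"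
  shows "profinite_regular_covering \<Gamma> \<Delta> f"
proof -
  interpret G: profinite \<Gamma> by unfold_locales fact
  interpret D: profinite \<Delta> by unfold_locales fact
  have gm: "graph_map \<Gamma> \<Delta> f" using f by (simp add: continuous_graph_map_def graph_map_def)
  have pair: "compatible_cofinite_entourage \<Gamma> (fst P)" "compatible_cofinite_entourage \<Delta> (snd P)"
    "map_prod f f ` fst P \<subseteq> snd P"
    "regular_covering (quotient_graph \<Gamma> (fst P)) (quotient_graph \<Delta> (snd P)) (quotient_map_of (snd P) f)"
    if "P \<in> I" for P
    using I that
    by (cases P; force simp: fundamental_system_of_regular_good_pairs_def regular_good_pair_def good_pair_def)+
  have fund: "\<exists>P\<in>I. fst P \<subseteq> V \<and> snd P \<subseteq> W" if "entourage \<Gamma> V" "entourage \<Delta> W" for V W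
  proof -
    have "\<exists>(R, S)\<in>I. R \<subseteq> V \<and> S \<subseteq> W"
      using I that by (simp add: fundamental_system_of_regular_good_pairs_def)
    then show ?thesis by (simp add: split_beta)
  qed
  \<comment> \<open>Going up means becoming finer in both coordinates, so a single order serves the
    quotients of \<Gamma> and of \<Delta>.\<close>
  define r where "r = {(P, P'). P \<in> I \<and> P' \<in> I \<and> fst P' \<subseteq> fst P \<and> snd P' \<subseteq> snd P}"
  have "directed_order I r"
    unfolding directed_order_def
  proof (intro conjI ballI)
    show "I \<noteq> {}" using fund[OF G.entourage_full D.entourage_full] by blast
    show "preorder_on I r" by (auto simp: preorder_on_def r_def refl_on_def intro!: transI)
    fix P P' assume P: "P \<in> I" "P' \<in> I"
    \<comment> \<open>An upper bound of two pairs is a member of \<open>I\<close> below their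
      coordinatewise intersection, which need not itself be a good pair.\<close>
    have "entourage \<Gamma> (fst P \<inter> fst P')" "entourage \<Delta> (snd P \<inter> snd P')"
      using pair(1,2)[OF P(1)] pair(1,2)[OF P(2)] G.entourage_Int D.entourage_Int
      by (auto simp: compatible_cofinite_entourage_def)
    from fund[OF this] show "\<exists>k\<in>I. (P, k) \<in> r \<and> (P', k) \<in> r" using P by (auto simp: r_def)
  qed
  note directed = this
  have "\<exists>P\<in>I. fst P \<subseteq> V" if "entourage \<Gamma> V" for V
    using fund[OF that D.entourage_full] by blast
  then interpret G: quotient_system \<Gamma> I r fst
    by unfold_locales (rule directed pair(1) | simp add: r_def)+
  have "\<exists>P\<in>I. snd P \<subseteq> W" if "entourage \<Delta> W" for W
    using fund[OF G.entourage_full that] by blast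
  then interpret D: quotient_system \<Delta> I r snd
    by unfold_locales (rule directed pair(2) | simp add: r_def)+
  define g where "g P = quotient_map_of (snd P) f" for P :: "('a \<times> 'a) set \<times> ('b \<times> 'b) set"
  have g: "g P (fst P `` {x}) = snd P `` {f x}" if "P \<in> I" "x \<in> elts \<Gamma>" for P x
    unfolding g_def
    using compatible_equivalence.quotient_map_of_class[OF G.compatible[OF that(1)] that(2)
        compatible_equivalence.equiv[OF D.compatible[OF that(1)]] pair(3)[OF that(1)]] .
  have f_elts: "f x \<in> elts \<Delta>" if "x \<in> elts \<Gamma>" for x using that gm by (auto simp: graph_map_def elts_def)
  have "inverse_system_of_maps I r G.Q D.Q g G.\<phi> D.\<phi>"
    unfolding inverse_system_of_maps_def
  proof (intro conjI ballI; clarify?)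
    show "continuous_graph_map (G.Q P) (D.Q P) (g P)" if "P \<in> I" for P
      unfolding G.Q_def D.Q_def g_def
      by (intro continuous_quotient_map G.compatible D.compatible that gm pair)
    fix R S R' S' x assume r: "((R, S), (R', S')) \<in> r" and x: "x \<in> elts (G.Q (R', S'))"
    have i: "(R, S) \<in> I" "(R', S') \<in> I" using r by (auto simp: r_def)
    obtain y where y: "y \<in> elts \<Gamma>" "x = fst (R', S') `` {y}" using x G.elts_Q[OF i(2)] by auto
    show "g (R, S) (G.\<phi> (R, S) (R', S') x) = D.\<phi> (R, S) (R', S') (g (R', S') x)"
      unfolding y(2) G.\<phi>_class[OF r y(1)] g[OF i(1) y(1)] g[OF i(2) y(1)] D.\<phi>_class[OF r f_elts[OF y(1)]] ..
  qed (rule G.inverse_system_Q D.inverse_system_Q)+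
  moreover have "D.proj (f x) = limit_map I g (G.proj x)" if "x \<in> elts \<Gamma>" for x
    unfolding D.proj_def G.proj_def limit_map_def by (rule restrict_ext) (simp add: g that)
  ultimately have "is_inverse_limit_of_maps (top_graph_of \<Gamma>) (top_graph_of \<Delta>) f I r G.Q D.Q g G.\<phi> D.\<phi>"
    unfolding is_inverse_limit_of_maps_def using G.isomorphism_proj D.isomorphism_proj by auto
  moreover have "\<forall>P\<in>I. finite_discrete_graph (G.Q P) \<and> finite_discrete_graph (D.Q P) \<and>
      regular_covering (G.Q P) (D.Q P) (g P)"
  proof (intro ballI conjI)
    fix P assume P: "P \<in> I"
    show "finite_discrete_graph (G.Q P)" "finite_discrete_graph (D.Q P)"
      unfolding G.Q_def D.Q_def
      using pair(1,2)[OF P] G.compatible[OF P] D.compatible[OF P]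
      by (auto intro!: finite_discrete_quotient simp: compatible_cofinite_entourage_def)
    show "regular_covering (G.Q P) (D.Q P) (g P)"
      unfolding G.Q_def D.Q_def quotient_top_graph_def g_def
      by (intro regular_covering_extend pair P)
  qed
  ultimately show ?thesis
    unfolding profinite_regular_covering_def regular_covering_over_def
    using assms(1-3) by blast
qed

section \<open>Inverse limits of finite graphs\<close>

text \<open>Nothing makes the bonding maps or the projections \<open>\<pi> i\<close> onto. Existence
  of points of \<Gamma> therefore always goes through \<open>thread_realized\<close> or
  \<open>finite_subsystem_realized\<close>.\<close>

locale inverse_limit_presentation = profinite \<Gamma> for \<Gamma> :: "'a unif_graph" +
  fixes I :: "'i set" and r :: "('i \<times> 'i) set" and G :: "'i \<Rightarrow> 'c top_graph"
    and \<phi> :: "'i \<Rightarrow> 'i \<Rightarrow> 'c \<Rightarrow> 'c" and h :: "'a \<Rightarrow> 'i \<Rightarrow> 'c"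
  assumes system: "inverse_system I r G \<phi>"
    and finite_discrete: "i \<in> I \<Longrightarrow> finite_discrete_graph (G i)"
    and iso: "top_graph_isomorphism (top_graph_of \<Gamma>) (inverse_limit I r G \<phi>) h"
begin

abbreviation "L \<equiv> inverse_limit I r G \<phi>"

abbreviation \<pi> :: "'i \<Rightarrow> 'a \<Rightarrow> 'c" where "\<pi> i x \<equiv> h x i"

lemma directed: "directed_order I r"
  using system by (simp add: inverse_system_def)

lemma graph_G: "i \<in> I \<Longrightarrow> is_graph (G i)"
  and finite_G: "i \<in> I \<Longrightarrow> finite (elts (G i))"
  and topo_G: "i \<in> I \<Longrightarrow> topo (G i) = discrete_topology (elts (G i))"
  using finite_discrete by (auto simp: finite_discrete_graph_def)

lemma \<phi>_graph_map: "(i, j) \<in> r \<Longrightarrow> graph_map (G j) (G i) (\<phi> i j)"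
  using system by (auto simp: inverse_system_def continuous_graph_map_def)

lemma \<phi>_id: "i \<in> I \<Longrightarrow> x \<in> elts (G i) \<Longrightarrow> \<phi> i i x = x"
  using system by (auto simp: inverse_system_def)

lemma \<phi>_comp: "(i, j) \<in> r \<Longrightarrow> (j, k) \<in> r \<Longrightarrow> x \<in> elts (G k) \<Longrightarrow> \<phi> i j (\<phi> j k x) = \<phi> i k x"
  using system unfolding inverse_system_def by fastforce

lemma L_simps:
  "verts L = (\<Pi>\<^sub>E i\<in>I. verts (G i)) \<inter> {t. \<forall>(i, j)\<in>r. t i = \<phi> i j (t j)}"
  "edges L = (\<Pi>\<^sub>E i\<in>I. edges (G i)) \<inter> {t. \<forall>(i, j)\<in>r. t i = \<phi> i j (t j)}"
  "src L t = (\<lambda>i\<in>I. src (G i) (t i))" "tgt L t = (\<lambda>i\<in>I. tgt (G i) (t i))"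
  "opp L t = (\<lambda>i\<in>I. opp (G i) (t i))"
  "topo L = subtopology (product_topology (\<lambda>i. topo (G i)) I) (elts L)"
  by (simp_all add: inverse_limit_def Let_def elts_def)

lemma h_graph_map: "graph_map \<Gamma> L h"
  using iso by (simp add: top_graph_isomorphism_def graph_map_def)

lemma h_bij: "bij_betw h (elts \<Gamma>) (elts L)"
  using iso by (simp add: top_graph_isomorphism_def)

lemma \<pi>_graph_map:
  assumes "i \<in> I"
  shows "graph_map \<Gamma> (G i) (\<pi> i)"
proof -
  have "\<pi> i v \<in> verts (G i)" if "v \<in> verts \<Gamma>" for v
    using graph_mapD(1)[OF h_graph_map that] assms by (auto simp: L_simps)
  moreover have "\<pi> i e \<in> edges (G i)" if "e \<in> edges \<Gamma>" for e
    using graph_mapD(2)[OF h_graph_map that] assms by (auto simp: L_simps)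
  ultimately show ?thesis
    unfolding graph_map_def
    using graph_mapD(4-6)[OF h_graph_map] assms by (auto simp: L_simps)
qed

lemma \<pi>_in: "i \<in> I \<Longrightarrow> x \<in> elts \<Gamma> \<Longrightarrow> \<pi> i x \<in> elts (G i)"
  using graph_mapD(3)[OF \<pi>_graph_map] .

lemma \<pi>_compat: "(i, j) \<in> r \<Longrightarrow> x \<in> elts \<Gamma> \<Longrightarrow> \<phi> i j (\<pi> j x) = \<pi> i x"
  using graph_mapD(3)[OF h_graph_map, of x] by (auto simp: L_simps elts_def)

lemma \<pi>_inj:
  assumes "x \<in> elts \<Gamma>" "y \<in> elts \<Gamma>" "\<And>i. i \<in> I \<Longrightarrow> \<pi> i x = \<pi> i y"
  shows "x = y"
proof -
  have "h x \<in> extensional I" "h y \<in> extensional I"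
    using graph_mapD(3)[OF h_graph_map, of x] graph_mapD(3)[OF h_graph_map, of y] assms
    by (auto simp: L_simps elts_def PiE_def)
  then have "h x = h y" using assms(3) by (rule extensionalityI)
  then show ?thesis using h_bij assms(1,2) by (auto simp: bij_betw_def inj_on_def)
qed

lemma \<phi>_in: "(i, j) \<in> r \<Longrightarrow> x \<in> elts (G j) \<Longrightarrow> \<phi> i j x \<in> elts (G i)"
  using graph_mapD(3)[OF \<phi>_graph_map] .

text \<open>The limit is the union of a part of the product of the vertex sets and a part of the
  product of the edge sets. A thread lies in one of them because bonding maps preserve and reflect
  the kind of an element and any two indices have a common upper bound.\<close>

lemma thread_realized:
  assumes t: "\<And>i. i \<in> I \<Longrightarrow> t i \<in> elts (G i)" "\<And>i j. (i, j) \<in> r \<Longrightarrow> t i = \<phi> i j (t j)"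
  obtains x where "x \<in> elts \<Gamma>" "\<And>i. i \<in> I \<Longrightarrow> \<pi> i x = t i"
proof -
  have same: "t i \<in> verts (G i) \<longleftrightarrow> t j \<in> verts (G j)" if ij: "(i, j) \<in> r" for i j
  proof -
    have "i \<in> I" "j \<in> I" using directed_order_carrier[OF directed ij] by auto
    then show ?thesis
      using t(2)[OF ij] graph_mapD(1)[OF \<phi>_graph_map[OF ij]]
        graph_map_reflects(1)[OF \<phi>_graph_map[OF ij] graph_G t(1)] by auto
  qed
  have all_verts: "(\<forall>i\<in>I. t i \<in> verts (G i)) \<or> (\<forall>i\<in>I. t i \<notin> verts (G i))"
  proof (rule ccontr)
    assume "\<not> ?thesis"
    then obtain i j where ij: "i \<in> I" "j \<in> I" "t i \<in> verts (G i)" "t j \<notin> verts (G j)" by blast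
    then obtain k where "(i, k) \<in> r" "(j, k) \<in> r" using directed unfolding directed_order_def by blast
    then show False using same ij by blast
  qed
  have "\<forall>(i, j)\<in>r. restrict t I i = \<phi> i j (restrict t I j)"
    using t(2) directed_order_carrier[OF directed] by fastforce
  moreover have "restrict t I \<in> (\<Pi>\<^sub>E i\<in>I. verts (G i)) \<or> restrict t I \<in> (\<Pi>\<^sub>E i\<in>I. edges (G i))"
    using all_verts t(1) by (fastforce simp: elts_def)
  ultimately have "restrict t I \<in> elts L" by (auto simp: elts_def L_simps)
  then have "restrict t I \<in> h ` elts \<Gamma>" using h_bij by (simp add: bij_betw_def)
  then obtain x where "x \<in> elts \<Gamma>" "h x = restrict t I" by force
  then show ?thesis using that by simp
qed

text \<open>By Tychonoff's theorem, applied to the product of the finite sets \<open>A i\<close>.\<close>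

lemma finite_subsystem_realized:
  assumes A: "\<And>i. i \<in> I \<Longrightarrow> A i \<subseteq> elts (G i)" "\<And>i. i \<in> I \<Longrightarrow> A i \<noteq> {}"
    and sub: "\<And>i j x. (i, j) \<in> r \<Longrightarrow> x \<in> A j \<Longrightarrow> \<phi> i j x \<in> A i"
  obtains x where "x \<in> elts \<Gamma>" "\<And>i. i \<in> I \<Longrightarrow> \<pi> i x \<in> A i"
proof -
  let ?P = "product_topology (\<lambda>i. discrete_topology (A i)) I"
  \<comment> \<open>\<open>C k\<close> asks for compatibility only between \<open>k\<close> and the
    indices below it. This keeps each \<open>C k\<close> nonempty, while a larger \<open>k\<close>
    imposes more, so the sets are directed.\<close>
  define C where "C k = {t \<in> topspace ?P. \<forall>i. (i, k) \<in> r \<longrightarrow> t i = \<phi> i k (t k)}" for k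
  have finA: "finite (A i)" if "i \<in> I" for i
    using finite_subset[OF A(1) finite_G] that by blast
  have "\<exists>t. t \<in> topspace ?P \<and> (\<forall>k\<in>I. t \<in> C k)"
  proof (rule compact_space_directed_Inter_nonempty[OF _ directed])
    show "compact_space ?P"
      using finA by (simp add: compact_space_product_topology compact_space_discrete_topology)
    fix k assume k: "k \<in> I"
    have "closedin ?P {t \<in> topspace ?P. t i = \<phi> i k (t k)}" if ik: "(i, k) \<in> r" for i
    proof -
      have i: "i \<in> I" using directed_order_carrier[OF directed ik] by simp
      have "continuous_map ?P (discrete_topology (A i)) (\<lambda>t. t i)"
        by (rule continuous_map_product_projection[OF i])
      moreover have "continuous_map ?P (discrete_topology (A i)) (\<phi> i k \<circ> (\<lambda>t. t k))"
      proof (rule continuous_map_compose)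
        show "continuous_map ?P (discrete_topology (A k)) (\<lambda>t. t k)"
          by (rule continuous_map_product_projection[OF k])
        show "continuous_map (discrete_topology (A k)) (discrete_topology (A i)) (\<phi> i k)"
          using sub[OF ik] by auto
      qed
      ultimately have "closedin ?P {t \<in> topspace ?P. t i = (\<phi> i k \<circ> (\<lambda>t. t k)) t}"
        by (rule closedin_continuous_maps_eq[OF Hausdorff_space_discrete_topology])
      then show ?thesis by simp
    qed
    then have "closedin ?P (\<Inter>i\<in>{i. (i, k) \<in> r}. {t \<in> topspace ?P. t i = \<phi> i k (t k)})"
      using directed_order_refl[OF directed k] by (intro closedin_Inter) auto
    moreover have "(\<Inter>i\<in>{i. (i, k) \<in> r}. {t \<in> topspace ?P. t i = \<phi> i k (t k)}) = C k"
      using directed_order_refl[OF directed k] by (auto simp: C_def)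
    ultimately show "closedin ?P (C k)" by simp
    obtain a where a: "a \<in> A k" using A(2)[OF k] by blast
    \<comment> \<open>A point of \<open>A k\<close> is pushed down to all indices below
      \<open>k\<close>; at other indices any point of \<open>A i\<close> will do.\<close>
    define t where "t = (\<lambda>i\<in>I. if (i, k) \<in> r then \<phi> i k a else (SOME b. b \<in> A i))"
    have "t i \<in> A i" if "i \<in> I" for i
      using that A(2)[OF that] sub[OF _ a] some_in_eq[of "A i"] by (simp add: t_def)
    then have "t \<in> topspace ?P" by (auto simp: t_def)
    moreover have "t k = a"
      using directed_order_refl[OF directed k] \<phi>_id[OF k] A(1)[OF k] a k by (auto simp: t_def)
    then have "t i = \<phi> i k (t k)" if "(i, k) \<in> r" for i
      using that directed_order_carrier[OF directed that] by (simp add: t_def)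
    ultimately show "C k \<noteq> {}" by (auto simp: C_def)
  next
    fix j k assume jk: "(j, k) \<in> r"
    show "C k \<subseteq> C j"
    proof
      fix t assume t: "t \<in> C k"
      have "k \<in> I" using directed_order_carrier[OF directed jk] by simp
      then have tk: "t k \<in> elts (G k)" using t A(1) by (auto simp: C_def)
      have "t i = \<phi> i j (t j)" if "(i, j) \<in> r" for i
        using t directed_order_trans[OF directed that jk] jk \<phi>_comp[OF that jk tk] by (simp add: C_def)
      then show "t \<in> C j" using t by (simp add: C_def)
    qed
  qed blast
  then obtain t where t: "t \<in> topspace ?P" "\<And>k. k \<in> I \<Longrightarrow> t \<in> C k" by blast
  have tA: "t i \<in> A i" if "i \<in> I" for i using t(1) that by auto
  obtain x where "x \<in> elts \<Gamma>" "\<And>i. i \<in> I \<Longrightarrow> \<pi> i x = t i"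
  proof (rule thread_realized[of t])
    show "t i \<in> elts (G i)" if "i \<in> I" for i using tA A(1) that by blast
    show "t i = \<phi> i j (t j)" if "(i, j) \<in> r" for i j
      using t(2)[of j] directed_order_carrier[OF directed that] that by (simp add: C_def)
  qed blast
  then show ?thesis using that tA by metis
qed

text \<open>A point of \<open>G i\<close> that is hit from every level above \<open>i\<close> is hit
  by \<Gamma>, since a thread runs through its preimages. So each of the finitely many points missed
  by \<Gamma> is missed from some level already, and then from all higher ones; an index above all
  these levels misses them together.\<close>

lemma image_stabilizes:
  assumes i: "i \<in> I"
  obtains j where "(i, j) \<in> r" "\<phi> i j ` elts (G j) \<subseteq> \<pi> i ` elts \<Gamma>"
proof -
  define N where "N = elts (G i) - \<pi> i ` elts \<Gamma>"
  have "\<exists>j. (i, j) \<in> r \<and> a \<notin> \<phi> i j ` elts (G j)" if a: "a \<in> N" for a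
  proof (rule ccontr)
    assume "\<not> ?thesis"
    then have ex: "\<exists>z\<in>elts (G k). \<phi> i k z = a" if "(i, k) \<in> r" for k using that by blast
    \<comment> \<open>An index \<open>j\<close> need not lie above \<open>i\<close>, so preimages of
      \<open>a\<close> are taken at common upper bounds \<open>k\<close> and then sent down to
      \<open>j\<close>. At \<open>j = i\<close> only \<open>a\<close> itself is left.\<close>
    define A where "A j = {\<phi> j k z | k z. (i, k) \<in> r \<and> (j, k) \<in> r \<and> z \<in> elts (G k) \<and> \<phi> i k z = a}" for j
    obtain x where x: "x \<in> elts \<Gamma>" "\<And>j. j \<in> I \<Longrightarrow> \<pi> j x \<in> A j"
    proof (rule finite_subsystem_realized[of A])
      fix j assume j: "j \<in> I"
      show "A j \<subseteq> elts (G j)" using \<phi>_in by (auto simp: A_def)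
      obtain k where "(i, k) \<in> r" "(j, k) \<in> r" using directed i j unfolding directed_order_def by blast
      then show "A j \<noteq> {}" using ex by (fastforce simp: A_def)
    next
      fix j l y assume jl: "(j, l) \<in> r" and "y \<in> A l"
      then obtain k z where kz: "y = \<phi> l k z" "(i, k) \<in> r" "(l, k) \<in> r" "z \<in> elts (G k)" "\<phi> i k z = a"
        by (auto simp: A_def)
      have "\<phi> j l y = \<phi> j k z" using \<phi>_comp[OF jl kz(3,4)] kz(1) by simp
      then show "\<phi> j l y \<in> A j"
        unfolding A_def using kz(2,4,5) directed_order_trans[OF directed jl kz(3)] by blast
    qed blast
    have "\<pi> i x = a" using x(2)[OF i] by (auto simp: A_def)
    then show False using a x(1) by (auto simp: N_def)
  qed
  then obtain c where c: "\<And>a. a \<in> N \<Longrightarrow> (i, c a) \<in> r" "\<And>a. a \<in> N \<Longrightarrow> a \<notin> \<phi> i (c a) ` elts (G (c a))"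
    by metis
  \<comment> \<open>Inserting \<open>i\<close> puts the bound above \<open>i\<close> even when no
    point is missed.\<close>
  have "finite (insert i (c ` N))" "insert i (c ` N) \<subseteq> I"
    using finite_G[OF i] i c(1) directed_order_carrier[OF directed] by (auto simp: N_def)
  then obtain k where k: "k \<in> I" "\<And>j. j \<in> insert i (c ` N) \<Longrightarrow> (j, k) \<in> r"
    by (rule directed_order_upper_bound[OF directed]) (rule that)
  have ik: "(i, k) \<in> r" using k(2) by blast
  have "\<phi> i k z \<in> \<pi> i ` elts \<Gamma>" if z: "z \<in> elts (G k)" for z
  proof (rule ccontr)
    assume "\<not> ?thesis"
    then have a: "\<phi> i k z \<in> N" using \<phi>_in[OF ik z] by (simp add: N_def)
    have ck: "(c (\<phi> i k z), k) \<in> r" using k(2) a by blast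
    show False using c(2)[OF a] \<phi>_comp[OF c(1)[OF a] ck z] \<phi>_in[OF ck z] by (metis imageI)
  qed
  then show ?thesis using that ik by blast
qed

section \<open>Kernels of the projections as entourages\<close>

definition kernel :: "'i \<Rightarrow> ('a \<times> 'a) set" where
  "kernel i = {(x, y) \<in> elts \<Gamma> \<times> elts \<Gamma>. \<pi> i x = \<pi> i y}"

lemma equiv_kernel: "equiv (elts \<Gamma>) (kernel i)"
  by (auto simp: equiv_def refl_on_def sym_def trans_def kernel_def)

lemma open_equiv_kernel:
  assumes "i \<in> I"
  shows "open_equiv (kernel i)"
  unfolding open_equiv_def
proof (intro conjI ballI)
  show "equiv (elts \<Gamma>) (kernel i)" by (rule equiv_kernel)
  fix x assume x: "x \<in> elts \<Gamma>"
  have "continuous_map \<T> (topo L) h"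
    using iso by (auto simp: top_graph_isomorphism_def dest: homeomorphic_imp_continuous_map)
  then have "continuous_map \<T> (product_topology (\<lambda>i. topo (G i)) I) h"
    unfolding L_simps(6) by (simp add: continuous_map_in_subtopology)
  then have "continuous_map \<T> (topo (G i)) (\<pi> i)"
    using assms by (simp add: continuous_map_componentwise)
  then have "openin \<T> {y \<in> topspace \<T>. \<pi> i y \<in> {\<pi> i x}}"
    using \<pi>_in[OF assms x] by (rule_tac openin_continuous_map_preimage) (auto simp: topo_G[OF assms])
  moreover have "{y \<in> topspace \<T>. \<pi> i y \<in> {\<pi> i x}} = kernel i `` {x}"
    using x by (auto simp: kernel_def topspace)
  ultimately show "openin \<T> (kernel i `` {x})" by simp
qed

lemma kernel_mono:
  assumes "(i, j) \<in> r"
  shows "kernel j \<subseteq> kernel i"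
proof clarify
  fix x y assume "(x, y) \<in> kernel j"
  then show "(x, y) \<in> kernel i"
    using \<pi>_compat[OF assms, of x] \<pi>_compat[OF assms, of y] by (simp add: kernel_def)
qed

text \<open>Elements of \<Gamma> are determined by their coordinates, so the kernels form a directed
  separating family of open relations.\<close>

lemma kernel_refines:
  assumes "entourage \<Gamma> V"
  obtains i where "i \<in> I" "kernel i \<subseteq> V"
proof (rule separating_family_refines[OF directed open_equiv_kernel kernel_mono _ assms])
  fix x y assume "x \<in> elts \<Gamma>" "y \<in> elts \<Gamma>" "\<And>i. i \<in> I \<Longrightarrow> (x, y) \<in> kernel i"
  then show "x = y" by (intro \<pi>_inj) (auto simp: kernel_def)
qed (use that in auto)

lemma compatible_cofinite_entourage_kernel:
  assumes i: "i \<in> I"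
  shows "compatible_cofinite_entourage \<Gamma> (kernel i)"
  unfolding compatible_cofinite_entourage_def
proof (intro conjI)
  show "entourage \<Gamma> (kernel i)" by (rule open_equiv_entourage[OF open_equiv_kernel[OF i]])
  note m = graph_mapD[OF \<pi>_graph_map[OF i]] and g = is_graphD[OF graph]
  show "compatible_equiv \<Gamma> (kernel i)"
    unfolding compatible_equiv_def
  proof (intro conjI ballI impI)
    show "equiv (elts \<Gamma>) (kernel i)" by (rule equiv_kernel)
    show "(v, e) \<notin> kernel i" if "v \<in> verts \<Gamma>" "e \<in> edges \<Gamma>" for v e
      using m(1)[OF that(1)] m(2)[OF that(2)] is_graphD(4)[OF graph_G[OF i]] by (auto simp: kernel_def)
    show "(e, opp \<Gamma> e) \<notin> kernel i" if "e \<in> edges \<Gamma>" for e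
      using is_graphD(5)[OF graph_G[OF i] m(2)[OF that]] m(6)[OF that] by (auto simp: kernel_def)
    fix e e' assume "e \<in> edges \<Gamma>" "e' \<in> edges \<Gamma>" "(e, e') \<in> kernel i"
    then show "(src \<Gamma> e, src \<Gamma> e') \<in> kernel i" "(tgt \<Gamma> e, tgt \<Gamma> e') \<in> kernel i"
      "(opp \<Gamma> e, opp \<Gamma> e') \<in> kernel i"
      using m(4-6)[of e] m(4-6)[of e'] g(1-3)[of e] g(1-3)[of e']
      by (simp_all add: kernel_def verts_elts edges_elts)
  qed
  have "elts \<Gamma> // kernel i \<subseteq> (\<lambda>a. {y \<in> elts \<Gamma>. a = \<pi> i y}) ` elts (G i)"
    using \<pi>_in[OF i] by (auto simp: quotient_def kernel_def)
  then show "finite (elts \<Gamma> // kernel i)"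
    using finite_subset finite_G[OF i] by blast
qed

end

section \<open>Limits of regular coverings\<close>

locale regular_covering_system =
  G: inverse_limit_presentation \<Gamma> I r G \<phi> h + D: inverse_limit_presentation \<Delta> I r D \<psi> k
  for \<Gamma> :: "'a unif_graph" and \<Delta> :: "'b unif_graph" and I :: "'i set" and r
    and G :: "'i \<Rightarrow> 'c top_graph" and \<phi> h and D :: "'i \<Rightarrow> 'd top_graph" and \<psi> k +
  fixes f :: "'a \<Rightarrow> 'b" and g :: "'i \<Rightarrow> 'c \<Rightarrow> 'd"
  assumes f: "continuous_graph_map (top_graph_of \<Gamma>) (top_graph_of \<Delta>) f"
    and regular: "i \<in> I \<Longrightarrow> regular_covering (G i) (D i) (g i)"
    and natural: "(i, j) \<in> r \<Longrightarrow> a \<in> elts (G j) \<Longrightarrow> g i (\<phi> i j a) = \<psi> i j (g j a)"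
    and limit: "x \<in> elts \<Gamma> \<Longrightarrow> k (f x) = limit_map I g (h x)"
begin

section \<open>Lifting properties of the limit map\<close>

lemma f_graph_map: "graph_map \<Gamma> \<Delta> f"
  using f by (simp add: continuous_graph_map_def graph_map_def)

lemma f_in: "x \<in> elts \<Gamma> \<Longrightarrow> f x \<in> elts \<Delta>"
  using graph_mapD(3)[OF f_graph_map] .

lemma g_\<pi>: "i \<in> I \<Longrightarrow> x \<in> elts \<Gamma> \<Longrightarrow> g i (G.\<pi> i x) = D.\<pi> i (f x)"
  using limit by (simp add: limit_map_def)

lemma locally_injective_f: "locally_injective \<Gamma> f"
  unfolding locally_injective_def
proof (intro ballI impI)
  fix e e' assume e: "e \<in> edges \<Gamma>" "e' \<in> edges \<Gamma>" "src \<Gamma> e = src \<Gamma> e'" "f e = f e'"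
  show "e = e'"
  proof (rule G.\<pi>_inj)
    fix i assume i: "i \<in> I"
    note m = graph_mapD[OF G.\<pi>_graph_map[OF i]]
    show "G.\<pi> i e = G.\<pi> i e'"
      using locally_injectiveD[OF regular_coveringD(9)[OF regular[OF i]], of "G.\<pi> i e" "G.\<pi> i e'"]
        m(2,4)[OF e(1)] m(2,4)[OF e(2)] e(3,4) g_\<pi>[OF i edges_elts[OF e(1)]] g_\<pi>[OF i edges_elts[OF e(2)]]
      by simp
  qed (use e in \<open>auto simp: elts_def\<close>)
qed

text \<open>The fibres of the \<open>g i\<close> over the projections of \<open>y\<close> are
  finite, nonempty because a covering of connected graphs is onto, and mapped into each other by
  naturality. A thread through them is a preimage of \<open>y\<close>.\<close>

lemma surj_f: "f ` elts \<Gamma> = elts \<Delta>"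
proof
  show "f ` elts \<Gamma> \<subseteq> elts \<Delta>" using f_in by blast
  show "elts \<Delta> \<subseteq> f ` elts \<Gamma>"
  proof
    fix y assume y: "y \<in> elts \<Delta>"
    define A where "A i = {a \<in> elts (G i). g i a = D.\<pi> i y}" for i
    obtain x where x: "x \<in> elts \<Gamma>" "\<And>i. i \<in> I \<Longrightarrow> G.\<pi> i x \<in> A i"
    proof (rule G.finite_subsystem_realized[of A])
      fix i assume i: "i \<in> I"
      have "D.\<pi> i y \<in> g i ` elts (G i)"
        using D.\<pi>_in[OF i y] locally_bijective_surj[of "G i" "D i" "g i"] regular_coveringD[OF regular[OF i]]
        by simp
      then show "A i \<noteq> {}" by (auto simp: A_def)
    next
      fix i j a assume "(i, j) \<in> r" "a \<in> A j"
      then show "\<phi> i j a \<in> A i"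
        using G.\<phi>_in[of i j a] natural[of i j a] D.\<pi>_compat[of i j y] y by (simp add: A_def)
    qed (auto simp: A_def)
    have "f x = y"
    proof (rule D.\<pi>_inj[OF f_in[OF x(1)] y])
      show "D.\<pi> i (f x) = D.\<pi> i y" if "i \<in> I" for i
        using x(2)[OF that] g_\<pi>[OF that x(1)] by (simp add: A_def)
    qed
    then show "y \<in> f ` elts \<Gamma>" using x(1) by blast
  qed
qed

text \<open>At each level exactly one edge at \<open>G.\<pi> i a\<close> lies over
  \<open>D.\<pi> i d\<close>. A bonding map sends such an edge to another one, so uniqueness alone
  turns them into a thread.\<close>

lemma lift_edge:
  assumes a: "a \<in> verts \<Gamma>" and d: "d \<in> edges \<Delta>" "src \<Delta> d = f a"
  obtains e where "e \<in> edges \<Gamma>" "src \<Gamma> e = a" "f e = d"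
proof -
  define Q where "Q i e \<longleftrightarrow> e \<in> edges (G i) \<and> src (G i) e = G.\<pi> i a \<and> g i e = D.\<pi> i d" for i e
  have "\<exists>e. Q i e" if i: "i \<in> I" for i
  proof -
    note m = graph_mapD[OF D.\<pi>_graph_map[OF i]]
    have "src (D i) (D.\<pi> i d) = g i (G.\<pi> i a)"
      using m(4)[OF d(1)] d(2) g_\<pi>[OF i verts_elts[OF a]] by simp
    from locally_bijective_lift_edge[OF regular_coveringD(8)[OF regular[OF i]]
        graph_mapD(1)[OF G.\<pi>_graph_map[OF i] a] m(2)[OF d(1)] this]
    show ?thesis unfolding Q_def by blast
  qed
  then obtain t where t: "\<And>i. i \<in> I \<Longrightarrow> Q i (t i)" by metis
  have Q_unique: "e = e'" if "i \<in> I" "Q i e" "Q i e'" for i e e'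
    using that locally_injectiveD[OF regular_coveringD(9)[OF regular[OF that(1)]], of e e']
    by (simp add: Q_def)
  have Q_\<phi>: "Q i (\<phi> i j e)" if ij: "(i, j) \<in> r" and e: "Q j e" for i j e
    using graph_mapD(2,4)[OF G.\<phi>_graph_map[OF ij], of e] e natural[OF ij, of e]
      G.\<pi>_compat[OF ij verts_elts[OF a]] D.\<pi>_compat[OF ij edges_elts[OF d(1)]]
    by (simp add: Q_def edges_elts)
  obtain e where e: "e \<in> elts \<Gamma>" "\<And>i. i \<in> I \<Longrightarrow> G.\<pi> i e = t i"
  proof (rule G.thread_realized[of t])
    show "t i \<in> elts (G i)" if "i \<in> I" for i using t[OF that] by (simp add: Q_def edges_elts)
    show "t i = \<phi> i j (t j)" if "(i, j) \<in> r" for i j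
      using directed_order_carrier[OF G.directed that] Q_unique t Q_\<phi>[OF that] by metis
  qed blast
  obtain i where i: "i \<in> I" using G.directed by (auto simp: directed_order_def)
  have edge: "e \<in> edges \<Gamma>"
    using graph_map_reflects(2)[OF G.\<pi>_graph_map[OF i] G.graph_G[OF i] e(1)] t[OF i] e(2)[OF i]
    by (simp add: Q_def)
  have "src \<Gamma> e = a"
  proof (rule G.\<pi>_inj)
    show "src \<Gamma> e \<in> elts \<Gamma>" using is_graphD(1)[OF G.graph edge] by (rule verts_elts)
    show "a \<in> elts \<Gamma>" using a by (rule verts_elts)
    show "G.\<pi> i (src \<Gamma> e) = G.\<pi> i a" if "i \<in> I" for i
      using graph_mapD(4)[OF G.\<pi>_graph_map[OF that] edge] e(2)[OF that] t[OF that] by (simp add: Q_def)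
  qed
  moreover have "f e = d"
  proof (rule D.\<pi>_inj[OF f_in[OF e(1)] edges_elts[OF d(1)]])
    show "D.\<pi> i (f e) = D.\<pi> i d" if "i \<in> I" for i
      using g_\<pi>[OF that e(1)] e(2)[OF that] t[OF that] by (simp add: Q_def)
  qed
  ultimately show ?thesis using that edge by blast
qed

text \<open>At each level the deck map \<open>\<delta> i\<close> is pinned by sending
  \<open>G.\<pi> i x\<close> to \<open>G.\<pi> i x'\<close>, so separate choices match. The
  resulting \<open>\<gamma>\<close> acts on coordinate \<open>i\<close> as
  \<open>\<delta> i\<close>, hence preserves \<open>G.kernel i\<close>. If \<open>x\<close> and
  \<open>x'\<close> agree at \<open>i\<close>, then \<open>\<delta> i\<close> fixes a vertex and is
  the identity; this is the freeness used for local injectivity of the quotient.\<close>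

lemma deck:
  assumes x: "x \<in> verts \<Gamma>" "x' \<in> verts \<Gamma>" "f x = f x'"
  obtains \<gamma> where "graph_map \<Gamma> \<Gamma> \<gamma>" "\<And>y. y \<in> elts \<Gamma> \<Longrightarrow> f (\<gamma> y) = f y" "\<gamma> x = x'"
    "\<And>i. i \<in> I \<Longrightarrow> map_prod \<gamma> \<gamma> ` G.kernel i \<subseteq> G.kernel i"
    "\<And>i y. i \<in> I \<Longrightarrow> (x, x') \<in> G.kernel i \<Longrightarrow> y \<in> elts \<Gamma> \<Longrightarrow> (y, \<gamma> y) \<in> G.kernel i"
proof -
  note \<pi>_verts = graph_mapD(1)[OF G.\<pi>_graph_map]
  have "\<exists>d. graph_map (G i) (G i) d \<and> (\<forall>y\<in>elts (G i). g i (d y) = g i y) \<and> d (G.\<pi> i x) = G.\<pi> i x'"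
    if i: "i \<in> I" for i
    using regular_covering_deck[OF regular[OF i] \<pi>_verts[OF i x(1)] \<pi>_verts[OF i x(2)]]
      g_\<pi>[OF i verts_elts[OF x(1)]] g_\<pi>[OF i verts_elts[OF x(2)]] x(3) by simp
  then obtain \<delta> where \<delta>: "\<And>i. i \<in> I \<Longrightarrow> graph_map (G i) (G i) (\<delta> i)"
    "\<And>i y. i \<in> I \<Longrightarrow> y \<in> elts (G i) \<Longrightarrow> g i (\<delta> i y) = g i y" "\<And>i. i \<in> I \<Longrightarrow> \<delta> i (G.\<pi> i x) = G.\<pi> i x'"
    by metis
  have \<delta>_in: "\<delta> i y \<in> elts (G i)" if "i \<in> I" "y \<in> elts (G i)" for i y
    using graph_mapD(3)[OF \<delta>(1)[OF that(1)] that(2)] .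
  have graph_map_comp: "graph_map A C (\<lambda>y. v (u y))" if "graph_map A B u" "graph_map B C v"
    for A :: "'c top_graph" and B C :: "'c top_graph" and u v
    using graph_mapD[OF that(1)] graph_mapD[OF that(2)] by (auto simp: graph_map_def)
  have \<delta>_natural: "\<delta> i (\<phi> i j y) = \<phi> i j (\<delta> j y)" if ij: "(i, j) \<in> r" and y: "y \<in> elts (G j)" for i j y
  proof -
    have I: "i \<in> I" "j \<in> I" using directed_order_carrier[OF G.directed ij] by auto
    note R = regular_coveringD[OF regular[OF I(2)]]
    show ?thesis
    proof (rule unique_lift[OF R(1,3) _ _ regular_coveringD(9)[OF regular[OF I(1)]] _ \<pi>_verts[OF I(2) x(1)] _ y])
      show "graph_map (G j) (G i) (\<lambda>y. \<delta> i (\<phi> i j y))"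
        by (rule graph_map_comp[OF G.\<phi>_graph_map[OF ij] \<delta>(1)[OF I(1)]])
      show "graph_map (G j) (G i) (\<lambda>y. \<phi> i j (\<delta> j y))"
        by (rule graph_map_comp[OF \<delta>(1)[OF I(2)] G.\<phi>_graph_map[OF ij]])
      show "g i (\<delta> i (\<phi> i j y)) = g i (\<phi> i j (\<delta> j y))" if "y \<in> elts (G j)" for y
        using that G.\<phi>_in[OF ij that] \<delta>(2) I natural[OF ij] \<delta>_in by simp
      show "\<delta> i (\<phi> i j (G.\<pi> j x)) = \<phi> i j (\<delta> j (G.\<pi> j x))"
        using \<delta>(3) I G.\<pi>_compat[OF ij] x by (simp add: verts_elts)
    qed
  qed
  have "\<exists>z\<in>elts \<Gamma>. \<forall>i\<in>I. G.\<pi> i z = \<delta> i (G.\<pi> i y)" if y: "y \<in> elts \<Gamma>" for y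
  proof (rule G.thread_realized[of "\<lambda>i. \<delta> i (G.\<pi> i y)"])
    show "\<delta> i (G.\<pi> i y) \<in> elts (G i)" if "i \<in> I" for i using \<delta>_in[OF that G.\<pi>_in[OF that y]] .
    show "\<delta> i (G.\<pi> i y) = \<phi> i j (\<delta> j (G.\<pi> j y))" if ij: "(i, j) \<in> r" for i j
      using \<delta>_natural[OF ij, of "G.\<pi> j y"] G.\<pi>_compat[OF ij y] G.\<pi>_in[OF _ y]
        directed_order_carrier[OF G.directed ij] by simp
  qed blast
  then obtain \<gamma> where \<gamma>: "\<And>y. y \<in> elts \<Gamma> \<Longrightarrow> \<gamma> y \<in> elts \<Gamma>"
    "\<And>i y. y \<in> elts \<Gamma> \<Longrightarrow> i \<in> I \<Longrightarrow> G.\<pi> i (\<gamma> y) = \<delta> i (G.\<pi> i y)" by metis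
  \<comment> \<open>A single level decides whether an element of \<Gamma> is a vertex or an
    edge.\<close>
  obtain i0 where i0: "i0 \<in> I" using G.directed by (auto simp: directed_order_def)
  have \<gamma>_verts: "\<gamma> y \<in> verts \<Gamma>" if "y \<in> verts \<Gamma>" for y
    using graph_map_reflects(1)[OF G.\<pi>_graph_map[OF i0] G.graph_G[OF i0] \<gamma>(1)[OF verts_elts[OF that]]]
      graph_mapD(1)[OF \<delta>(1)[OF i0] \<pi>_verts[OF i0 that]] \<gamma>(2)[OF verts_elts[OF that] i0] by simp
  have \<gamma>_edges: "\<gamma> y \<in> edges \<Gamma>" if "y \<in> edges \<Gamma>" for y
    using graph_map_reflects(2)[OF G.\<pi>_graph_map[OF i0] G.graph_G[OF i0] \<gamma>(1)[OF edges_elts[OF that]]]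
      graph_mapD(2)[OF \<delta>(1)[OF i0] graph_mapD(2)[OF G.\<pi>_graph_map[OF i0] that]]
      \<gamma>(2)[OF edges_elts[OF that] i0] by simp
  note gr = is_graphD[OF G.graph]
  have "graph_map \<Gamma> \<Gamma> \<gamma>"
    unfolding graph_map_def
  proof (intro conjI ballI)
    show "\<gamma> ` verts \<Gamma> \<subseteq> verts \<Gamma>" using \<gamma>_verts by blast
    show "\<gamma> ` edges \<Gamma> \<subseteq> edges \<Gamma>" using \<gamma>_edges by blast
    fix e assume e: "e \<in> edges \<Gamma>"
    have el: "src \<Gamma> e \<in> elts \<Gamma>" "tgt \<Gamma> e \<in> elts \<Gamma>" "opp \<Gamma> e \<in> elts \<Gamma>" "e \<in> elts \<Gamma>"
      "src \<Gamma> (\<gamma> e) \<in> elts \<Gamma>" "tgt \<Gamma> (\<gamma> e) \<in> elts \<Gamma>" "opp \<Gamma> (\<gamma> e) \<in> elts \<Gamma>"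
      using gr(1-3)[OF e] gr(1-3)[OF \<gamma>_edges[OF e]] e by (simp_all add: elts_def)
    have "G.\<pi> i (\<gamma> (src \<Gamma> e)) = G.\<pi> i (src \<Gamma> (\<gamma> e)) \<and> G.\<pi> i (\<gamma> (tgt \<Gamma> e)) = G.\<pi> i (tgt \<Gamma> (\<gamma> e)) \<and>
        G.\<pi> i (\<gamma> (opp \<Gamma> e)) = G.\<pi> i (opp \<Gamma> (\<gamma> e))" if i: "i \<in> I" for i
    proof -
      note m = graph_mapD[OF G.\<pi>_graph_map[OF i]]
      show ?thesis
        using m(4-6)[OF e] m(4-6)[OF \<gamma>_edges[OF e]] \<gamma>(2)[OF _ i] el
          graph_mapD(4-6)[OF \<delta>(1)[OF i] m(2)[OF e]] by simp
    qed
    then show "\<gamma> (src \<Gamma> e) = src \<Gamma> (\<gamma> e)" "\<gamma> (tgt \<Gamma> e) = tgt \<Gamma> (\<gamma> e)" "\<gamma> (opp \<Gamma> e) = opp \<Gamma> (\<gamma> e)"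
      using el \<gamma>(1) by (auto intro!: G.\<pi>_inj)
  qed
  moreover have "f (\<gamma> y) = f y" if y: "y \<in> elts \<Gamma>" for y
  proof (rule D.\<pi>_inj[OF f_in[OF \<gamma>(1)[OF y]] f_in[OF y]])
    show "D.\<pi> i (f (\<gamma> y)) = D.\<pi> i (f y)" if i: "i \<in> I" for i
      using g_\<pi>[OF i \<gamma>(1)[OF y]] g_\<pi>[OF i y] \<gamma>(2)[OF y i] \<delta>(2)[OF i G.\<pi>_in[OF i y]] by simp
  qed
  moreover have "\<gamma> x = x'"
    using \<gamma>(2)[OF verts_elts[OF x(1)]] \<delta>(3) \<gamma>(1)[OF verts_elts[OF x(1)]] verts_elts[OF x(2)]
    by (intro G.\<pi>_inj) simp_all
  moreover have "map_prod \<gamma> \<gamma> ` G.kernel i \<subseteq> G.kernel i" if "i \<in> I" for i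
    using \<gamma> that by (auto simp: G.kernel_def)
  moreover have "(y, \<gamma> y) \<in> G.kernel i" if i: "i \<in> I" and xx: "(x, x') \<in> G.kernel i" and y: "y \<in> elts \<Gamma>" for i y
  proof -
    note R = regular_coveringD[OF regular[OF i]]
    have "\<delta> i (G.\<pi> i y) = G.\<pi> i y"
    proof (rule unique_lift[OF R(1,3) \<delta>(1)[OF i] _ R(9) _ \<pi>_verts[OF i x(1)] _ G.\<pi>_in[OF i y]])
      show "graph_map (G i) (G i) (\<lambda>y. y)" by (simp add: graph_map_def)
      show "\<delta> i (G.\<pi> i x) = G.\<pi> i x" using xx \<delta>(3)[OF i] by (simp add: G.kernel_def)
    qed (rule \<delta>(2)[OF i])
    then show ?thesis using y \<gamma>(1)[OF y] \<gamma>(2)[OF y i] by (simp add: G.kernel_def)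
  qed
  ultimately show ?thesis using that by blast
qed

text \<open>For edges, move the source of \<open>x\<close> to that of \<open>x'\<close>; the moved
  edge and \<open>x'\<close> then have the same source and the same image under \<open>f\<close>, so
  they coincide.\<close>

lemma deck_elts:
  assumes x: "x \<in> elts \<Gamma>" "x' \<in> elts \<Gamma>" "f x = f x'"
  obtains \<gamma> where "graph_map \<Gamma> \<Gamma> \<gamma>" "\<And>y. y \<in> elts \<Gamma> \<Longrightarrow> f (\<gamma> y) = f y" "\<gamma> x = x'"
    "\<And>i. i \<in> I \<Longrightarrow> map_prod \<gamma> \<gamma> ` G.kernel i \<subseteq> G.kernel i"
proof (cases "x \<in> verts \<Gamma>")
  case True
  have v: "x' \<in> verts \<Gamma>"
    using graph_map_reflects(1)[OF f_graph_map D.graph x(2)] graph_mapD(1)[OF f_graph_map True] x(3) by simp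
  show ?thesis by (rule deck[OF True v x(3)]) (rule that)
next
  case False
  then have e: "x \<in> edges \<Gamma>" using x(1) by (simp add: elts_def)
  then have e': "x' \<in> edges \<Gamma>"
    using graph_map_reflects(2)[OF f_graph_map D.graph x(2)] graph_mapD(2)[OF f_graph_map e] x(3) by simp
  have "f (src \<Gamma> x) = f (src \<Gamma> x')" using graph_mapD(4)[OF f_graph_map] e e' x(3) by simp
  then obtain \<gamma> where \<gamma>: "graph_map \<Gamma> \<Gamma> \<gamma>" "\<And>y. y \<in> elts \<Gamma> \<Longrightarrow> f (\<gamma> y) = f y" "\<gamma> (src \<Gamma> x) = src \<Gamma> x'"
    "\<And>i. i \<in> I \<Longrightarrow> map_prod \<gamma> \<gamma> ` G.kernel i \<subseteq> G.kernel i"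
    by (rule deck[OF is_graphD(1)[OF G.graph e] is_graphD(1)[OF G.graph e']]) (rule that)
  have "\<gamma> x = x'"
    using locally_injectiveD[OF locally_injective_f, of "\<gamma> x" x'] graph_mapD(2,4)[OF \<gamma>(1) e] e'
      \<gamma>(2)[OF x(1)] \<gamma>(3) x(3) by simp
  then show ?thesis using that \<gamma> by blast
qed

text \<open>The kernel of the projection of \<open>\<Delta>\<close> can be too coarse to be paired with \<open>G.kernel i\<close>,
  since neither projection need be onto; its refinement \<open>image_kernel i\<close> is the right partner.\<close>

definition image_kernel :: "'i \<Rightarrow> ('b \<times> 'b) set" where
  "image_kernel i = map_prod f f ` G.kernel i"

lemma image_kernelI: "(x, y) \<in> G.kernel i \<Longrightarrow> (f x, f y) \<in> image_kernel i"
  by (force simp: image_kernel_def)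

text \<open>The pair upstairs that witnesses \<open>uv\<close> starts at some \<open>c\<close> in
  the fibre of \<open>a\<close>, not necessarily at \<open>a\<close>. A deck map taking
  \<open>c\<close> to \<open>a\<close> preserves the kernel and moves the whole pair into
  place.\<close>

lemma image_kernel_lift:
  assumes i: "i \<in> I" and uv: "(f a, v) \<in> image_kernel i" and a: "a \<in> elts \<Gamma>"
  obtains b where "(a, b) \<in> G.kernel i" "f b = v"
proof -
  obtain c d where cd: "(c, d) \<in> G.kernel i" "f c = f a" "f d = v"
    using uv by (auto simp: image_kernel_def)
  then have el: "c \<in> elts \<Gamma>" "d \<in> elts \<Gamma>" by (auto simp: G.kernel_def)
  obtain \<gamma> where \<gamma>: "\<And>y. y \<in> elts \<Gamma> \<Longrightarrow> f (\<gamma> y) = f y" "\<gamma> c = a"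
    "\<And>i. i \<in> I \<Longrightarrow> map_prod \<gamma> \<gamma> ` G.kernel i \<subseteq> G.kernel i"
    by (rule deck_elts[OF el(1) a cd(2)]) (rule that)
  have "(a, \<gamma> d) \<in> G.kernel i" using \<gamma>(3)[OF i] cd(1) \<gamma>(2) by force
  then show ?thesis using that \<gamma>(1)[OF el(2)] cd(3) by simp
qed

lemma image_kernel_subset:
  assumes "i \<in> I"
  shows "image_kernel i \<subseteq> D.kernel i"
proof -
  have "(f x, f y) \<in> D.kernel i" if "(x, y) \<in> G.kernel i" for x y
    using g_\<pi>[OF assms, of x] g_\<pi>[OF assms, of y] f_in that by (simp add: G.kernel_def D.kernel_def)
  then show ?thesis by (auto simp: image_kernel_def)
qed

lemma equiv_image_kernel:
  assumes i: "i \<in> I"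
  shows "equiv (elts \<Delta>) (image_kernel i)"
proof -
  have "image_kernel i \<subseteq> elts \<Delta> \<times> elts \<Delta>"
    using image_kernel_subset[OF i] by (auto simp: D.kernel_def)
  moreover have "refl_on (elts \<Delta>) (image_kernel i)"
  proof (rule refl_onI)
    fix u assume u: "u \<in> elts \<Delta>"
    obtain x where "x \<in> elts \<Gamma>" "u = f x" using u surj_f by blast
    then show "(u, u) \<in> image_kernel i" using image_kernelI[of x x i] by (simp add: G.kernel_def)
  qed
  moreover have "sym (image_kernel i)"
    by (rule symI) (force simp: image_kernel_def G.kernel_def)
  moreover have "trans (image_kernel i)"
  proof (rule transI)
    fix u v w assume uv: "(u, v) \<in> image_kernel i" and vw: "(v, w) \<in> image_kernel i"
    obtain a b where ab: "(a, b) \<in> G.kernel i" "u = f a" "v = f b" using uv by (auto simp: image_kernel_def)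
    then have "b \<in> elts \<Gamma>" by (simp add: G.kernel_def)
    \<comment> \<open>The point over \<open>v\<close> in a witness of the second pair may differ
      from \<open>b\<close>; lifting the second pair at \<open>b\<close> makes the witnesses
      composable.\<close>
    then obtain c where c: "(b, c) \<in> G.kernel i" "f c = w"
      using image_kernel_lift[OF i vw[unfolded ab(3)]] by blast
    have "(a, c) \<in> G.kernel i" using ab(1) c(1) by (simp add: G.kernel_def)
    then show "(u, w) \<in> image_kernel i" using image_kernelI ab(2) c(2) by blast
  qed
  ultimately show ?thesis by (simp add: equiv_def)
qed

text \<open>The preimage of a class under \<open>f\<close> is a union of open kernel classes. Its
  complement is compact, so the image of this complement is closed in the Hausdorff space \<Delta>;
  since \<open>f\<close> is onto, this image is the complement of the class. Vertices stay apart
  from edges, and edges from their opposites, because this already holds for the coarser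
  \<open>D.kernel i\<close>.\<close>

lemma compatible_cofinite_entourage_image_kernel:
  assumes i: "i \<in> I"
  shows "compatible_cofinite_entourage \<Delta> (image_kernel i)"
  unfolding compatible_cofinite_entourage_def
proof (intro conjI)
  interpret R: compatible_equivalence \<Gamma> "G.kernel i"
    by (rule G.compatible_equivalence[OF G.compatible_cofinite_entourage_kernel[OF i]])
  interpret S: compatible_equivalence \<Delta> "D.kernel i"
    by (rule D.compatible_equivalence[OF D.compatible_cofinite_entourage_kernel[OF i]])
  note eq = equiv_image_kernel[OF i]
  have "openin D.\<T> (image_kernel i `` {u})" if u: "u \<in> elts \<Delta>" for u
  proof -
    let ?C = "image_kernel i `` {u}"
    let ?P = "{y \<in> elts \<Gamma>. f y \<in> ?C}"
    have "?P = (\<Union>y\<in>?P. G.kernel i `` {y})"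
    proof (intro equalityI subsetI)
      fix z assume "z \<in> (\<Union>y\<in>?P. G.kernel i `` {y})"
      then obtain y where y: "(u, f y) \<in> image_kernel i" "(y, z) \<in> G.kernel i" by auto
      have "(u, f z) \<in> image_kernel i"
        using y(1) image_kernelI[OF y(2)] eq by (auto simp: equiv_def dest: transD)
      then show "z \<in> ?P" using y(2) by (auto simp: G.kernel_def)
    qed (use R.rel_refl in auto)
    moreover have "openin G.\<T> (\<Union>y\<in>?P. G.kernel i `` {y})"
      using G.open_equiv_kernel[OF i] by (auto simp: G.open_equiv_def)
    ultimately have "openin G.\<T> ?P" by simp
    then have "closedin G.\<T> (elts \<Gamma> - ?P)" by (metis closedin_diff closedin_topspace G.topspace)
    then have "compactin G.\<T> (elts \<Gamma> - ?P)" by (rule closedin_compact_space[OF G.compact])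
    moreover have "continuous_map G.\<T> D.\<T> f" using f by (simp add: continuous_graph_map_def)
    ultimately have "compactin D.\<T> (f ` (elts \<Gamma> - ?P))" by (rule image_compactin)
    then have "closedin D.\<T> (f ` (elts \<Gamma> - ?P))" by (rule compactin_imp_closedin[OF D.Hausdorff])
    moreover have "f ` (elts \<Gamma> - ?P) = elts \<Delta> - ?C" using surj_f by auto
    moreover have "?C \<subseteq> elts \<Delta>" using eq by (auto simp: equiv_def)
    ultimately show ?thesis
      by (metis D.topspace openin_closedin_eq)
  qed
  then have "D.open_equiv (image_kernel i)" using eq by (simp add: D.open_equiv_def)
  then show "entourage \<Delta> (image_kernel i)" by (rule D.open_equiv_entourage)
  show "compatible_equiv \<Delta> (image_kernel i)"
    unfolding compatible_equiv_def
  proof (intro conjI ballI impI)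
    show "(v, e) \<notin> image_kernel i" if "v \<in> verts \<Delta>" "e \<in> edges \<Delta>" for v e
      using that image_kernel_subset[OF i] S.edge_iff[of v e] is_graphD(4)[OF D.graph] by blast
    show "(e, opp \<Delta> e) \<notin> image_kernel i" if "e \<in> edges \<Delta>" for e
      using S.opp_not_rel[OF that] image_kernel_subset[OF i] by blast
    fix e e' assume e: "e \<in> edges \<Delta>" "e' \<in> edges \<Delta>" "(e, e') \<in> image_kernel i"
    then obtain c d where cd: "(c, d) \<in> G.kernel i" "e = f c" "e' = f d" by (auto simp: image_kernel_def)
    then have "c \<in> edges \<Gamma>" "d \<in> edges \<Gamma>"
      using graph_map_reflects(2)[OF f_graph_map D.graph] e(1,2) R.in_elts by blast+
    then show "(src \<Delta> e, src \<Delta> e') \<in> image_kernel i" "(tgt \<Delta> e, tgt \<Delta> e') \<in> image_kernel i"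
      "(opp \<Delta> e, opp \<Delta> e') \<in> image_kernel i"
      using R.edge_rel[OF cd(1)] image_kernelI graph_mapD(4-6)[OF f_graph_map] cd(2,3) by metis+
  qed (rule eq)
  have "elts \<Delta> // image_kernel i \<subseteq> quotient_map_of (image_kernel i) f ` (elts \<Gamma> // G.kernel i)"
  proof
    fix A assume "A \<in> elts \<Delta> // image_kernel i"
    then obtain u where u: "u \<in> elts \<Delta>" "A = image_kernel i `` {u}" by (rule quotientE)
    have "u \<in> f ` elts \<Gamma>" using u(1) surj_f by simp
    then obtain x where "x \<in> elts \<Gamma>" "u = f x" by blast
    then have x: "x \<in> elts \<Gamma>" "A = image_kernel i `` {f x}" using u(2) by auto
    have "quotient_map_of (image_kernel i) f (G.kernel i `` {x}) = A"
      using R.quotient_map_of_class[OF x(1) eq] x(2) by (simp add: image_kernel_def)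
    then show "A \<in> quotient_map_of (image_kernel i) f ` (elts \<Gamma> // G.kernel i)"
      using x(1) by (auto simp: quotient_def)
  qed
  then show "finite (elts \<Delta> // image_kernel i)"
    using G.compatible_cofinite_entourage_kernel[OF i]
    by (auto simp: compatible_cofinite_entourage_def intro: finite_subset)
qed

text \<open>A path of \<open>G j\<close> need not lift to \<Gamma>, but the image in
  \<open>G i\<close> of each of its edges comes from an edge of \<Gamma>. Consecutive edges found in
  this way fit together only up to \<open>G.kernel i\<close>, which is exactly what a path in the
  quotient needs.\<close>

lemma path_connected_quotient:
  assumes i: "i \<in> I"
  shows "path_connected_graph (quotient_graph \<Gamma> (G.kernel i))"
proof -
  interpret R: compatible_equivalence \<Gamma> "G.kernel i"
    by (rule G.compatible_equivalence[OF G.compatible_cofinite_entourage_kernel[OF i]])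
  let ?X = "quotient_graph \<Gamma> (G.kernel i)"
  \<comment> \<open>Finite nonempty levels have a thread; this is why \<Gamma> is nonempty.\<close>
  obtain x where x: "x \<in> elts \<Gamma>"
  proof (rule G.finite_subsystem_realized[of "\<lambda>i. elts (G i)"])
    show "elts (G i) \<noteq> {}" if "i \<in> I" for i
      using regular_coveringD(3)[OF regular[OF that]] by (simp add: path_connected_graph_def)
  qed (use G.\<phi>_in in auto)
  obtain j where ij: "(i, j) \<in> r" and im: "\<phi> i j ` elts (G j) \<subseteq> G.\<pi> i ` elts \<Gamma>"
    using G.image_stabilizes[OF i] .
  then have j: "j \<in> I" using directed_order_carrier[OF G.directed] by blast
  note m = graph_mapD[OF G.\<pi>_graph_map[OF i]] and mj = graph_mapD[OF G.\<phi>_graph_map[OF ij]]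
  have path: "\<exists>q. edge_path ?X (G.kernel i `` {a}) q (G.kernel i `` {b})"
    if "edge_path (G j) u p w" "a \<in> verts \<Gamma>" "b \<in> verts \<Gamma>" "G.\<pi> i a = \<phi> i j u" "G.\<pi> i b = \<phi> i j w"
    for u p w a b
    using that
  proof (induction p arbitrary: u a)
    case Nil
    then have "(a, b) \<in> G.kernel i" by (auto simp: G.kernel_def verts_elts)
    moreover have "G.kernel i `` {a} \<in> verts ?X"
      using Nil.prems(2) by (simp add: R.verts_quotient_graph)
    ultimately have "edge_path ?X (G.kernel i `` {a}) [] (G.kernel i `` {b})"
      using R.class_eq[of a b] by simp
    then show ?case by blast
  next
    case (Cons e p)
    then have e: "e \<in> edges (G j)" "src (G j) e = u" "edge_path (G j) (tgt (G j) e) p w" by auto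
    obtain c where c: "c \<in> elts \<Gamma>" "G.\<pi> i c = \<phi> i j e" using im edges_elts[OF e(1)] by force
    then have ce: "c \<in> edges \<Gamma>"
      using graph_map_reflects(2)[OF G.\<pi>_graph_map[OF i] G.graph_G[OF i] c(1)] mj(2)[OF e(1)] by simp
    have s: "src \<Gamma> c \<in> verts \<Gamma>" and t: "tgt \<Gamma> c \<in> verts \<Gamma>" using is_graphD(1,2)[OF G.graph ce] by auto
    have "G.\<pi> i (tgt \<Gamma> c) = \<phi> i j (tgt (G j) e)" using m(5)[OF ce] mj(5)[OF e(1)] c(2) by simp
    from Cons.IH[OF e(3) t Cons.prems(3) this Cons.prems(5)] obtain q
      where q: "edge_path ?X (G.kernel i `` {tgt \<Gamma> c}) q (G.kernel i `` {b})" by blast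
    have "G.\<pi> i (src \<Gamma> c) = G.\<pi> i a"
      using m(4)[OF ce] mj(4)[OF e(1)] c(2) e(2) Cons.prems(4) by simp
    then have "G.kernel i `` {src \<Gamma> c} = G.kernel i `` {a}"
      using s Cons.prems(2) by (intro R.class_eq) (simp add: G.kernel_def verts_elts)
    then have "edge_path ?X (G.kernel i `` {a}) (G.kernel i `` {c} # q) (G.kernel i `` {b})"
      using q ce by (simp add: R.quotient_graph_simps R.edges_quotient_graph)
    then show ?case by blast
  qed
  show ?thesis
    unfolding path_connected_graph_def
  proof (intro conjI ballI)
    show "elts ?X \<noteq> {}" using x by (auto simp: R.elts_quotient_graph quotient_def)
    fix v w assume "v \<in> verts ?X" "w \<in> verts ?X"
    then obtain a b where ab: "a \<in> verts \<Gamma>" "v = G.kernel i `` {a}" "b \<in> verts \<Gamma>" "w = G.kernel i `` {b}"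
      by (auto simp: R.verts_quotient_graph)
    have "G.\<pi> j a \<in> verts (G j)" "G.\<pi> j b \<in> verts (G j)"
      using graph_mapD(1)[OF G.\<pi>_graph_map[OF j]] ab(1,3) by auto
    then obtain p where "edge_path (G j) (G.\<pi> j a) p (G.\<pi> j b)"
      using regular_coveringD(3)[OF regular[OF j]] unfolding path_connected_graph_def by blast
    from path[OF this ab(1,3)] show "\<exists>p. edge_path ?X v p w"
      using G.\<pi>_compat[OF ij] ab by (simp add: verts_elts)
  qed
qed

lemma locally_bijective_quotient:
  assumes i: "i \<in> I"
  shows "locally_bijective (quotient_graph \<Gamma> (G.kernel i)) (quotient_graph \<Delta> (image_kernel i))
    (quotient_map_of (image_kernel i) f)"
proof -
  interpret R: compatible_equivalence \<Gamma> "G.kernel i"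
    by (rule G.compatible_equivalence[OF G.compatible_cofinite_entourage_kernel[OF i]])
  interpret S: compatible_equivalence \<Delta> "image_kernel i"
    by (rule D.compatible_equivalence[OF compatible_cofinite_entourage_image_kernel[OF i]])
  let ?R = "G.kernel i" and ?S = "image_kernel i"
  let ?X = "quotient_graph \<Gamma> ?R" and ?Y = "quotient_graph \<Delta> ?S" and ?q = "quotient_map_of ?S f"
  have q: "?q (?R `` {x}) = ?S `` {f x}" if "x \<in> elts \<Gamma>" for x
    using R.quotient_map_of_class[OF that S.equiv] by (simp add: image_kernel_def)
  have gm: "graph_map ?X ?Y ?q"
    using graph_map_quotient_map[OF R.compatible_equivalence_axioms S.compatible_equivalence_axioms f_graph_map]
    by (simp add: image_kernel_def)
  note m = graph_mapD[OF f_graph_map] and gr = is_graphD[OF G.graph] and dgr = is_graphD[OF D.graph]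
  show ?thesis
    unfolding locally_bijective_def
  proof (intro ballI)
    fix v assume "v \<in> verts ?X"
    then obtain a where a: "a \<in> verts \<Gamma>" "v = ?R `` {a}" by (auto simp: R.verts_quotient_graph)
    show "bij_betw ?q {e \<in> edges ?X. src ?X e = v} {e \<in> edges ?Y. src ?Y e = ?q v}"
      unfolding bij_betw_def
    proof
      show "inj_on ?q {e \<in> edges ?X. src ?X e = v}"
      proof (rule inj_onI)
        fix A A' assume A: "A \<in> {e \<in> edges ?X. src ?X e = v}" "A' \<in> {e \<in> edges ?X. src ?X e = v}" "?q A = ?q A'"
        then obtain e e' where e: "e \<in> edges \<Gamma>" "A = ?R `` {e}" "e' \<in> edges \<Gamma>" "A' = ?R `` {e'}"
          by (auto simp: R.edges_quotient_graph)
        have "?R `` {src \<Gamma> e} = ?R `` {src \<Gamma> e'}"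
          using A(1,2) e by (simp add: R.quotient_graph_simps)
        then have ss: "(src \<Gamma> e, src \<Gamma> e') \<in> ?R"
          using R.class_eq_iff verts_elts gr(1) e(1,3) by metis
        have "?S `` {f e} = ?S `` {f e'}" using A(3) e q by (simp add: edges_elts)
        then have "(f e, f e') \<in> ?S" using S.class_eq_iff m(3) edges_elts e(1,3) by metis
        \<comment> \<open>The images of \<open>e\<close> and \<open>e'\<close> are merely
          equivalent. Replacing \<open>e\<close> inside its class by \<open>b\<close> makes them
          equal, so that the sources of \<open>b\<close> and \<open>e'\<close> lie in one fibre of
          \<open>f\<close> as well as in one kernel class.\<close>
        then obtain b where b: "(e, b) \<in> ?R" "f b = f e'"
          using image_kernel_lift[OF i _ edges_elts[OF e(1)]] by blast
        have be: "b \<in> edges \<Gamma>" using R.edge_iff[OF b(1)] e(1) by simp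
        have sb: "(src \<Gamma> b, src \<Gamma> e') \<in> ?R"
          using R.edge_rel(1)[OF b(1) e(1)] ss R.rel_sym R.rel_trans by blast
        have "f (src \<Gamma> b) = f (src \<Gamma> e')" using m(4)[OF be] m(4)[OF e(3)] b(2) by simp
        \<comment> \<open>This deck map carries \<open>b\<close> to \<open>e'\<close> and is trivial
          modulo the kernel, hence the two edges are equivalent.\<close>
        then obtain \<gamma> where
          \<gamma>: "graph_map \<Gamma> \<Gamma> \<gamma>" "\<And>y. y \<in> elts \<Gamma> \<Longrightarrow> f (\<gamma> y) = f y" "\<gamma> (src \<Gamma> b) = src \<Gamma> e'"
          "\<And>i y. i \<in> I \<Longrightarrow> (src \<Gamma> b, src \<Gamma> e') \<in> G.kernel i \<Longrightarrow> y \<in> elts \<Gamma> \<Longrightarrow> (y, \<gamma> y) \<in> G.kernel i"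
          by (rule deck[OF gr(1)[OF be] gr(1)[OF e(3)]]) (rule that)
        have "\<gamma> b = e'"
          using locally_injectiveD[OF locally_injective_f, of "\<gamma> b" e'] graph_mapD(2,4)[OF \<gamma>(1) be] e(3)
            \<gamma>(2)[OF edges_elts[OF be]] \<gamma>(3) b(2) by simp
        then have "(b, e') \<in> ?R" using \<gamma>(4)[OF i sb edges_elts[OF be]] by simp
        then have "(e, e') \<in> ?R" using b(1) R.rel_trans by blast
        then show "A = A'" using e R.class_eq by simp
      qed
      show "?q ` {e \<in> edges ?X. src ?X e = v} = {e \<in> edges ?Y. src ?Y e = ?q v}"
      proof (intro equalityI subsetI)
        fix B assume "B \<in> ?q ` {e \<in> edges ?X. src ?X e = v}"
        then show "B \<in> {e \<in> edges ?Y. src ?Y e = ?q v}"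
          using graph_mapD(2,4)[OF gm] by auto
      next
        fix B assume B: "B \<in> {e \<in> edges ?Y. src ?Y e = ?q v}"
        then obtain d where d: "d \<in> edges \<Delta>" "B = ?S `` {d}" by (auto simp: S.edges_quotient_graph)
        have "?S `` {f a} = ?S `` {src \<Delta> d}"
          using B d a q[OF verts_elts[OF a(1)]] by (simp add: S.quotient_graph_simps)
        then have "(f a, src \<Delta> d) \<in> ?S"
          using S.class_eq_iff[OF m(3)[OF verts_elts[OF a(1)]] verts_elts[OF dgr(1)[OF d(1)]]] by simp
        \<comment> \<open>\<open>lift_edge\<close> requires a vertex exactly over the source of
          \<open>d\<close>; the class of \<open>a\<close> contains one.\<close>
        then obtain b where b: "(a, b) \<in> ?R" "f b = src \<Delta> d"
          using image_kernel_lift[OF i _ verts_elts[OF a(1)]] by blast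
        have "b \<in> verts \<Gamma>" using R.vert_iff[OF b(1)] a(1) by simp
        then obtain e where e: "e \<in> edges \<Gamma>" "src \<Gamma> e = b" "f e = d"
          using lift_edge[OF _ d(1) b(2)[symmetric]] by blast
        have "?q (?R `` {e}) = B" using q[OF edges_elts[OF e(1)]] e(3) d(2) by simp
        moreover have "src ?X (?R `` {e}) = v"
          using R.quotient_graph_simps(1)[OF e(1)] e(2) a(2) R.class_eq[OF b(1)] by simp
        moreover have "?R `` {e} \<in> edges ?X" using e(1) by (simp add: R.edges_quotient_graph)
        ultimately show "B \<in> ?q ` {e \<in> edges ?X. src ?X e = v}" by blast
      qed
    qed
  qed
qed

text \<open>Deck maps of \<Gamma> preserve the kernel and so descend to the quotient. Two vertex
  classes with the same image have representatives in one fibre of \<open>f\<close>, so the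
  descended maps are transitive in the way that \<open>regular_coveringI\<close> asks for.\<close>

lemma regular_good_pair_kernel:
  assumes i: "i \<in> I"
  shows "regular_good_pair \<Gamma> \<Delta> f (G.kernel i) (image_kernel i)"
proof -
  let ?R = "G.kernel i" and ?S = "image_kernel i"
  note cR = G.compatible_cofinite_entourage_kernel[OF i]
    and cS = compatible_cofinite_entourage_image_kernel[OF i]
  interpret R: compatible_equivalence \<Gamma> ?R by (rule G.compatible_equivalence[OF cR])
  interpret S: compatible_equivalence \<Delta> ?S by (rule D.compatible_equivalence[OF cS])
  let ?X = "quotient_graph \<Gamma> ?R" and ?Y = "quotient_graph \<Delta> ?S" and ?q = "quotient_map_of ?S f"
  have sub: "map_prod f f ` ?R \<subseteq> ?S" by (simp add: image_kernel_def)
  have q: "?q (?R `` {x}) = ?S `` {f x}" if "x \<in> elts \<Gamma>" for x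
    using R.quotient_map_of_class[OF that S.equiv sub] .
  have gm: "graph_map ?X ?Y ?q"
    using graph_map_quotient_map[OF R.compatible_equivalence_axioms S.compatible_equivalence_axioms f_graph_map sub] .
  have lb: "locally_bijective ?X ?Y ?q" by (rule locally_bijective_quotient[OF i])
  have "regular_covering ?X ?Y ?q"
  proof (rule regular_coveringI)
    show "is_graph ?X" by (rule R.is_graph_quotient)
    show Y: "is_graph ?Y" by (rule S.is_graph_quotient)
    show "finite (elts ?X)" "finite (elts ?Y)"
      using cR cS by (auto simp: compatible_cofinite_entourage_def R.elts_quotient_graph S.elts_quotient_graph)
    show "path_connected_graph ?X" by (rule path_connected_quotient[OF i])
    then show "path_connected_graph ?Y"
    proof (rule path_connected_graph_image[OF _ gm _ Y])
      have "?q ` elts ?X = (\<lambda>x. ?q (?R `` {x})) ` elts \<Gamma>"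
        by (auto simp: R.elts_quotient_graph quotient_def)
      also have "\<dots> = (\<lambda>y. ?S `` {y}) ` f ` elts \<Gamma>" by (simp add: q image_image cong: image_cong)
      finally show "?q ` elts ?X = elts ?Y"
        by (auto simp: surj_f S.elts_quotient_graph quotient_def)
    qed
    show "graph_map ?X ?Y ?q" by (rule gm)
    show "locally_bijective ?X ?Y ?q" by (rule lb)
    fix x x' assume "x \<in> verts ?X" "x' \<in> verts ?X" and qx: "?q x = ?q x'"
    then obtain a a' where a: "a \<in> verts \<Gamma>" "x = ?R `` {a}" "a' \<in> verts \<Gamma>" "x' = ?R `` {a'}"
      by (auto simp: R.verts_quotient_graph)
    have "(f a, f a') \<in> ?S"
      using qx a q S.class_eq_iff f_in by (simp add: verts_elts)
    then obtain b where b: "(a, b) \<in> ?R" "f b = f a'"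
      using image_kernel_lift[OF i _ verts_elts[OF a(1)]] by blast
    have "b \<in> verts \<Gamma>" using R.vert_iff[OF b(1)] a(1) by simp
    then obtain \<gamma> where \<gamma>: "graph_map \<Gamma> \<Gamma> \<gamma>"
      "\<And>y. y \<in> elts \<Gamma> \<Longrightarrow> f (\<gamma> y) = f y" "\<gamma> b = a'"
      "\<And>i. i \<in> I \<Longrightarrow> map_prod \<gamma> \<gamma> ` G.kernel i \<subseteq> G.kernel i"
      by (rule deck[OF _ a(3) b(2)]) (rule that)
    let ?d = "quotient_map_of ?R \<gamma>"
    have d: "?d (?R `` {y}) = ?R `` {\<gamma> y}" if "y \<in> elts \<Gamma>" for y
      using R.quotient_map_of_class[OF that R.equiv \<gamma>(4)[OF i]] .
    have "graph_map ?X ?X ?d"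
      using graph_map_quotient_map[OF R.compatible_equivalence_axioms R.compatible_equivalence_axioms \<gamma>(1) \<gamma>(4)[OF i]] .
    moreover have "?q (?d y) = ?q y" if "y \<in> elts ?X" for y
    proof -
      obtain z where "z \<in> elts \<Gamma>" "y = ?R `` {z}"
        using \<open>y \<in> elts ?X\<close> by (auto simp: R.elts_quotient_graph quotient_def)
      then show ?thesis using d q graph_mapD(3)[OF \<gamma>(1)] \<gamma>(2) by simp
    qed
    moreover have "?d x = x'"
      using d[of b] R.in_elts[OF b(1)] \<gamma>(3) a R.class_eq[OF b(1)] by simp
    ultimately show "\<exists>d. graph_map ?X ?X d \<and> (\<forall>y\<in>elts ?X. ?q (d y) = ?q y) \<and> d x = x'" by blast
  qed
  then show ?thesis
    using cR cS sub lb by (simp add: regular_good_pair_def good_pair_def)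
qed

lemma fundamental_system:
  "fundamental_system_of_regular_good_pairs \<Gamma> \<Delta> f ((\<lambda>i. (G.kernel i, image_kernel i)) ` I)"
  unfolding fundamental_system_of_regular_good_pairs_def
proof (intro conjI allI impI)
  show "\<forall>(R, S)\<in>(\<lambda>i. (G.kernel i, image_kernel i)) ` I. regular_good_pair \<Gamma> \<Delta> f R S"
    using regular_good_pair_kernel by auto
  fix V W assume "entourage \<Gamma> V" "entourage \<Delta> W"
  then obtain i j where i: "i \<in> I" "G.kernel i \<subseteq> V" and j: "j \<in> I" "D.kernel j \<subseteq> W"
    using G.kernel_refines D.kernel_refines by metis
  \<comment> \<open>\<open>i\<close> is fine enough for \<open>V\<close> and \<open>j\<close> for
    \<open>W\<close>. An index above both serves the pair because \<open>image_kernel l\<close> is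
    contained in \<open>D.kernel l\<close>.\<close>
  obtain l where l: "l \<in> I" "(i, l) \<in> r" "(j, l) \<in> r"
    using G.directed i(1) j(1) unfolding directed_order_def by blast
  have "G.kernel l \<subseteq> V" "image_kernel l \<subseteq> W"
    using G.kernel_mono[OF l(2)] i(2) image_kernel_subset[OF l(1)] D.kernel_mono[OF l(3)] j(2) by blast+
  then show "\<exists>(R, S)\<in>(\<lambda>i. (G.kernel i, image_kernel i)) ` I. R \<subseteq> V \<and> S \<subseteq> W" using l(1) by auto
qed

end

text \<open>The types of the inverse system disappear from the conclusion. Combined with
  \<open>profinite_regular_coveringI\<close> this moves a covering from any types to the ones fixed
  in \<open>profinite_regular_covering\<close>.\<close>

lemma regular_covering_over_imp_fundamental_system:
  fixes \<Gamma> :: "'a unif_graph" and \<Delta> :: "'b unif_graph"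
  assumes "regular_covering_over TYPE('i) TYPE('c) TYPE('d) \<Gamma> \<Delta> f"
  shows "\<exists>I. fundamental_system_of_regular_good_pairs \<Gamma> \<Delta> f I"
proof -
  obtain I :: "'i set" and r and G :: "'i \<Rightarrow> 'c top_graph" and D :: "'i \<Rightarrow> 'd top_graph" and g \<phi> \<psi>
    where fin: "\<And>i. i \<in> I \<Longrightarrow> finite_discrete_graph (G i) \<and> finite_discrete_graph (D i) \<and>
        regular_covering (G i) (D i) (g i)"
      and lim: "is_inverse_limit_of_maps (top_graph_of \<Gamma>) (top_graph_of \<Delta>) f I r G D g \<phi> \<psi>"
    using assms unfolding regular_covering_over_def by blast
  obtain h k where hk: "top_graph_isomorphism (top_graph_of \<Gamma>) (inverse_limit I r G \<phi>) h"
      "top_graph_isomorphism (top_graph_of \<Delta>) (inverse_limit I r D \<psi>) k"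
      "\<And>x. x \<in> elts \<Gamma> \<Longrightarrow> k (f x) = limit_map I g (h x)"
    and sys: "inverse_system_of_maps I r G D g \<phi> \<psi>"
    using lim unfolding is_inverse_limit_of_maps_def by auto
  have sys': "inverse_system I r G \<phi>" "inverse_system I r D \<psi>"
    "\<And>i j x. (i, j) \<in> r \<Longrightarrow> x \<in> elts (G j) \<Longrightarrow> g i (\<phi> i j x) = \<psi> i j (g j x)"
    using sys unfolding inverse_system_of_maps_def by auto
  interpret regular_covering_system \<Gamma> \<Delta> I r G \<phi> h D \<psi> k f g
    using assms fin hk sys' by unfold_locales (auto simp: regular_covering_over_def)
  show ?thesis using fundamental_system by blast
qed

theorem theorem20:
  fixes \<Gamma> :: "'a unif_graph" and \<Delta> :: "'b unif_graph" and f :: "'a \<Rightarrow> 'b"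
  assumes "profinite_graph \<Gamma>" and "profinite_graph \<Delta>"
    and "continuous_graph_map (top_graph_of \<Gamma>) (top_graph_of \<Delta>) f"
  shows "(profinite_regular_covering \<Gamma> \<Delta> f \<longleftrightarrow>
            (\<exists>I. fundamental_system_of_regular_good_pairs \<Gamma> \<Delta> f I)) \<and>
         (regular_covering_over TYPE('i) TYPE('c) TYPE('d) \<Gamma> \<Delta> f \<longrightarrow>
            profinite_regular_covering \<Gamma> \<Delta> f)"
proof (intro conjI iffI impI)
  show "\<exists>I. fundamental_system_of_regular_good_pairs \<Gamma> \<Delta> f I" if "profinite_regular_covering \<Gamma> \<Delta> f"
    using that unfolding profinite_regular_covering_def
    by (rule regular_covering_over_imp_fundamental_system)
  show "profinite_regular_covering \<Gamma> \<Delta> f" if "\<exists>I. fundamental_system_of_regular_good_pairs \<Gamma> \<Delta> f I"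
    using that profinite_regular_coveringI[OF assms] by blast
  then show "profinite_regular_covering \<Gamma> \<Delta> f"
    if "regular_covering_over TYPE('i) TYPE('c) TYPE('d) \<Gamma> \<Delta> f"
    using regular_covering_over_imp_fundamental_system[OF that] by blast
qed

end
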